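(* Let $M$ be a $C^\infty$ Riemannian manifold of dimension $n\ge 2$ and let $\Sigma\subset M\times\mathbb{R}$ be a vertical helicoid with nonvanishing angle function. Assume that each horizontal section $\Sigma_t\subset\Sigma$ is totally geodesic in $M\times\{t\}$. Then, given $x_0\in\Sigma$, there exist $\epsilon>0$, a connected open set $\Sigma'\ni x_0$ of $\Sigma$, a hypersurface $\mathfrak{L}_0\subset\pi_M(\Sigma')\subset M$, and a one-parameter group of isometries $$\Gamma_t:\pi_M(\Sigma')\to\Gamma_t(\pi_M(\Sigma'))\subset M,\qquad t\in(-\epsilon,\epsilon),$$ such that $\Sigma'$ is the $1$-pitched twisting of $\mathfrak{L}_0$ determined by $\{\Gamma_t\,;\,t\in(-\epsilon,\epsilon)\}$, that is, $$\Sigma'=\{(\Gamma_t(p),t)\in\Sigma\,;\,p\in\mathfrak{L}_0,\ t\in(-\epsilon,\epsilon)\}.$$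
   Context: $M\times\mathbb{R}$ carries the product metric $\langle\,,\rangle=\langle\,,\rangle_M+dt^2$ with Levi-Civita connection $\overline\nabla$; $\partial_t$ is the unit vertical field and $\pi_M:M\times\mathbb{R}\to M$ is the projection. For an orientable hypersurface $\Sigma\subset M\times\mathbb{R}$ with unit normal $N$: the shape operator is $AX=-\overline\nabla_XN$; the height function $\xi$ is the restriction to $\Sigma$ of the projection onto $\mathbb{R}$, with gradient $\nabla\xi$ on $\Sigma$; $\Theta=\langle N,\partial_t\rangle$ is the angle function. A horizontal point is a point where $\Theta^2=1$ (a critical point of $\xi$). A horizontal section of $\Sigma$ is $\Sigma_t=\Sigma\cap(M\times\{t\})$ when the intersection is transversal. Vertical helicoid: a hypersurface with no horizontal points and nonconstant angle function whose horizontal sections $\Sigma_t$ are minimal hypersurfaces of $M\times\{t\}$ and such that $\langle A\nabla\xi,\nabla\xi\rangle=0$ on $\Sigma$. For $a>0$, the $a$-pitched twisting of a hypersurface $\Sigma_0\subset M$ determined by a one-parameter group of isometries $\{\Gamma_s\,;\,s\in I\}$ ($I\ni0$ an open interval, $\Gamma_0$ the identity) is the hypersurface $\{(\Gamma_s(p),as)\,;\,p\in\Sigma_0,\ s\in I\}$ of $M\times\mathbb{R}$. In the claim, where the maps $\Gamma_t$ are defined only on $\pi_M(\Sigma')$, "one-parameter group" is understood locally: $\Gamma_0$ is the identity and $\Gamma_{t+s}=\Gamma_t\circ\Gamma_s$ wherever both sides are defined; each $\Gamma_t$ is an isometry onto its image.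
   Formalization: The displayed equation is proved up to the vertical translation by the height of x_0: Σ' = {(Γ_t(p), ξ(x_0)+t)}; as displayed, it fails when Σ has no point at height 0, e.g. a half-helicoid over heights (4,6). For ξ(x_0)=0 it is the formula as stated. *)

theory Defs
  imports "HOL-Analysis.Analysis"
begin

section \<open>Smooth functions between Euclidean spaces\<close>

text \<open>The domain \<open>U\<close> is meant to be open.\<close>

primrec Ck_on :: "nat \<Rightarrow> 'e::euclidean_space set \<Rightarrow> ('e \<Rightarrow> 'f::euclidean_space) \<Rightarrow> bool" where
  "Ck_on 0 = (\<lambda>U f. continuous_on U f)"
| "Ck_on (Suc k) = (\<lambda>U f. (\<forall>x\<in>U. f differentiable (at x)) \<and>
      (\<forall>v. Ck_on k U (\<lambda>x. frechet_derivative f (at x) v)))"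

definition smooth_on :: "'e::euclidean_space set \<Rightarrow> ('e \<Rightarrow> 'f::euclidean_space) \<Rightarrow> bool" where
  "smooth_on U f \<longleftrightarrow> (\<forall>k. Ck_on k U f)"

text \<open>Smoothness on an arbitrary subset: local existence of smooth extensions.\<close>

definition smooth_along :: "'e::euclidean_space set \<Rightarrow> ('e \<Rightarrow> 'f::euclidean_space) \<Rightarrow> bool" where
  "smooth_along T f \<longleftrightarrow> (\<forall>x\<in>T. \<exists>W F. open W \<and> x \<in> W \<and> smooth_on W F \<and> (\<forall>y\<in>W \<inter> T. F y = f y))"


section \<open>Smooth manifolds\<close>

text \<open>
  A manifold is a type of sort \<open>{t2_space, second_countable_topology}\<close> with a smooth atlas
  whose charts take values in a Euclidean space \<open>'e\<close>; its dimension is \<open>DIM('e)\<close>. A chart is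
  a pair of its domain and its coordinate map; the coordinate map is irrelevant off the domain.
\<close>

type_synonym ('a, 'e) chart = "'a set \<times> ('a \<Rightarrow> 'e)"

abbreviation cdom :: "('a, 'e) chart \<Rightarrow> 'a set" where "cdom \<equiv> fst"
abbreviation cmap :: "('a, 'e) chart \<Rightarrow> 'a \<Rightarrow> 'e" where "cmap \<equiv> snd"

definition cinv :: "('a, 'e) chart \<Rightarrow> 'e \<Rightarrow> 'a" where
  "cinv c = inv_into (cdom c) (cmap c)"

definition is_chart :: "('a::topological_space, 'e::euclidean_space) chart \<Rightarrow> bool" where
  "is_chart c \<longleftrightarrow> open (cdom c) \<and> open (cmap c ` cdom c) \<and>
     homeomorphism (cdom c) (cmap c ` cdom c) (cmap c) (cinv c)"

definition smooth_compat ::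
    "('a::topological_space, 'e::euclidean_space) chart \<Rightarrow> ('a, 'e) chart \<Rightarrow> bool" where
  "smooth_compat c d \<longleftrightarrow>
     smooth_on (cmap c ` (cdom c \<inter> cdom d)) (cmap d \<circ> cinv c) \<and>
     smooth_on (cmap d ` (cdom c \<inter> cdom d)) (cmap c \<circ> cinv d)"

definition smooth_atlas :: "('a::topological_space, 'e::euclidean_space) chart set \<Rightarrow> bool" where
  "smooth_atlas A \<longleftrightarrow> (\<Union>c\<in>A. cdom c) = UNIV \<and> (\<forall>c\<in>A. is_chart c) \<and>
     (\<forall>c\<in>A. \<forall>d\<in>A. smooth_compat c d)"

definition maximal_atlas ::
    "('a::topological_space, 'e::euclidean_space) chart set \<Rightarrow> ('a, 'e) chart set" where
  "maximal_atlas A = {c. is_chart c \<and> (\<forall>d\<in>A. smooth_compat c d)}"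

definition smooth_map_on ::
    "('a::topological_space, 'e::euclidean_space) chart set \<Rightarrow>
     ('b::topological_space, 'f::euclidean_space) chart set \<Rightarrow> 'a set \<Rightarrow> ('a \<Rightarrow> 'b) \<Rightarrow> bool" where
  "smooth_map_on A B U F \<longleftrightarrow> (\<forall>p\<in>U. \<exists>c\<in>A. \<exists>d\<in>B. \<exists>W. open W \<and> p \<in> W \<and> W \<subseteq> U \<inter> cdom c \<and>
     F ` W \<subseteq> cdom d \<and> smooth_on (cmap c ` W) (cmap d \<circ> F \<circ> cinv c))"


section \<open>Tangent vectors\<close>

text \<open>
  A tangent vector at \<open>p\<close> is the directional derivative operator on real functions
  differentiable at \<open>p\<close>, extended by \<open>0\<close> to all other functions, so that equality of
  tangent vectors is equality of operators.
\<close>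

type_synonym 'a tangent = "('a \<Rightarrow> real) \<Rightarrow> real"

definition diff_at :: "('a, 'e::euclidean_space) chart set \<Rightarrow> ('a \<Rightarrow> real) \<Rightarrow> 'a \<Rightarrow> bool" where
  "diff_at A f p \<longleftrightarrow> (\<exists>c\<in>A. p \<in> cdom c \<and> (f \<circ> cinv c) differentiable (at (cmap c p)))"

definition velocity :: "('a, 'e::euclidean_space) chart set \<Rightarrow> (real \<Rightarrow> 'a) \<Rightarrow> 'a tangent" where
  "velocity A \<gamma> = (\<lambda>f. if diff_at A f (\<gamma> 0) then vector_derivative (f \<circ> \<gamma>) (at 0) else 0)"

text \<open>
  The tangent space at \<open>p\<close> of a submanifold \<open>S\<close>, inside that of the ambient manifold:
  velocities at \<open>p\<close> of smooth curves lying in \<open>S\<close>.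
\<close>

definition tangent_space ::
    "('a, 'e::euclidean_space) chart set \<Rightarrow> 'a set \<Rightarrow> 'a \<Rightarrow> 'a tangent set" where
  "tangent_space A S p = {velocity A \<gamma> | \<gamma>. \<gamma> 0 = p \<and> (\<exists>c\<in>A. \<exists>\<epsilon>>0.
     (\<forall>t\<in>{-\<epsilon><..<\<epsilon>}. \<gamma> t \<in> S \<inter> cdom c) \<and> smooth_on {-\<epsilon><..<\<epsilon>} (cmap c \<circ> \<gamma>))}"

text \<open>
  \<open>coord_vector A c p v\<close> is the tangent vector at \<open>p\<close> with components \<open>v\<close> in the chart \<open>c\<close>;
  \<open>components c X\<close> are the components of \<open>X\<close> in \<open>c\<close>.
\<close>

definition coord_vector ::
    "('a, 'e::euclidean_space) chart set \<Rightarrow> ('a, 'e) chart \<Rightarrow> 'a \<Rightarrow> 'e \<Rightarrow> 'a tangent" where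
  "coord_vector A c p v = velocity A (\<lambda>s. cinv c (cmap c p + s *\<^sub>R v))"

definition components :: "('a, 'e::euclidean_space) chart \<Rightarrow> 'a tangent \<Rightarrow> 'e" where
  "components c X = (\<Sum>b\<in>Basis. X (\<lambda>q. cmap c q \<bullet> b) *\<^sub>R b)"

definition pushforward :: "('a \<Rightarrow> 'b) \<Rightarrow> 'a tangent \<Rightarrow> 'b tangent" where
  "pushforward F X = (\<lambda>f. X (f \<circ> F))"


section \<open>Riemannian metrics and the Levi-Civita connection\<close>

type_synonym 'a metric = "'a \<Rightarrow> 'a tangent \<Rightarrow> 'a tangent \<Rightarrow> real"

definition metric_coord ::
    "('a, 'e::euclidean_space) chart set \<Rightarrow> 'a metric \<Rightarrow> ('a, 'e) chart \<Rightarrow> 'e \<Rightarrow> 'e \<Rightarrow> 'e \<Rightarrow> real" where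
  "metric_coord A g c x u v =
     g (cinv c x) (coord_vector A c (cinv c x) u) (coord_vector A c (cinv c x) v)"

definition riemannian_metric :: "('a, 'e::euclidean_space) chart set \<Rightarrow> 'a metric \<Rightarrow> bool" where
  "riemannian_metric A g \<longleftrightarrow> (\<forall>c\<in>A.
     (\<forall>x\<in>cmap c ` cdom c. bilinear (metric_coord A g c x) \<and>
        (\<forall>u v. metric_coord A g c x u v = metric_coord A g c x v u) \<and>
        (\<forall>u. u \<noteq> 0 \<longrightarrow> metric_coord A g c x u u > 0)) \<and>
     (\<forall>u v. smooth_on (cmap c ` cdom c) (\<lambda>x. metric_coord A g c x u v)))"

text \<open>
  The Levi-Civita connection in a chart is \<open>\<nabla>\<^sub>u V = DV(u) + \<Gamma>(u, V)\<close>, where the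
  Christoffel map \<open>\<Gamma>\<close> is given by the Koszul formula for constant coordinate fields.
\<close>

definition christoffel ::
    "('a, 'e::euclidean_space) chart set \<Rightarrow> 'a metric \<Rightarrow> ('a, 'e) chart \<Rightarrow> 'e \<Rightarrow> 'e \<Rightarrow> 'e \<Rightarrow> 'e" where
  "christoffel A g c x u v = (THE z. \<forall>w. metric_coord A g c x z w =
     (frechet_derivative (\<lambda>y. metric_coord A g c y v w) (at x) u
      + frechet_derivative (\<lambda>y. metric_coord A g c y u w) (at x) v
      - frechet_derivative (\<lambda>y. metric_coord A g c y u v) (at x) w) / 2)"

text \<open>
  The covariant derivative at \<open>p\<close> of a field \<open>V\<close> defined along \<open>S\<close> in the direction of a vector
  \<open>X\<close> tangent to \<open>S\<close>, computed in the chart \<open>c\<close> (the result does not depend on \<open>c\<close>).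
  The Frechet derivative within \<open>S\<close> is not unique, but its values on vectors tangent
  to \<open>S\<close> are.
\<close>

definition covariant_derivative ::
    "('a, 'e::euclidean_space) chart set \<Rightarrow> 'a metric \<Rightarrow> ('a, 'e) chart \<Rightarrow> 'a set \<Rightarrow>
     ('a \<Rightarrow> 'a tangent) \<Rightarrow> 'a \<Rightarrow> 'a tangent \<Rightarrow> 'a tangent" where
  "covariant_derivative A g c S V p X = coord_vector A c p
     (frechet_derivative (\<lambda>x. components c (V (cinv c x)))
        (at (cmap c p) within cmap c ` (S \<inter> cdom c)) (components c X)
      + christoffel A g c (cmap c p) (components c X) (components c (V p)))"

definition isometry_on ::
    "('a::topological_space, 'e::euclidean_space) chart set \<Rightarrow> 'a metric \<Rightarrow> 'a set \<Rightarrow> ('a \<Rightarrow> 'a) \<Rightarrow> bool" where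
  "isometry_on A g U F \<longleftrightarrow> open U \<and> open (F ` U) \<and> inj_on F U \<and>
     smooth_map_on A A U F \<and> smooth_map_on A A (F ` U) (inv_into U F) \<and>
     (\<forall>p\<in>U. \<forall>X\<in>tangent_space A UNIV p. \<forall>Y\<in>tangent_space A UNIV p.
        g (F p) (pushforward F X) (pushforward F Y) = g p X Y)"


section \<open>Hypersurfaces\<close>

definition hypersurface ::
    "('a::topological_space, 'e::euclidean_space) chart set \<Rightarrow> 'a set \<Rightarrow> bool" where
  "hypersurface A S \<longleftrightarrow> (\<forall>p\<in>S. \<exists>c\<in>maximal_atlas A. p \<in> cdom c \<and>
     (\<exists>b\<in>Basis. S \<inter> cdom c = {q \<in> cdom c. cmap c q \<bullet> b = 0}))"

definition unit_normal ::
    "('a, 'e::euclidean_space) chart set \<Rightarrow> 'a metric \<Rightarrow> 'a set \<Rightarrow> ('a \<Rightarrow> 'a tangent) \<Rightarrow> bool" where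
  "unit_normal A g S N \<longleftrightarrow>
     (\<forall>p\<in>S. N p \<in> tangent_space A UNIV p \<and> g p (N p) (N p) = 1 \<and>
        (\<forall>X\<in>tangent_space A S p. g p (N p) X = 0)) \<and>
     (\<forall>c\<in>A. smooth_along (cmap c ` (S \<inter> cdom c)) (\<lambda>x. components c (N (cinv c x))))"

text \<open>\<open>second_form A g c S N p X Y\<close> is \<open>\<langle>A X, Y\<rangle>\<close> for the shape operator \<open>A X = - \<nabla>\<^sub>X N\<close>.\<close>

definition second_form ::
    "('a, 'e::euclidean_space) chart set \<Rightarrow> 'a metric \<Rightarrow> ('a, 'e) chart \<Rightarrow> 'a set \<Rightarrow>
     ('a \<Rightarrow> 'a tangent) \<Rightarrow> 'a \<Rightarrow> 'a tangent \<Rightarrow> 'a tangent \<Rightarrow> real" where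
  "second_form A g c S N p X Y = g p (\<lambda>f. - covariant_derivative A g c S N p X f) Y"

definition orthonormal_basis ::
    "('a, 'e::euclidean_space) chart set \<Rightarrow> 'a metric \<Rightarrow> 'a set \<Rightarrow> 'a \<Rightarrow> 'a tangent set \<Rightarrow> bool" where
  "orthonormal_basis A g S p E \<longleftrightarrow> finite E \<and> E \<subseteq> tangent_space A S p \<and>
     (\<forall>X\<in>E. \<forall>Y\<in>E. g p X Y = (if X = Y then 1 else 0)) \<and>
     (\<forall>X\<in>tangent_space A S p. X = (\<lambda>f. \<Sum>Y\<in>E. g p X Y * Y f))"

text \<open>
  Neither notion below needs a global unit normal: local ones always exist, and both conditions
  are insensitive to their sign.
\<close>

definition totally_geodesic ::
    "('a::topological_space, 'e::euclidean_space) chart set \<Rightarrow> 'a metric \<Rightarrow> 'a set \<Rightarrow> bool" where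
  "totally_geodesic A g S \<longleftrightarrow> hypersurface A S \<and>
     (\<forall>W N. open W \<and> unit_normal A g (S \<inter> W) N \<longrightarrow>
        (\<forall>p\<in>S \<inter> W. \<forall>c\<in>A. p \<in> cdom c \<longrightarrow>
           (\<forall>X\<in>tangent_space A S p. \<forall>Y\<in>tangent_space A S p.
              second_form A g c (S \<inter> W) N p X Y = 0)))"

definition minimal_hypersurface ::
    "('a::topological_space, 'e::euclidean_space) chart set \<Rightarrow> 'a metric \<Rightarrow> 'a set \<Rightarrow> bool" where
  "minimal_hypersurface A g S \<longleftrightarrow> hypersurface A S \<and>
     (\<forall>W N. open W \<and> unit_normal A g (S \<inter> W) N \<longrightarrow>
        (\<forall>p\<in>S \<inter> W. \<forall>c\<in>A. p \<in> cdom c \<longrightarrow>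
           (\<forall>E. orthonormal_basis A g S p E \<longrightarrow>
              (\<Sum>X\<in>E. second_form A g c (S \<inter> W) N p X X) = 0)))"

definition surface_gradient ::
    "('a, 'e::euclidean_space) chart set \<Rightarrow> 'a metric \<Rightarrow> 'a set \<Rightarrow> ('a \<Rightarrow> real) \<Rightarrow> 'a \<Rightarrow> 'a tangent" where
  "surface_gradient A g S f p =
     (THE Z. Z \<in> tangent_space A S p \<and> (\<forall>X\<in>tangent_space A S p. g p Z X = X f))"

definition transversal ::
    "('a, 'e::euclidean_space) chart set \<Rightarrow> 'a set \<Rightarrow> 'a set \<Rightarrow> bool" where
  "transversal A S T \<longleftrightarrow> (\<forall>p\<in>S \<inter> T.
     {(\<lambda>f. X f + Y f) | X Y. X \<in> tangent_space A S p \<and> Y \<in> tangent_space A T p}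
       = tangent_space A UNIV p)"


section \<open>The product with the real line\<close>

definition prod_atlas ::
    "('a, 'e) chart set \<Rightarrow> ('a \<times> real, 'e \<times> real) chart set" where
  "prod_atlas A = (\<lambda>c. (cdom c \<times> UNIV, \<lambda>(p, t). (cmap c p, t))) ` A"

text \<open>\<open>X snd\<close> is \<open>dt(X)\<close>.\<close>

definition prod_metric :: "'a metric \<Rightarrow> ('a \<times> real) metric" where
  "prod_metric g = (\<lambda>x X Y. g (fst x) (pushforward fst X) (pushforward fst Y) + X snd * Y snd)"

definition vertical_field ::
    "('a, 'e::euclidean_space) chart set \<Rightarrow> 'a \<times> real \<Rightarrow> ('a \<times> real) tangent" where
  "vertical_field A x = velocity (prod_atlas A) (\<lambda>s. (fst x, snd x + s))"

definition angle ::
    "('a, 'e::euclidean_space) chart set \<Rightarrow> 'a metric \<Rightarrow>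
     ('a \<times> real \<Rightarrow> ('a \<times> real) tangent) \<Rightarrow> 'a \<times> real \<Rightarrow> real" where
  "angle A g N x = prod_metric g x (N x) (vertical_field A x)"

abbreviation height_gradient ::
    "('a, 'e::euclidean_space) chart set \<Rightarrow> 'a metric \<Rightarrow> ('a \<times> real) set \<Rightarrow>
     'a \<times> real \<Rightarrow> ('a \<times> real) tangent" where
  "height_gradient A g \<Sigma> \<equiv> surface_gradient (prod_atlas A) (prod_metric g) \<Sigma> snd"

text \<open>
  The slice \<open>M \<times> {t}\<close> is identified with \<open>M\<close> by the isometry \<open>(p, t) \<mapsto> p\<close>, so that horizontal
  sections are subsets of \<open>M\<close>.
\<close>

definition section_at :: "('a \<times> real) set \<Rightarrow> real \<Rightarrow> 'a set" where
  "section_at \<Sigma> t = {p. (p, t) \<in> \<Sigma>}"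

abbreviation transversal_at ::
    "('a, 'e::euclidean_space) chart set \<Rightarrow> ('a \<times> real) set \<Rightarrow> real \<Rightarrow> bool" where
  "transversal_at A \<Sigma> t \<equiv> transversal (prod_atlas A) \<Sigma> (UNIV \<times> {t})"

definition vertical_helicoid ::
    "('a::topological_space, 'e::euclidean_space) chart set \<Rightarrow> 'a metric \<Rightarrow> ('a \<times> real) set \<Rightarrow>
     ('a \<times> real \<Rightarrow> ('a \<times> real) tangent) \<Rightarrow> bool" where
  "vertical_helicoid A g \<Sigma> N \<longleftrightarrow>
     hypersurface (prod_atlas A) \<Sigma> \<and>
     unit_normal (prod_atlas A) (prod_metric g) \<Sigma> N \<and>
     (\<forall>x\<in>\<Sigma>. (angle A g N x)\<^sup>2 \<noteq> 1) \<and>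
     \<not> (angle A g N) constant_on \<Sigma> \<and>
     (\<forall>t. transversal_at A \<Sigma> t \<longrightarrow> minimal_hypersurface A g (section_at \<Sigma> t)) \<and>
     (\<forall>x\<in>\<Sigma>. \<forall>c\<in>prod_atlas A. x \<in> cdom c \<longrightarrow>
        second_form (prod_atlas A) (prod_metric g) c \<Sigma> N x
          (height_gradient A g \<Sigma> x) (height_gradient A g \<Sigma> x) = 0)"


section \<open>Local one-parameter groups of isometries and twistings\<close>

text \<open>
  The maps are only required to be defined on \<open>U\<close>; their values elsewhere are irrelevant. As usual
  for one-parameter groups, joint smoothness in the parameter and the point is part of the notion.
\<close>

definition local_isometry_group ::
    "('a::topological_space, 'e::euclidean_space) chart set \<Rightarrow> 'a metric \<Rightarrow> 'a set \<Rightarrow> real set \<Rightarrow>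
     (real \<Rightarrow> 'a \<Rightarrow> 'a) \<Rightarrow> bool" where
  "local_isometry_group A g U I \<Gamma> \<longleftrightarrow>
     (\<forall>t\<in>I. isometry_on A g U (\<Gamma> t)) \<and>
     smooth_map_on (prod_atlas A) A (U \<times> I) (\<lambda>(p, t). \<Gamma> t p) \<and>
     (\<forall>p\<in>U. \<Gamma> 0 p = p) \<and>
     (\<forall>p\<in>U. \<forall>s\<in>I. \<forall>t\<in>I. t + s \<in> I \<and> \<Gamma> s p \<in> U \<longrightarrow> \<Gamma> (t + s) p = \<Gamma> t (\<Gamma> s p))"

definition twisting :: "real \<Rightarrow> (real \<Rightarrow> 'a \<Rightarrow> 'a) \<Rightarrow> real set \<Rightarrow> 'a set \<Rightarrow> ('a \<times> real) set" where
  "twisting a \<Gamma> I L = {(\<Gamma> s p, a * s) | p s. p \<in> L \<and> s \<in> I}"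

definition vertical_translate :: "real \<Rightarrow> ('a \<times> real) set \<Rightarrow> ('a \<times> real) set" where
  "vertical_translate h S = (\<lambda>(p, t). (p, h + t)) ` S"

end

theory Submission
  imports Defs
begin

text \<open>
  Since the angle function avoids both \<open>0\<close> and \<open>\<plusminus>1\<close>, the helicoid is locally the graph of a function
  \<open>u\<close> on \<open>M\<close> without critical points, all its horizontal sections are transversal, and they are the
  level sets of \<open>u\<close>. That they are totally geodesic says that \<open>Hess u\<close> vanishes on \<open>ker du \<times> ker du\<close>;
  that the second fundamental form vanishes on \<open>\<nabla>\<xi>\<close> says that \<open>Hess u (\<nabla>u, \<nabla>u) = 0\<close>. Together these
  are exactly the Killing equation for \<open>Z = \<nabla>u / \<bar>\<nabla>u\<bar>\<^sup>2\<close>. The flow of \<open>Z\<close> thus consists of isometries,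
  and since \<open>du(Z) = 1\<close> it raises \<open>u\<close> at unit speed, so it twists the level set of \<open>u\<close> through the
  given point into the graph.
\<close>

section \<open>Calculus of smooth functions\<close>

text \<open>The rescaling of the gradient removes the mixed terms: the two conditions say nothing
  about \<open>Hess u (v, \<nabla>u)\<close> for \<open>v\<close> in \<open>ker du\<close>, but
  these values are half the derivative of \<open>\<bar>\<nabla>u\<bar>\<^sup>2\<close> along
  \<open>v\<close>, and dividing by that function cancels exactly them. The nonvanishing angle makes
  the projection to \<open>M\<close> a local diffeomorphism, so everything is computed in one chart
  of \<open>M\<close>, with the connection entering only through the Koszul formula. The analytic
  obstacle is that the flow must be smooth in the point as well as in time: it comes from a
  contraction on a short time interval, and its derivatives are identified with solutions of the
  linearised equation. The geometric obstacle is that \<open>\<Sigma>'\<close> must be a twisting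
  exactly, with one time interval for all points, while each \<open>\<Gamma> t\<close> is defined on
  the whole projection. So the domain is the union of the flow lines over times in
  \<open>(-\<epsilon>, \<epsilon>)\<close> through a small level slice, and the flow is controlled
  up to time \<open>2 * \<epsilon>\<close>, which leaves room to move such a point by another
  \<open>\<epsilon>\<close>.\<close>

lemma Ck_on_subset: "Ck_on k U f \<Longrightarrow> V \<subseteq> U \<Longrightarrow> Ck_on k V f"
proof (induction k arbitrary: f)
  case 0
  then show ?case using continuous_on_subset[of U f V] by simp
next
  case (Suc k)
  then show ?case unfolding Ck_on.simps(2) by blast
qed

text \<open>Openness carries the lemma: near each point of \<open>U\<close> the functions agree, so
  their derivatives agree there too and the induction can continue.\<close>

lemma Ck_on_cong:
  assumes "open U" "\<And>x. x \<in> U \<Longrightarrow> f x = g x"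
  shows "Ck_on k U f \<longleftrightarrow> Ck_on k U g"
proof -
  have *: "Ck_on k U g" if "Ck_on k U f" "\<And>x. x \<in> U \<Longrightarrow> f x = g x" for f g :: "'a \<Rightarrow> 'b"
    using that
  proof (induction k arbitrary: f g)
    case 0
    then show ?case by (auto cong: continuous_on_cong)
  next
    case (Suc k)
    have d: "(g has_derivative frechet_derivative f (at x)) (at x)" if "x \<in> U" for x
    proof -
      have "(f has_derivative frechet_derivative f (at x)) (at x)"
        using Suc.prems(1) that unfolding Ck_on.simps frechet_derivative_works by blast
      then show ?thesis
        using Suc.prems(2) by (rule has_derivative_transform_within_open[OF _ \<open>open U\<close> that])
    qed
    have eq: "frechet_derivative f (at x) v = frechet_derivative g (at x) v" if "x \<in> U" for x v
      by (rule fun_cong[OF frechet_derivative_at[OF d[OF that]]])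
    have "Ck_on k U (\<lambda>x. frechet_derivative g (at x) v)" for v
      by (rule Suc.IH[OF _ eq]) (use Suc.prems(1) in auto)
    moreover have "g differentiable at x" if "x \<in> U" for x
      using d[OF that] by (rule differentiableI)
    ultimately show ?case by simp
  qed
  show ?thesis using *[of f g] *[of g f] assms(2) by auto
qed

text \<open>The inductive step of the closure properties below: an explicitly known derivative may
  stand in for \<open>frechet_derivative\<close>, being equal to it on the open set.\<close>

lemma Ck_on_SucI:
  assumes "open U" "\<And>x. x \<in> U \<Longrightarrow> (f has_derivative f' x) (at x)"
    "\<And>v. Ck_on k U (\<lambda>x. f' x v)"
  shows "Ck_on (Suc k) U f"
proof -
  have eq: "f' x v = frechet_derivative f (at x) v" if "x \<in> U" for x v
    by (rule fun_cong[OF frechet_derivative_at[OF assms(2)[OF that]]])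
  have "Ck_on k U (\<lambda>x. frechet_derivative f (at x) v)" for v
    by (rule Ck_on_cong[THEN iffD1, OF assms(1) eq assms(3)])
  moreover have "f differentiable at x" if "x \<in> U" for x
    using assms(2)[OF that] by (rule differentiableI)
  ultimately show ?thesis by simp
qed

lemma Ck_on_SucD:
  assumes "Ck_on (Suc k) U f"
  shows "x \<in> U \<Longrightarrow> (f has_derivative frechet_derivative f (at x)) (at x)"
    "Ck_on k U (\<lambda>x. frechet_derivative f (at x) v)"
proof -
  have "\<forall>x\<in>U. f differentiable (at x)" "\<forall>v. Ck_on k U (\<lambda>x. frechet_derivative f (at x) v)"
    using assms unfolding Ck_on.simps(2) by (rule conjunct1, rule conjunct2)
  then show "x \<in> U \<Longrightarrow> (f has_derivative frechet_derivative f (at x)) (at x)"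
    "Ck_on k U (\<lambda>x. frechet_derivative f (at x) v)"
    by (simp_all only: frechet_derivative_works[symmetric])
qed

lemma Ck_on_Suc:
  "Ck_on (Suc k) U f \<longleftrightarrow> (\<forall>x\<in>U. f differentiable (at x)) \<and>
    (\<forall>v. Ck_on k U (\<lambda>x. frechet_derivative f (at x) v))"
  by simp

declare Ck_on.simps(2)[simp del]

lemma Ck_on_Suc_imp: "Ck_on (Suc k) U f \<Longrightarrow> Ck_on k U f"
proof (induction k arbitrary: f)
  case 0
  then show ?case
    by (auto intro!: differentiable_imp_continuous_on differentiable_at_imp_differentiable_on simp: Ck_on.simps(2))
next
  case (Suc k)
  have "\<forall>x\<in>U. f differentiable (at x)" "\<forall>v. Ck_on (Suc k) U (\<lambda>x. frechet_derivative f (at x) v)"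
    using Suc.prems unfolding Ck_on_Suc[of "Suc k" U f] by (rule conjunct1, rule conjunct2)
  then show ?case
    unfolding Ck_on_Suc[of k U f] using Suc.IH by blast
qed

lemma Ck_on_le: "Ck_on k U f \<Longrightarrow> j \<le> k \<Longrightarrow> Ck_on j U f"
proof (induction k)
  case (Suc k)
  then show ?case using Ck_on_Suc_imp[of k U f] le_Suc_eq[of j k] by blast
qed simp

lemma Ck_on_imp_continuous_on: "Ck_on k U f \<Longrightarrow> continuous_on U f"
  using Ck_on_le[of k U f 0] by simp

text \<open>Derivatives at a point are intrinsic to the function, so locally known regularity glues
  without any compatibility check.\<close>

lemma Ck_on_local:
  assumes "open U" "\<And>x. x \<in> U \<Longrightarrow> \<exists>W. open W \<and> x \<in> W \<and> Ck_on k W f"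
  shows "Ck_on k U f"
  using assms(2)
proof (induction k arbitrary: f)
  case 0
  have "isCont f x" if x: "x \<in> U" for x
  proof -
    obtain W where "open W" "x \<in> W" "continuous_on W f"
      using 0[OF x] by auto
    then show ?thesis by (simp add: continuous_on_eq_continuous_at)
  qed
  then show ?case by (simp add: continuous_at_imp_continuous_on)
next
  case (Suc k)
  have "Ck_on k U (\<lambda>x. frechet_derivative f (at x) v)" for v
  proof (rule Suc.IH)
    fix x assume "x \<in> U"
    then obtain W where "open W" "x \<in> W" "Ck_on (Suc k) W f" using Suc.prems by blast
    then show "\<exists>W. open W \<and> x \<in> W \<and> Ck_on k W (\<lambda>x. frechet_derivative f (at x) v)"
      using Ck_on_SucD(2) by blast
  qed
  moreover have "f differentiable at x" if "x \<in> U" for x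
    using Suc.prems[OF that] by (auto simp: Ck_on.simps(2))
  ultimately show ?case by (simp add: Ck_on.simps(2))
qed

lemma Ck_on_const: "Ck_on k U (\<lambda>x. c)"
  by (induction k arbitrary: c) (auto simp: Ck_on.simps(2))

lemma Ck_on_add:
  "open U \<Longrightarrow> Ck_on k U f \<Longrightarrow> Ck_on k U g \<Longrightarrow> Ck_on k U (\<lambda>x. f x + g x)"
proof (induction k arbitrary: f g)
  case (Suc k)
  note f = Ck_on_SucD[OF Suc.prems(2)] and g = Ck_on_SucD[OF Suc.prems(3)]
  show ?case
    by (rule Ck_on_SucI[OF Suc.prems(1) has_derivative_add[OF f(1) g(1)] Suc.IH[OF Suc.prems(1) f(2) g(2)]])
qed (simp add: continuous_on_add)

lemma Ck_on_bounded_linear_comp: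
  assumes "bounded_linear h" "open U"
  shows "Ck_on k U f \<Longrightarrow> Ck_on k U (\<lambda>x. h (f x))"
proof (induction k arbitrary: f)
  case 0
  then show ?case by (simp add: bounded_linear.continuous_on[OF assms(1)])
next
  case (Suc k)
  note f = Ck_on_SucD[OF Suc.prems]
  show ?case
    by (rule Ck_on_SucI[OF assms(2) bounded_linear.has_derivative[OF assms(1) f(1)] Suc.IH[OF f(2)]])
qed

lemma Ck_on_bounded_linear:
  assumes "bounded_linear h" "open U"
  shows "Ck_on k U h"
proof (cases k)
  case 0
  then show ?thesis by (simp add: linear_continuous_on assms)
next
  case (Suc j)
  have "Ck_on (Suc j) U h"
    by (rule Ck_on_SucI[OF assms(2), where f' = "\<lambda>_. h"])
      (auto intro: bounded_linear_imp_has_derivative assms Ck_on_const)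
  then show ?thesis using Suc by simp
qed

text \<open>The product rule gives two terms of the same bilinear shape, each with one factor
  differentiated; hence the induction is over arbitrary \<open>f\<close> and
  \<open>g\<close>.\<close>

lemma Ck_on_bilinear:
  assumes "bounded_bilinear b" "open U"
  shows "Ck_on k U f \<Longrightarrow> Ck_on k U g \<Longrightarrow> Ck_on k U (\<lambda>x. b (f x) (g x))"
proof (induction k arbitrary: f g)
  case 0
  then show ?case by (simp add: bounded_bilinear.continuous_on[OF assms(1)])
next
  case (Suc k)
  note f = Ck_on_SucD[OF Suc.prems(1)] and g = Ck_on_SucD[OF Suc.prems(2)]
  show ?case
  proof (rule Ck_on_SucI[OF assms(2) bounded_bilinear.FDERIV[OF assms(1) f(1) g(1)]])
    fix v
    show "Ck_on k U (\<lambda>x. b (f x) (frechet_derivative g (at x) v) + b (frechet_derivative f (at x) v) (g x))"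
      by (rule Ck_on_add[OF assms(2) Suc.IH[OF Ck_on_Suc_imp[OF Suc.prems(1)] g(2)] Suc.IH[OF f(2) Ck_on_Suc_imp[OF Suc.prems(2)]]])
  qed
qed

lemma Ck_on_sum:
  assumes "open U" "\<And>i. i \<in> I \<Longrightarrow> Ck_on k U (f i)"
  shows "Ck_on k U (\<lambda>x. \<Sum>i\<in>I. f i x)"
  using assms(2)
  by (induction I rule: infinite_finite_induct) (simp_all add: Ck_on_const Ck_on_add[OF assms(1)])

lemmas Ck_on_scaleR = Ck_on_bilinear[OF bounded_bilinear_scaleR]
lemmas Ck_on_mult = Ck_on_bilinear[OF bounded_bilinear_mult[where 'a = real]]
lemmas Ck_on_inner = Ck_on_bilinear[OF bounded_bilinear_inner]
lemmas Ck_on_snd = Ck_on_bounded_linear_comp[OF bounded_linear_snd]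
lemmas Ck_on_minus = Ck_on_bounded_linear_comp[OF bounded_linear_minus[OF bounded_linear_ident]]
lemmas Ck_on_id = Ck_on_bounded_linear[OF bounded_linear_ident]

lemma Ck_on_diff:
  "open U \<Longrightarrow> Ck_on k U f \<Longrightarrow> Ck_on k U g \<Longrightarrow> Ck_on k U (\<lambda>x. f x - g x)"
  using Ck_on_add[of U k f "\<lambda>x. - g x"] Ck_on_minus[of U k g] by simp

lemma Ck_on_Pair:
  assumes "open U" "Ck_on k U f" "Ck_on k U g"
  shows "Ck_on k U (\<lambda>x. (f x, g x))"
proof -
  have "bounded_linear (\<lambda>a. (a, 0))" "bounded_linear (\<lambda>a. (0, a))"
    by (intro bounded_linear_Pair bounded_linear_ident bounded_linear_zero)+
  then have "Ck_on k U (\<lambda>x. (f x, 0) + (0, g x))"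
    by (intro Ck_on_add assms Ck_on_bounded_linear_comp[where f = f] Ck_on_bounded_linear_comp[where f = g])
  then show ?thesis by simp
qed

lemma linear_sum_Basis:
  fixes v :: "'a::euclidean_space"
  assumes "linear h"
  shows "h v = (\<Sum>b\<in>Basis. (v \<bullet> b) *\<^sub>R h b)"
proof -
  have "h (\<Sum>b\<in>Basis. (v \<bullet> b) *\<^sub>R b) = (\<Sum>b\<in>Basis. (v \<bullet> b) *\<^sub>R h b)"
    by (simp add: linear_sum[OF assms] linear_cmul[OF assms])
  then show ?thesis by (simp only: euclidean_representation)
qed

text \<open>Regularity of a family of linear maps is only ever known on fixed vectors. Expanding a
  moving argument in the standard basis reduces to those.\<close>

lemma Ck_on_linear_family:
  assumes "open U" "\<And>x. x \<in> U \<Longrightarrow> linear (B x)" "\<And>v. Ck_on k U (\<lambda>x. B x v)" "Ck_on k U h"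
  shows "Ck_on k U (\<lambda>x. B x (h x))"
proof -
  have "Ck_on k U (\<lambda>x. \<Sum>b\<in>Basis. (h x \<bullet> b) *\<^sub>R B x b)"
    by (intro Ck_on_sum Ck_on_scaleR Ck_on_inner Ck_on_const assms)
  then show ?thesis
    by (rule Ck_on_cong[THEN iffD1, OF assms(1) linear_sum_Basis[OF assms(2), symmetric], rotated])
qed

text \<open>By the chain rule the derivative is the linear family \<open>Df (g x)\<close> applied to
  \<open>Dg x v\<close>; the family is a composition one order lower, so the induction hypothesis
  covers it.\<close>

lemma Ck_on_compose:
  assumes "open U" "open V"
  shows "Ck_on k V f \<Longrightarrow> Ck_on k U g \<Longrightarrow> g ` U \<subseteq> V \<Longrightarrow> Ck_on k U (\<lambda>x. f (g x))"
proof (induction k arbitrary: f g)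
  case 0
  then show ?case using continuous_on_compose2[of V f U g] by simp
next
  case (Suc k)
  note f = Ck_on_SucD[OF Suc.prems(1)] and g = Ck_on_SucD[OF Suc.prems(2)]
  show ?case
  proof (rule Ck_on_SucI[OF assms(1),
        where f' = "\<lambda>x v. frechet_derivative f (at (g x)) (frechet_derivative g (at x) v)"])
    show "((\<lambda>x. f (g x)) has_derivative
        (\<lambda>v. frechet_derivative f (at (g x)) (frechet_derivative g (at x) v))) (at x)" if "x \<in> U" for x
      using that Suc.prems(3) by (intro has_derivative_compose[OF g(1) f(1)]) auto
    fix v
    show "Ck_on k U (\<lambda>x. frechet_derivative f (at (g x)) (frechet_derivative g (at x) v))"
    proof (rule Ck_on_linear_family[OF assms(1), where B = "\<lambda>x. frechet_derivative f (at (g x))"])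
      show "linear (frechet_derivative f (at (g x)))" if "x \<in> U" for x
        using Suc.prems(1,3) that unfolding Ck_on_Suc by (intro linear_frechet_derivative) auto
      show "Ck_on k U (\<lambda>x. frechet_derivative f (at (g x)) w)" for w
        using Suc.IH[OF f(2) Ck_on_Suc_imp[OF Suc.prems(2)] Suc.prems(3)] by simp
    qed (rule g(2))
  qed
qed

lemma Ck_on_frechet_comp:
  assumes "open U" "open V" "Ck_on (Suc k) V f" "Ck_on k U g" "g ` U \<subseteq> V" "Ck_on k U h"
  shows "Ck_on k U (\<lambda>x. frechet_derivative f (at (g x)) (h x))"
proof (rule Ck_on_linear_family[OF assms(1) _ _ assms(6), where B = "\<lambda>x. frechet_derivative f (at (g x))"])
  show "linear (frechet_derivative f (at (g x)))" if "x \<in> U" for x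
    using assms(3,5) that unfolding Ck_on_Suc by (intro linear_frechet_derivative) auto
  show "Ck_on k U (\<lambda>x. frechet_derivative f (at (g x)) w)" for w
    using Ck_on_compose[OF assms(1,2) Ck_on_SucD(2)[OF assms(3)] assms(4,5)] by simp
qed

text \<open>The derivative of the reciprocal is a product of the reciprocal itself with a derivative
  of \<open>f\<close>, so regularity of order \<open>k\<close> bootstraps to order
  \<open>k + 1\<close>.\<close>

lemma Ck_on_inverse:
  fixes f :: "'e::euclidean_space \<Rightarrow> real"
  assumes "open U" "\<And>x. x \<in> U \<Longrightarrow> f x \<noteq> 0"
  shows "Ck_on k U f \<Longrightarrow> Ck_on k U (\<lambda>x. inverse (f x))"
proof (induction k)
  case 0
  then show ?case using assms by (simp add: continuous_on_inverse continuous_on_real_sqrt)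
next
  case (Suc k)
  note f = Ck_on_SucD[OF Suc.prems] and i = Suc.IH[OF Ck_on_Suc_imp[OF Suc.prems]]
  show ?case
  proof (rule Ck_on_SucI[OF assms(1)])
    show "((\<lambda>x. inverse (f x)) has_derivative
        (\<lambda>v. - (inverse (f x) * frechet_derivative f (at x) v * inverse (f x)))) (at x)"
      if "x \<in> U" for x
      using Deriv.has_derivative_inverse[OF assms(2)[OF that] f(1)[OF that]] by simp
    show "Ck_on k U (\<lambda>x. - (inverse (f x) * frechet_derivative f (at x) v * inverse (f x)))" for v
      by (intro Ck_on_minus Ck_on_mult assms i f)
  qed
qed

lemma Ck_on_divide:
  fixes f g :: "'e::euclidean_space \<Rightarrow> real"
  assumes "open U" "Ck_on k U f" "Ck_on k U g" "\<And>x. x \<in> U \<Longrightarrow> g x \<noteq> 0"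
  shows "Ck_on k U (\<lambda>x. f x / g x)"
  unfolding divide_inverse by (intro Ck_on_mult Ck_on_inverse assms)

text \<open>The same bootstrap as for the reciprocal: \<open>sqrt (f x)\<close> reappears in the
  denominator of its own derivative.\<close>

lemma Ck_on_sqrt:
  fixes f :: "'e::euclidean_space \<Rightarrow> real"
  assumes "open U" "\<And>x. x \<in> U \<Longrightarrow> f x > 0"
  shows "Ck_on k U f \<Longrightarrow> Ck_on k U (\<lambda>x. sqrt (f x))"
proof (induction k)
  case 0
  then show ?case using assms by (simp add: continuous_on_inverse continuous_on_real_sqrt)
next
  case (Suc k)
  note f = Ck_on_SucD[OF Suc.prems] and i = Suc.IH[OF Ck_on_Suc_imp[OF Suc.prems]]
  show ?case
  proof (rule Ck_on_SucI[OF assms(1)])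
    show "((\<lambda>x. sqrt (f x)) has_derivative (\<lambda>v. frechet_derivative f (at x) v * (1 / (2 * sqrt (f x))))) (at x)"
      if "x \<in> U" for x
    proof -
      have "(sqrt has_derivative (\<lambda>h. h * (inverse (sqrt (f x)) / 2))) (at (f x))"
        using DERIV_real_sqrt[OF assms(2)[OF that]]
        unfolding has_field_derivative_def by (rule has_derivative_eq_rhs) auto
      from has_derivative_compose[OF f(1)[OF that] this] show ?thesis
        by (simp add: inverse_eq_divide mult.commute)
    qed
    show "Ck_on k U (\<lambda>x. frechet_derivative f (at x) v * (1 / (2 * sqrt (f x))))" for v
      by (intro Ck_on_divide Ck_on_mult Ck_on_const assms i f) (use assms(2) in force)
  qed
qed

section \<open>The same rules for smoothness of all orders\<close>

lemma smooth_onD: "smooth_on U f \<Longrightarrow> Ck_on k U f"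
  by (simp add: smooth_on_def)

lemma smooth_on_subset: "smooth_on U f \<Longrightarrow> V \<subseteq> U \<Longrightarrow> smooth_on V f"
  unfolding smooth_on_def by (intro allI Ck_on_subset[of _ U f V]) auto

lemma smooth_on_cong:
  "open U \<Longrightarrow> (\<And>x. x \<in> U \<Longrightarrow> f x = g x) \<Longrightarrow> smooth_on U f \<longleftrightarrow> smooth_on U g"
  unfolding smooth_on_def by (intro all_cong1 Ck_on_cong)

lemma smooth_on_has_derivative:
  "smooth_on U f \<Longrightarrow> x \<in> U \<Longrightarrow> (f has_derivative frechet_derivative f (at x)) (at x)"
  using Ck_on_SucD(1)[OF smooth_onD] .

lemma smooth_on_differentiable: "smooth_on U f \<Longrightarrow> x \<in> U \<Longrightarrow> f differentiable at x"
  by (rule differentiableI[OF smooth_on_has_derivative])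

lemma smooth_on_linear_frechet: "smooth_on U f \<Longrightarrow> x \<in> U \<Longrightarrow> linear (frechet_derivative f (at x))"
  by (rule linear_frechet_derivative[OF smooth_on_differentiable])

lemma smooth_on_frechet: "smooth_on U f \<Longrightarrow> smooth_on U (\<lambda>x. frechet_derivative f (at x) v)"
  unfolding smooth_on_def by (intro allI Ck_on_SucD(2)) simp

lemma smooth_on_imp_continuous_on: "smooth_on U f \<Longrightarrow> continuous_on U f"
  by (rule Ck_on_imp_continuous_on[OF smooth_onD])

lemma smooth_on_const: "smooth_on U (\<lambda>x. c)"
  by (simp add: smooth_on_def Ck_on_const)

lemma smooth_on_bounded_linear: "bounded_linear h \<Longrightarrow> open U \<Longrightarrow> smooth_on U h"
  by (simp add: smooth_on_def Ck_on_bounded_linear)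

lemma smooth_on_add: "open U \<Longrightarrow> smooth_on U f \<Longrightarrow> smooth_on U g \<Longrightarrow> smooth_on U (\<lambda>x. f x + g x)"
  by (simp add: smooth_on_def Ck_on_add)

lemma smooth_on_diff: "open U \<Longrightarrow> smooth_on U f \<Longrightarrow> smooth_on U g \<Longrightarrow> smooth_on U (\<lambda>x. f x - g x)"
  by (simp add: smooth_on_def Ck_on_diff)

lemma smooth_on_minus: "open U \<Longrightarrow> smooth_on U f \<Longrightarrow> smooth_on U (\<lambda>x. - f x)"
  by (simp add: smooth_on_def Ck_on_minus)

lemma smooth_on_scaleR:
  "open U \<Longrightarrow> smooth_on U f \<Longrightarrow> smooth_on U g \<Longrightarrow> smooth_on U (\<lambda>x. f x *\<^sub>R g x)"
  by (simp add: smooth_on_def Ck_on_scaleR)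

lemma smooth_on_inner:
  "open U \<Longrightarrow> smooth_on U f \<Longrightarrow> smooth_on U g \<Longrightarrow> smooth_on U (\<lambda>x. f x \<bullet> g x)"
  by (simp add: smooth_on_def Ck_on_inner)

lemma smooth_on_Pair: "open U \<Longrightarrow> smooth_on U f \<Longrightarrow> smooth_on U g \<Longrightarrow> smooth_on U (\<lambda>x. (f x, g x))"
  by (simp add: smooth_on_def Ck_on_Pair)

lemma smooth_on_snd: "open U \<Longrightarrow> smooth_on U f \<Longrightarrow> smooth_on U (\<lambda>x. snd (f x))"
  by (simp add: smooth_on_def Ck_on_snd)

lemma smooth_on_id: "open U \<Longrightarrow> smooth_on U (\<lambda>x. x)"
  by (simp add: smooth_on_def Ck_on_id)

lemma smooth_on_compose:
  "open U \<Longrightarrow> open V \<Longrightarrow> smooth_on V f \<Longrightarrow> smooth_on U g \<Longrightarrow> g ` U \<subseteq> V \<Longrightarrow> smooth_on U (\<lambda>x. f (g x))"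
  unfolding smooth_on_def by (intro allI, rule Ck_on_compose[where V = V and f = f]) auto

lemma smooth_on_linear_family:
  "open U \<Longrightarrow> (\<And>x. x \<in> U \<Longrightarrow> linear (B x)) \<Longrightarrow> (\<And>v. smooth_on U (\<lambda>x. B x v)) \<Longrightarrow> smooth_on U h
    \<Longrightarrow> smooth_on U (\<lambda>x. B x (h x))"
  unfolding smooth_on_def by (intro allI, rule Ck_on_linear_family) auto

lemma smooth_on_frechet_comp:
  "open U \<Longrightarrow> open V \<Longrightarrow> smooth_on V f \<Longrightarrow> smooth_on U g \<Longrightarrow> g ` U \<subseteq> V \<Longrightarrow> smooth_on U h
    \<Longrightarrow> smooth_on U (\<lambda>x. frechet_derivative f (at (g x)) (h x))"
  unfolding smooth_on_def by (intro allI, rule Ck_on_frechet_comp[where V = V and f = f]) auto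

lemma smooth_on_divide:
  fixes f g :: "'e::euclidean_space \<Rightarrow> real"
  shows "open U \<Longrightarrow> smooth_on U f \<Longrightarrow> smooth_on U g \<Longrightarrow> (\<And>x. x \<in> U \<Longrightarrow> g x \<noteq> 0)
    \<Longrightarrow> smooth_on U (\<lambda>x. f x / g x)"
  by (simp add: smooth_on_def Ck_on_divide)

lemma smooth_on_sqrt:
  fixes f :: "'e::euclidean_space \<Rightarrow> real"
  shows "open U \<Longrightarrow> smooth_on U f \<Longrightarrow> (\<And>x. x \<in> U \<Longrightarrow> f x > 0) \<Longrightarrow> smooth_on U (\<lambda>x. sqrt (f x))"
  by (simp add: smooth_on_def Ck_on_sqrt)

section \<open>Ordinary differential equations with parameters\<close>

lemma ode_mean_value:
  fixes r :: "real \<Rightarrow> 'e::real_normed_vector"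
  assumes "convex I" "0 \<in> I" "I \<subseteq> {-T..T}" "t \<in> I"
    and r: "\<And>t. t \<in> I \<Longrightarrow> (r has_vector_derivative r' t) (at t within I)"
    and K: "\<And>t. t \<in> I \<Longrightarrow> norm (r' t) \<le> K"
  shows "norm (r t - r 0) \<le> T * K"
proof -
  have "norm (r t - r 0) \<le> K * norm (t - 0)"
  proof (rule differentiable_bound[OF \<open>convex I\<close> r[unfolded has_vector_derivative_def] _ \<open>t \<in> I\<close> \<open>0 \<in> I\<close>])
    show "onorm (\<lambda>x. x *\<^sub>R r' s) \<le> K" if "s \<in> I" for s
      using mult_right_mono[OF K[OF that] abs_ge_zero] by (intro onorm_le) (simp add: mult.commute)
  qed
  also have "\<dots> \<le> K * T"
  proof (rule mult_left_mono)
    show "norm (t - 0) \<le> T" using subsetD[OF assms(3,4)] by auto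
    show "0 \<le> K" using K[OF \<open>0 \<in> I\<close>] norm_ge_zero[of "r' 0"] by linarith
  qed
  finally show ?thesis by (simp add: mult.commute)
qed

text \<open>On an interval so short that \<open>L T \<le> 1/2\<close>, the maximum of \<open>r\<close> absorbs itself; this replaces
  Gronwall's inequality.\<close>

lemma ode_absorb:
  fixes r :: "real \<Rightarrow> 'e::real_normed_vector"
  assumes I: "0 \<in> {a..b}" "{a..b} \<subseteq> {-T..T}" "t \<in> {a..b}"
    and r: "\<And>t. t \<in> {a..b} \<Longrightarrow> (r has_vector_derivative r' t) (at t within {a..b})"
    and r': "\<And>t. t \<in> {a..b} \<Longrightarrow> norm (r' t) \<le> e + L * norm (r t)"
    and L: "0 \<le> L" "L * T \<le> 1/2"
  shows "norm (r t) \<le> 2 * (norm (r 0) + T * e)"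
proof -
  have "continuous_on {a..b} r"
    unfolding continuous_on_eq_continuous_within by (blast intro: has_vector_derivative_continuous r)
  then have "continuous_on {a..b} (\<lambda>t. norm (r t))" by (intro continuous_intros)
  then obtain s where s: "s \<in> {a..b}" "\<And>t. t \<in> {a..b} \<Longrightarrow> norm (r t) \<le> norm (r s)"
    using continuous_attains_sup[OF compact_Icc, of a b "\<lambda>t. norm (r t)"] I(1) by fastforce
  have T: "T \<ge> 0" using I by auto
  have "norm (r s - r 0) \<le> T * (e + L * norm (r s))"
  proof (rule ode_mean_value[OF convex_real_interval(5) I(1,2) s(1) r])
    show "norm (r' t) \<le> e + L * norm (r s)" if "t \<in> {a..b}" for t
      using r'[OF that] mult_left_mono[OF s(2)[OF that] L(1)] by linarith
  qed
  then have "norm (r s) \<le> norm (r 0) + T * e + (L * T) * norm (r s)"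
    using norm_triangle_ineq2[of "r s" "r 0"] by (simp add: algebra_simps)
  moreover have "(L * T) * norm (r s) \<le> 1/2 * norm (r s)"
    using L(2) by (intro mult_right_mono) auto
  ultimately show ?thesis using s(2)[OF I(3)] by argo
qed

text \<open>Picard iteration for all parameters at once: the unknown is a function of
  \<open>(p, t)\<close>, so its continuity in the parameter comes with the fixed point. The
  condition \<open>L * T \<le> 1/2\<close> makes the contraction factor \<open>1/2\<close>.\<close>

lemma ode_fixpoint:
  fixes f :: "'p::euclidean_space \<times> real \<times> 'e::euclidean_space \<Rightarrow> 'e"
  assumes X: "compact X" "convex X" "X \<noteq> {}" and T: "0 < T"
    and f: "continuous_on (X \<times> {-T..T} \<times> UNIV) f"
    and lip: "\<And>p t y z. p \<in> X \<Longrightarrow> t \<in> {-T..T} \<Longrightarrow> norm (f (p, t, y) - f (p, t, z)) \<le> L * norm (y - z)"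
    and L: "0 \<le> L" "L * T \<le> 1/2"
    and y0: "continuous_on X y0"
  obtains y where "continuous_on (X \<times> {-T..T}) (\<lambda>(p, t). y p t)"
    "\<And>p. p \<in> X \<Longrightarrow> y p 0 = y0 p"
    "\<And>p t. p \<in> X \<Longrightarrow> t \<in> {-T..T} \<Longrightarrow>
      (y p has_vector_derivative f (p, t, y p t)) (at t within {-T..T})"
proof -
  define Q where "Q = X \<times> {-T..T}"
  have Q: "compact Q" "convex Q" "closed Q" "Q \<noteq> {}"
    using X T by (auto simp: Q_def intro!: compact_Times convex_Times compact_imp_closed)
  \<comment> \<open>Precomposing with the nearest-point retraction onto \<open>Q\<close> extends
    functions from \<open>Q\<close> to the whole space, where the complete metric space of bounded
    continuous functions lives.\<close>
  let ?P = "closest_point Q"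
  have P: "?P q \<in> Q" "q \<in> Q \<Longrightarrow> ?P q = q" for q
    using closest_point_in_set[OF Q(3,4)] closest_point_self by auto
  have contP: "continuous_on UNIV ?P"
    by (rule continuous_on_closest_point[OF Q(2,3,4)])
  \<comment> \<open>The Picard integral from \<open>0\<close> to \<open>t\<close>, rescaled to the
    unit interval. This treats both signs of \<open>t\<close> alike and makes continuity in
    \<open>(p, t)\<close> a matter of integrals over a fixed interval.\<close>
  define h where "h Y q = y0 (fst q) + snd q *\<^sub>R integral {0..1} (\<lambda>\<tau>. f (fst q, snd q * \<tau>, Y (fst q, snd q * \<tau>)))"
    for Y :: "'p \<times> real \<Rightarrow> 'e" and q
  have scale: "snd q * \<tau> \<in> {-T..T}" if "q \<in> Q" "\<tau> \<in> {0..1}" for q \<tau>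
  proof -
    have "\<bar>snd q * \<tau>\<bar> \<le> T * 1"
      unfolding abs_mult using that by (intro mult_mono) (auto simp: Q_def)
    then show ?thesis by (auto simp: abs_le_iff)
  qed
  have cont_f: "continuous_on (Q \<times> {0..1}) (\<lambda>(q, \<tau>). f (fst q, snd q * \<tau>, Y (fst q, snd q * \<tau>)))"
    if "continuous_on Q Y" for Y :: "'p \<times> real \<Rightarrow> 'e"
  proof -
    have "continuous_on (Q \<times> {0..1}) (\<lambda>z. f (fst (fst z), snd (fst z) * snd z, Y (fst (fst z), snd (fst z) * snd z)))"
      using scale
      by (intro continuous_on_compose2[OF f] continuous_intros continuous_on_compose2[OF that])
        (auto simp: Q_def)
    then show ?thesis by (simp add: split_def)
  qed
  have cont_f1: "continuous_on {0..1} (\<lambda>\<tau>. f (fst q, snd q * \<tau>, Y (fst q, snd q * \<tau>)))"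
    if "continuous_on Q Y" "q \<in> Q" for Y :: "'p \<times> real \<Rightarrow> 'e" and q
  proof -
    have "continuous_on {0..1} (\<lambda>\<tau>. (q, \<tau> :: real))" "(\<lambda>\<tau>. (q, \<tau>)) ` {0..1} \<subseteq> Q \<times> {0..1 :: real}"
      using that by (auto intro!: continuous_on_Pair continuous_on_const continuous_on_id)
    from continuous_on_compose2[OF cont_f[OF that(1)] this] show ?thesis by simp
  qed
  have cont_h: "continuous_on Q (h Y)" if "continuous_on Q Y" for Y
  proof -
    have "continuous_on Q (\<lambda>q. integral (cbox 0 1) (\<lambda>\<tau>. f (fst q, snd q * \<tau>, Y (fst q, snd q * \<tau>))))"
      by (rule integral_continuous_on_param) (use cont_f[OF that] in simp)
    then show ?thesis unfolding h_def
      by (intro continuous_intros continuous_on_compose2[OF y0]) (auto simp: Q_def)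
  qed
  define F where "F Y = Bcontfun (\<lambda>q. h (apply_bcontfun Y) (?P q))" for Y
  have F: "apply_bcontfun (F Y) = (\<lambda>q. h (apply_bcontfun Y) (?P q))" for Y
  proof -
    have c: "continuous_on Q (h (apply_bcontfun Y))" by (rule cont_h) simp
    have "range (\<lambda>q. h (apply_bcontfun Y) (?P q)) \<subseteq> h (apply_bcontfun Y) ` Q" using P(1) by auto
    then have "bounded (range (\<lambda>q. h (apply_bcontfun Y) (?P q)))"
      using compact_imp_bounded[OF compact_continuous_image[OF c Q(1)]] bounded_subset by blast
    moreover have "continuous_on UNIV (\<lambda>q. h (apply_bcontfun Y) (?P q))"
      using P(1) by (intro continuous_on_compose2[OF c contP]) auto
    ultimately show ?thesis
      unfolding F_def by (intro Bcontfun_inverse) (simp add: bcontfun_def)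
  qed
  have "\<exists>!Y. F Y = Y"
  proof (rule banach_fix_type[of "1/2"], safe)
    fix Y W :: "('p \<times> real) \<Rightarrow>\<^sub>C 'e"
    show "dist (F Y) (F W) \<le> 1/2 * dist Y W"
    proof (rule dist_bound)
      fix q0
      define q where "q = ?P q0"
      have q: "q \<in> Q" using P(1) by (simp add: q_def)
      let ?k = "\<lambda>Y \<tau>. f (fst q, snd q * \<tau>, apply_bcontfun Y (fst q, snd q * \<tau>))"
      have int: "?k Y integrable_on {0..1}" for Y
        by (intro integrable_continuous_real cont_f1 q) simp
      have "norm (integral {0..1} (?k Y) - integral {0..1} (?k W)) = norm (integral {0..1} (\<lambda>\<tau>. ?k Y \<tau> - ?k W \<tau>))"
        by (simp add: integral_diff[OF int int])
      also have "\<dots> \<le> L * dist Y W * (1 - 0)"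
      proof (rule integral_bound)
        show "continuous_on {0..1} (\<lambda>\<tau>. ?k Y \<tau> - ?k W \<tau>)"
          by (intro continuous_intros cont_f1 q) simp_all
        fix \<tau> :: real assume "\<tau> \<in> {0..1}"
        then have "norm (?k Y \<tau> - ?k W \<tau>) \<le> L * norm (Y (fst q, snd q * \<tau>) - W (fst q, snd q * \<tau>))"
          using lip[OF _ scale[OF q]] q by (auto simp: Q_def)
        also have "\<dots> \<le> L * dist Y W"
          using dist_bounded[of Y _ W] by (intro mult_left_mono L) (simp add: dist_norm)
        finally show "norm (?k Y \<tau> - ?k W \<tau>) \<le> L * dist Y W" .
      qed simp
      finally have 1: "norm (integral {0..1} (?k Y) - integral {0..1} (?k W)) \<le> L * dist Y W" by simp
      have "dist (F Y q0) (F W q0) = \<bar>snd q\<bar> * norm (integral {0..1} (?k Y) - integral {0..1} (?k W))"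
        by (simp add: F h_def dist_norm scaleR_diff_right[symmetric] flip: q_def)
      also have "\<dots> \<le> T * (L * dist Y W)"
        using q 1 T by (intro mult_mono) (auto simp: Q_def)
      also have "\<dots> = (L * T) * dist Y W" by simp
      also have "\<dots> \<le> 1/2 * dist Y W"
        using L(2) by (intro mult_right_mono) auto
      finally show "dist (F Y q0) (F W q0) \<le> 1/2 * dist Y W" .
    qed
  qed auto
  then obtain Y where Y: "F Y = Y" by blast
  define y where "y p t = Y (p, t)" for p t
  have y_eq: "y p t = y0 p + t *\<^sub>R integral {0..1} (\<lambda>\<tau>. f (p, t * \<tau>, y p (t * \<tau>)))"
    if "p \<in> X" "t \<in> {-T..T}" for p t
  proof -
    have "(p, t) \<in> Q" using that by (simp add: Q_def)
    then show ?thesis using fun_cong[OF F, of Y "(p, t)"] P(2) by (simp add: Y h_def y_def)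
  qed
  show ?thesis
  proof (rule that[of y])
    show "continuous_on (X \<times> {-T..T}) (\<lambda>(p, t). y p t)" by (simp add: y_def split_def)
    show "y p 0 = y0 p" if "p \<in> X" for p using y_eq[OF that, of 0] T by simp
    fix p t assume p: "p \<in> X" and t: "t \<in> {-T..T}"
    define k where "k s = f (p, s, y p s)" for s
    define H where "H s = integral {-T..s} k" for s
    have k: "continuous_on {-T..T} k" unfolding k_def y_def
      using p by (intro continuous_on_compose2[OF f] continuous_intros continuous_on_compose2[OF continuous_on_apply_bcontfun[of UNIV Y]]) auto
    have H: "(H has_vector_derivative k s) (at s within {-T..T})" if "s \<in> {-T..T}" for s
      unfolding H_def by (rule integral_has_vector_derivative[OF k that])
    \<comment> \<open>Undoes the rescaling, so that the fundamental theorem of calculus can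
      differentiate in time.\<close>
    have eq: "y p s = y0 p + (H s - H 0)" if s: "s \<in> {-T..T}" for s
    proof -
      have "((\<lambda>\<tau>. s *\<^sub>R k (s * \<tau>)) has_integral (H (s * 1) - H (s * 0))) {0..1}"
      proof (rule fundamental_theorem_of_calculus)
        fix \<tau> :: real assume \<tau>: "\<tau> \<in> {0..1}"
        have sub: "(\<lambda>\<tau>. s * \<tau>) ` {0..1} \<subseteq> {-T..T}"
          using scale[of "(p, s)"] p s by (auto simp: Q_def)
        have "((\<lambda>\<tau>. s * \<tau>) has_vector_derivative s) (at \<tau> within {0..1})"
          by (auto intro!: derivative_eq_intros)
        moreover have "s * \<tau> \<in> {-T..T}" using sub \<tau> by blast
        ultimately have "(H \<circ> (\<lambda>\<tau>. s * \<tau>) has_vector_derivative s *\<^sub>R k (s * \<tau>)) (at \<tau> within {0..1})"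
          by (intro vector_diff_chain_within has_vector_derivative_within_subset[OF H sub])
        then show "((\<lambda>\<tau>. H (s * \<tau>)) has_vector_derivative s *\<^sub>R k (s * \<tau>)) (at \<tau> within {0..1})"
          by (simp only: o_def)
      qed simp
      from integral_unique[OF this]
      have "s *\<^sub>R integral {0..1} (\<lambda>\<tau>. k (s * \<tau>)) = H s - H 0" by simp
      then show ?thesis using y_eq[OF p s] by (simp add: k_def)
    qed
    have "((\<lambda>s. y0 p + (H s - H 0)) has_vector_derivative k t) (at t within {-T..T})"
      using H[OF t] by (auto intro!: derivative_eq_intros)
    then show "(y p has_vector_derivative f (p, t, y p t)) (at t within {-T..T})"
      unfolding k_def[symmetric] by (rule has_vector_derivative_transform[OF t, rotated]) (rule eq)
  qed
qed

section \<open>Differentiability of solutions in the parameter\<close>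

lemma uniform_differentiability:
  fixes f :: "'a::euclidean_space \<Rightarrow> 'b::euclidean_space"
  assumes "open W" "Ck_on 1 W f" "compact K" "K \<subseteq> W" "\<epsilon> > 0"
  obtains d where "d > 0"
    "\<And>x h :: 'a. x \<in> K \<Longrightarrow> norm h \<le> d \<Longrightarrow> x + h \<in> W \<and>
      norm (f (x + h) - f x - frechet_derivative f (at x) h) \<le> \<epsilon> * norm h"
proof -
  obtain \<delta> where \<delta>: "\<delta> > 0" "(\<Union>x\<in>K. cball x \<delta>) \<subseteq> W"
    using compact_subset_open_imp_cball_epsilon_subset[OF assms(3,1,4)] by blast
  let ?D = "\<lambda>x. frechet_derivative f (at x)"
  \<comment> \<open>A thickening of \<open>K\<close> that is still compact and contains the segment
    from \<open>x\<close> to \<open>x + h\<close> for short \<open>h\<close>.\<close>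
  define K' where "K' = (\<Union>x\<in>K. cball x \<delta>)"
  have K': "compact K'" "K \<subseteq> K'" "K' \<subseteq> W"
  proof -
    have "K' = (\<Union>x\<in>K. \<Union>y\<in>cball 0 \<delta>. {x + y})"
    proof (intro equalityI subsetI)
      fix z assume "z \<in> K'"
      then obtain x where "x \<in> K" "dist x z \<le> \<delta>" by (auto simp: K'_def)
      then have "x \<in> K" "z - x \<in> cball 0 \<delta>" "z = x + (z - x)" by (auto simp: dist_norm norm_minus_commute)
      then show "z \<in> (\<Union>x\<in>K. \<Union>y\<in>cball 0 \<delta>. {x + y})" by blast
    next
      fix z assume "z \<in> (\<Union>x\<in>K. \<Union>y\<in>cball 0 \<delta>. {x + y})"
      then obtain x y where "x \<in> K" "norm y \<le> \<delta>" "z = x + y" by auto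
      then show "z \<in> K'" unfolding K'_def by (intro UN_I[of x]) (auto simp: dist_norm)
    qed
    then show "compact K'" using compact_sums'[OF assms(3) compact_cball[of 0 \<delta>]] by simp
  qed (use \<delta> in \<open>auto simp: K'_def\<close>)
  note f = Ck_on_SucD[of 0 W f, folded One_nat_def, OF assms(2)]
  have contD: "continuous_on K' (\<lambda>x. ?D x b)" for b
    using f(2)[of b] K'(3) continuous_on_subset by auto
  \<comment> \<open>A continuous bound for the operator norm of the difference of two derivatives.
    It vanishes on the diagonal, so its uniform continuity makes it small near the diagonal.\<close>
  define S where "S = (\<lambda>z. \<Sum>b\<in>Basis. norm (?D (fst z) b - ?D (snd z) b))"
  have "continuous_on (K' \<times> K') S"
    unfolding S_def by (intro continuous_intros continuous_on_compose2[OF contD]) auto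
  then have "uniformly_continuous_on (K' \<times> K') S"
    by (rule compact_uniformly_continuous) (intro compact_Times K'(1))
  then obtain d where d: "d > 0"
    "\<And>z z'. z \<in> K' \<times> K' \<Longrightarrow> z' \<in> K' \<times> K' \<Longrightarrow> dist z' z < d \<Longrightarrow> dist (S z') (S z) < \<epsilon>"
    using \<open>\<epsilon> > 0\<close> unfolding uniformly_continuous_on_def by blast
  have S0: "S (x, x) = 0" for x by (simp add: S_def)
  show ?thesis
  proof (rule that[of "min \<delta> (d / 2)"])
    show "min \<delta> (d / 2) > 0" using \<delta> d by simp
    fix x h :: 'a assume x: "x \<in> K" and h: "norm h \<le> min \<delta> (d / 2)"
    have "x + h \<in> K'" using x h by (force simp: K'_def dist_norm)
    moreover have "norm (f (x + h) - f x - ?D x (x + h - x)) \<le> norm (x + h - x) * \<epsilon>"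
    proof (rule differentiable_bound_linearization[where S = "cball x (norm h)" and f' = ?D])
      show "x + t *\<^sub>R (x + h - x) \<in> cball x (norm h)" if "t \<in> {0..1}" for t
        using that by (auto simp: dist_norm mult_left_le_one_le)
      fix y assume y: "y \<in> cball x (norm h)"
      then have yK: "y \<in> K'" using x h by (force simp: K'_def)
      then show "(f has_derivative ?D y) (at y within cball x (norm h))"
        using f(1) K'(3) has_derivative_at_withinI by blast
      have "dist (y, x) (x, x) < d"
        using y h d(1) by (simp add: dist_prod_def dist_commute)
      then have "S (y, x) < \<epsilon>"
        using d(2)[of "(x, x)" "(y, x)"] x K'(2) yK by (auto simp: dist_real_def S0)
      have lin: "linear (?D y)" "linear (?D x)"
        by (rule has_derivative_linear[OF f(1)], use yK x K' in blast)+
      show "onorm (?D y - ?D x) \<le> \<epsilon>"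
      proof (rule onorm_le)
        fix v
        have "(?D y - ?D x) v = (\<Sum>b\<in>Basis. (v \<bullet> b) *\<^sub>R (?D y b - ?D x b))"
          by (simp add: linear_sum_Basis[OF lin(1), of v] linear_sum_Basis[OF lin(2), of v]
              scaleR_diff_right sum_subtractf)
        also have "norm \<dots> \<le> (\<Sum>b\<in>Basis. norm v * norm (?D y b - ?D x b))"
          by (rule sum_norm_le) (auto intro!: mult_right_mono Basis_le_norm)
        also have "\<dots> = norm v * S (y, x)" by (simp add: S_def sum_distrib_left)
        also have "\<dots> \<le> norm v * \<epsilon>" using \<open>S (y, x) < \<epsilon>\<close> by (intro mult_left_mono) auto
        finally show "norm ((?D y - ?D x) v) \<le> \<epsilon> * norm v" by (simp add: mult.commute)
      qed
    qed simp
    ultimately show "x + h \<in> W \<and> norm (f (x + h) - f x - ?D x h) \<le> \<epsilon> * norm h"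
      using K'(3) by (auto simp: mult.commute)
  qed
qed

lemma continuous_on_linear_family:
  fixes h :: "'a::topological_space \<Rightarrow> 'e::euclidean_space" and B :: "'a \<Rightarrow> 'e \<Rightarrow> 'f::real_normed_vector"
  assumes "\<And>x. x \<in> S \<Longrightarrow> linear (B x)" "\<And>v. continuous_on S (\<lambda>x. B x v)" "continuous_on S h"
  shows "continuous_on S (\<lambda>x. B x (h x))"
proof -
  have "continuous_on S (\<lambda>x. \<Sum>b\<in>Basis. (h x \<bullet> b) *\<^sub>R B x b)"
    by (intro continuous_intros assms)
  then show ?thesis
    by (rule continuous_on_eq) (simp add: linear_sum_Basis[OF assms(1), symmetric])
qed

lemma compact_linear_family_bound:
  fixes B :: "'a::topological_space \<Rightarrow> 'e::euclidean_space \<Rightarrow> 'f::real_normed_vector"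
  assumes "compact K" "\<And>x. x \<in> K \<Longrightarrow> linear (B x)" "\<And>v. continuous_on K (\<lambda>x. B x v)"
  obtains M where "0 \<le> M" "\<And>x v. x \<in> K \<Longrightarrow> norm (B x v) \<le> M * norm v"
proof -
  define S where "S x = (\<Sum>b\<in>Basis. norm (B x b))" for x
  have "continuous_on K S" unfolding S_def by (intro continuous_intros assms)
  then have "bounded (S ` K)" using compact_continuous_image[OF _ assms(1)] compact_imp_bounded by blast
  then obtain M where M: "\<And>x. x \<in> K \<Longrightarrow> norm (S x) \<le> M" by (auto simp: bounded_iff)
  show ?thesis
  proof (rule that[of "max M 0"])
    fix x v assume x: "x \<in> K"
    have "norm (B x v) = norm (\<Sum>b\<in>Basis. (v \<bullet> b) *\<^sub>R B x b)"
      by (rule arg_cong[OF linear_sum_Basis[OF assms(2)[OF x]]])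
    also have "\<dots> \<le> (\<Sum>b\<in>Basis. norm v * norm (B x b))"
      by (rule sum_norm_le) (auto intro!: mult_right_mono Basis_le_norm)
    also have "\<dots> = S x * norm v" by (simp add: S_def sum_distrib_left mult.commute)
    also have "\<dots> \<le> max M 0 * norm v"
      using M[OF x] by (intro mult_right_mono) (auto simp: abs_le_iff)
    finally show "norm (B x v) \<le> max M 0 * norm v" .
  qed simp
qed

text \<open>The candidate \<open>w h\<close> for the derivative in direction \<open>h\<close> solves
  the linearised equation, whose solution \<open>ode_fixpoint\<close> provides. It is the derivative
  because the error of the linear approximation solves an equation with small inhomogeneity, to
  which \<open>ode_absorb\<close> applies.\<close>

lemma ode_differentiable_local:
  fixes f :: "'p::euclidean_space \<times> real \<times> 'e::euclidean_space \<Rightarrow> 'e" and y :: "'p \<Rightarrow> real \<Rightarrow> 'e"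
  assumes W: "open W" "Ck_on 1 W f" and X: "open X" "p1 \<in> X" and T: "0 < T1" "T1 < T"
    and y_cont: "continuous_on (X \<times> {-T<..<T}) (\<lambda>(p, t). y p t)"
    and y_in: "\<And>p t. p \<in> X \<Longrightarrow> t \<in> {-T<..<T} \<Longrightarrow> (p, t, y p t) \<in> W"
    and ode: "\<And>p t. p \<in> X \<Longrightarrow> t \<in> {-T<..<T} \<Longrightarrow> (y p has_vector_derivative f (p, t, y p t)) (at t)"
    and init: "\<And>p. p \<in> X \<Longrightarrow> y p 0 = y0 p" and y0: "Ck_on 1 X y0"
    and L: "\<And>p t k. p \<in> X \<Longrightarrow> t \<in> {-T<..<T} \<Longrightarrow>
      norm (frechet_derivative f (at (p, t, y p t)) (0, 0, k)) \<le> L * norm k" "0 \<le> L" "L * T \<le> 1/4"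
  obtains \<rho> w where "\<rho> > 0" "ball p1 \<rho> \<subseteq> X"
    "\<And>h. continuous_on (ball p1 \<rho> \<times> {-T1<..<T1}) (\<lambda>(p, t). w h p t)"
    "\<And>h p. p \<in> ball p1 \<rho> \<Longrightarrow> w h p 0 = frechet_derivative y0 (at p) h"
    "\<And>h p t. p \<in> ball p1 \<rho> \<Longrightarrow> t \<in> {-T1<..<T1} \<Longrightarrow>
      (w h p has_vector_derivative frechet_derivative f (at (p, t, y p t)) (h, 0, w h p t)) (at t)"
    "\<And>p t. p \<in> ball p1 \<rho> \<Longrightarrow> t \<in> {-T1<..<T1} \<Longrightarrow> ((\<lambda>q. y q t) has_derivative (\<lambda>h. w h p t)) (at p)"
proof -
  obtain \<rho> where \<rho>: "\<rho> > 0" "cball p1 \<rho> \<subseteq> X" using X open_contains_cball by blast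
  \<comment> \<open>The uniform estimates need a compact time interval inside the open one;
    \<open>ode_differentiable\<close> later recovers the open interval.\<close>
  define J where "J = {-T1..T1}"
  have J: "J \<subseteq> {-T<..<T}" "0 \<in> J" using T by (auto simp: J_def)
  define X1 where "X1 = cball p1 \<rho>"
  have X1: "X1 \<subseteq> X" "compact X1" "convex X1" "X1 \<noteq> {}" using \<rho> by (auto simp: X1_def)
  have cy: "continuous_on (X1 \<times> J) (\<lambda>q. y (fst q) (snd q))"
    using continuous_on_subset[OF y_cont, of "X1 \<times> J"] J X1 by (auto simp: split_def)
  let ?c = "\<lambda>p t. (p, t, y p t)" and ?D = "\<lambda>q. frechet_derivative f (at q)"
  define K where "K = (\<lambda>q. ?c (fst q) (snd q)) ` (X1 \<times> J)"
  have K: "compact K" "K \<subseteq> W"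
  proof -
    have "continuous_on (X1 \<times> J) (\<lambda>q. ?c (fst q) (snd q))"
      by (intro continuous_on_Pair continuous_on_fst continuous_on_snd continuous_on_id cy)
    then show "compact K" unfolding K_def
      by (rule compact_continuous_image) (simp add: compact_Times X1(2) J_def)
    show "K \<subseteq> W" unfolding K_def using y_in X1(1) J(1) by fastforce
  qed
  have KI: "?c p t \<in> K" if "p \<in> X1" "t \<in> J" for p t
    unfolding K_def using that by (intro image_eqI[of _ _ "(p, t)"]) auto
  note f = Ck_on_SucD[of 0 W f, folded One_nat_def, OF W(2)]
  have linD: "linear (?D q)" if "q \<in> W" for q using has_derivative_linear[OF f(1)[OF that]] .
  have linDc: "linear (?D (?c p t))" if "p \<in> X1" "t \<in> J" for p t
    using linD K KI[OF that] by blast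
  have contD: "continuous_on W (\<lambda>q. ?D q v)" for v using f(2)[of v] by simp
  have LJ: "norm (?D (?c p t) (0, 0, k)) \<le> L * norm k" if "p \<in> X1" "t \<in> J" for p t k
    using L(1) X1 J that by blast
  have LT: "L * T1 \<le> 1/4" using L(2,3) T mult_left_mono[of T1 T L] by linarith
  have Dsplit: "?D (?c p t) (h, 0, u) - ?D (?c p t) (h, 0, v) = ?D (?c p t) (0, 0, u - v)"
    if "p \<in> X1" "t \<in> J" for p t h u v
    using linear_diff[OF linDc[OF that], of "(h, 0, u)" "(h, 0, v)"] by simp
  \<comment> \<open>The linearised equation is affine in the unknown, with the Lipschitz constant
    \<open>L\<close> of the original one, so the same existence lemma applies on the same kind of
    interval.\<close>
  have ex: "\<exists>w. continuous_on (X1 \<times> J) (\<lambda>(p, t). w p t) \<and> (\<forall>p\<in>X1. w p 0 = frechet_derivative y0 (at p) h)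
      \<and> (\<forall>p\<in>X1. \<forall>t\<in>J. (w p has_vector_derivative ?D (?c p t) (h, 0, w p t)) (at t within J))" for h
  proof -
    let ?g = "\<lambda>z. ?D (?c (fst z) (fst (snd z))) (h, 0, snd (snd z))"
    have 1: "continuous_on (X1 \<times> J \<times> UNIV) ?g"
    proof (rule continuous_on_linear_family[where B = "\<lambda>z. ?D (?c (fst z) (fst (snd z)))"])
      show "linear (?D (?c (fst z) (fst (snd z))))" if "z \<in> X1 \<times> J \<times> UNIV" for z
        using that by (intro linDc) auto
      show "continuous_on (X1 \<times> J \<times> UNIV) (\<lambda>z. ?D (?c (fst z) (fst (snd z))) v)" for v
      proof (rule continuous_on_compose2[OF contD])
        have "continuous_on (X1 \<times> J \<times> UNIV) (\<lambda>z. (fst z, fst (snd z)))"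
          by (intro continuous_intros)
        moreover have "(\<lambda>z. (fst z, fst (snd z))) ` (X1 \<times> J \<times> (UNIV :: 'e set)) \<subseteq> X1 \<times> J" by auto
        ultimately have "continuous_on (X1 \<times> J \<times> UNIV) (\<lambda>z. y (fst z) (fst (snd z)))"
          using continuous_on_compose2[OF cy] by fastforce
        then show "continuous_on (X1 \<times> J \<times> UNIV) (\<lambda>z. ?c (fst z) (fst (snd z)))"
          by (intro continuous_on_Pair continuous_on_fst continuous_on_snd continuous_on_id)
      qed (use KI K in auto)
    qed (intro continuous_intros)
    have 2: "norm (?g (p, t, u) - ?g (p, t, v)) \<le> L * norm (u - v)" if "p \<in> X1" "t \<in> {-T1..T1}" for p t u v
      using Dsplit[of p t h u v] LJ[of p t "u - v"] that by (simp add: J_def)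
    have 3: "continuous_on X1 (\<lambda>p. frechet_derivative y0 (at p) h)"
      using Ck_on_SucD(2)[of 0 X y0 h] y0 X1(1) continuous_on_subset by auto
    show ?thesis
      by (rule ode_fixpoint[OF X1(2-4) T(1) 1[unfolded J_def] 2 L(2) _ 3])
        (use LT in \<open>auto simp: J_def\<close>)
  qed
  then obtain w where
    w_cont: "\<And>h. continuous_on (X1 \<times> J) (\<lambda>(p, t). w h p t)"
    and w0: "\<And>h p. p \<in> X1 \<Longrightarrow> w h p 0 = frechet_derivative y0 (at p) h"
    and w: "\<And>h p t. p \<in> X1 \<Longrightarrow> t \<in> J \<Longrightarrow>
      (w h p has_vector_derivative ?D (?c p t) (h, 0, w h p t)) (at t within J)"
    by metis
  have y: "(y p has_vector_derivative f (?c p t)) (at t within J)" if "p \<in> X1" "t \<in> J" for p t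
    using ode X1 J that has_vector_derivative_at_within by blast
  note absorb = ode_absorb[of "-T1" T1 T1, folded J_def, OF J(2) order_refl]
  have y0_lin: "linear (frechet_derivative y0 (at p))" if "p \<in> X" for p
    using has_derivative_linear[OF Ck_on_SucD(1)[of 0 X y0]] y0 that by simp
  obtain M where M: "0 \<le> M" "\<And>q h. q \<in> K \<Longrightarrow> norm (?D q (h, 0, 0)) \<le> M * norm h"
  proof (rule compact_linear_family_bound[OF K(1), of "\<lambda>q h. ?D q (h, 0, 0)"])
    show "linear (\<lambda>h. ?D q (h, 0, 0))" if "q \<in> K" for q
    proof -
      have "linear (\<lambda>h::'p. (h, 0::real, 0::'e))" by (auto intro!: linearI)
      moreover have "linear (?D q)" using linD that K by blast
      ultimately show ?thesis using linear_compose by (fastforce simp: o_def)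
    qed
  qed (use contD K continuous_on_subset in blast)+
  \<comment> \<open>Linearity in \<open>h\<close> is a uniqueness statement: each defect solves a
    homogeneous linear equation with initial value zero, and \<open>ode_absorb\<close> with
    \<open>e = 0\<close> forces it to vanish.\<close>
  have w_lin: "linear (\<lambda>h. w h p t)" if p: "p \<in> X1" and t: "t \<in> J" for p t
  proof (rule linearI)
    have p': "p \<in> X" using p X1 by auto
    fix h1 h2 :: 'p and c :: real
    let ?r = "\<lambda>s. w (h1 + h2) p s - (w h1 p s + w h2 p s)"
    have "norm (?r t) \<le> 2 * (norm (?r 0) + T1 * 0)"
    proof (rule absorb[OF t _ _ L(2), where r' = "\<lambda>s. ?D (?c p s) (h1 + h2, 0, w (h1 + h2) p s)
        - (?D (?c p s) (h1, 0, w h1 p s) + ?D (?c p s) (h2, 0, w h2 p s))"])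
      fix s assume s: "s \<in> J"
      show "(?r has_vector_derivative ?D (?c p s) (h1 + h2, 0, w (h1 + h2) p s)
        - (?D (?c p s) (h1, 0, w h1 p s) + ?D (?c p s) (h2, 0, w h2 p s))) (at s within J)"
        by (intro has_vector_derivative_diff has_vector_derivative_add w p s)
      have "?D (?c p s) (h1, 0, w h1 p s) + ?D (?c p s) (h2, 0, w h2 p s)
          = ?D (?c p s) (h1 + h2, 0, w h1 p s + w h2 p s)"
        using linear_add[OF linDc[OF p s], of "(h1, 0, w h1 p s)" "(h2, 0, w h2 p s)"] by simp
      then show "norm (?D (?c p s) (h1 + h2, 0, w (h1 + h2) p s)
        - (?D (?c p s) (h1, 0, w h1 p s) + ?D (?c p s) (h2, 0, w h2 p s))) \<le> 0 + L * norm (?r s)"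
        using LJ[OF p s, of "?r s"] Dsplit[OF p s, of "h1 + h2" "w (h1 + h2) p s" "w h1 p s + w h2 p s"]
        by simp
    qed (use LT in simp)
    then show "w (h1 + h2) p t = w h1 p t + w h2 p t"
      by (simp add: w0[OF p] linear_add[OF y0_lin[OF p']])
    let ?r = "\<lambda>s. w (c *\<^sub>R h1) p s - c *\<^sub>R w h1 p s"
    have "norm (?r t) \<le> 2 * (norm (?r 0) + T1 * 0)"
    proof (rule absorb[OF t _ _ L(2), where r' = "\<lambda>s. ?D (?c p s) (c *\<^sub>R h1, 0, w (c *\<^sub>R h1) p s)
        - c *\<^sub>R ?D (?c p s) (h1, 0, w h1 p s)"])
      fix s assume s: "s \<in> J"
      have "((\<lambda>s. c *\<^sub>R w h1 p s) has_vector_derivative c *\<^sub>R ?D (?c p s) (h1, 0, w h1 p s)) (at s within J)"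
        using has_vector_derivative_scaleR[OF DERIV_const w[OF p s]] by simp
      then show "(?r has_vector_derivative ?D (?c p s) (c *\<^sub>R h1, 0, w (c *\<^sub>R h1) p s)
        - c *\<^sub>R ?D (?c p s) (h1, 0, w h1 p s)) (at s within J)"
        by (intro has_vector_derivative_diff w p s)
      have "c *\<^sub>R ?D (?c p s) (h1, 0, w h1 p s) = ?D (?c p s) (c *\<^sub>R h1, 0, c *\<^sub>R w h1 p s)"
        using linear_cmul[OF linDc[OF p s], of c "(h1, 0, w h1 p s)"] by simp
      then show "norm (?D (?c p s) (c *\<^sub>R h1, 0, w (c *\<^sub>R h1) p s)
        - c *\<^sub>R ?D (?c p s) (h1, 0, w h1 p s)) \<le> 0 + L * norm (?r s)"
        using LJ[OF p s, of "?r s"] Dsplit[OF p s, of "c *\<^sub>R h1" "w (c *\<^sub>R h1) p s" "c *\<^sub>R w h1 p s"]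
        by simp
    qed (use LT in simp)
    then show "w (c *\<^sub>R h1) p t = c *\<^sub>R w h1 p t"
      by (simp add: w0[OF p] linear_cmul[OF y0_lin[OF p']])
  qed
  have ucy: "uniformly_continuous_on (X1 \<times> J) (\<lambda>q. y (fst q) (snd q))"
    by (rule compact_uniformly_continuous[OF cy]) (simp add: compact_Times X1 J_def)
  have deriv: "((\<lambda>q. y q t) has_derivative (\<lambda>h. w h p t)) (at p)" if p: "p \<in> ball p1 \<rho>" and t: "t \<in> J" for p t
    unfolding has_derivative_at_alt
  proof (intro conjI allI impI)
    have p': "p \<in> X1" "p \<in> X" using p X1 by (auto simp: X1_def)
    show "bounded_linear (\<lambda>h. w h p t)"
      by (rule w_lin[OF p'(1) t, unfolded linear_conv_bounded_linear])
    obtain M0 where M0: "M0 > 0" "\<And>h. norm (frechet_derivative y0 (at p) h) \<le> M0 * norm h"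
      using linear_bounded_pos[OF y0_lin[OF p'(2)]] by blast
    \<comment> \<open>This is the bound of \<open>ode_absorb\<close> for an initial value of size
      \<open>M0 * norm h\<close> and an inhomogeneity of size \<open>M * norm h\<close>.\<close>
    define C where "C = 2 * (M0 + T1 * M)"
    have C: "0 \<le> C" using M0 M T by (simp add: C_def)
    have w_bound: "norm (w h p s) \<le> C * norm h" if s: "s \<in> J" for h s
    proof -
      have "norm (w h p s) \<le> 2 * (norm (w h p 0) + T1 * (M * norm h))"
      proof (rule absorb[OF s w[OF p'(1)] _ L(2)])
        fix s assume s: "s \<in> J"
        have eq: "?D (?c p s) (h, 0, w h p s) = ?D (?c p s) (h, 0, 0) + ?D (?c p s) (0, 0, w h p s)"
          using linear_add[OF linDc[OF p'(1) s], of "(h, 0, 0)" "(0, 0, w h p s)"] by simp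
        show "norm (?D (?c p s) (h, 0, w h p s)) \<le> M * norm h + L * norm (w h p s)"
          unfolding eq
          using norm_triangle_ineq[of "?D (?c p s) (h, 0, 0)" "?D (?c p s) (0, 0, w h p s)"]
            M(2)[OF KI[OF p'(1) s], of h] LJ[OF p'(1) s, of "w h p s"] by linarith
      qed (use LT in simp_all)
      also have "\<dots> \<le> C * norm h"
        using M0(2)[of h] by (simp add: w0[OF p'(1)] C_def algebra_simps)
      finally show ?thesis .
    qed
    fix \<epsilon>0 :: real assume "0 < \<epsilon>0"
    \<comment> \<open>The first bound yields \<open>(L + \<epsilon>) * T1 \<le> 1/2\<close>, which
      is why \<open>L * T\<close> was limited to \<open>1/4\<close>; the second makes the final
      error at most \<open>\<epsilon>0 * norm h\<close>.\<close>
    define \<epsilon> where "\<epsilon> = min (1 / (4 * T1)) (\<epsilon>0 / (2 * (1 + T1 * (1 + C))))"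
    have den: "1 + T1 * (1 + C) > 0" using T C by (simp add: add_pos_nonneg)
    have \<epsilon>: "\<epsilon> > 0" "\<epsilon> * T1 \<le> 1/4" "2 * (\<epsilon> * (1 + T1 * (1 + C))) \<le> \<epsilon>0"
    proof -
      show "\<epsilon> > 0" using T \<open>0 < \<epsilon>0\<close> den by (simp add: \<epsilon>_def)
      have "\<epsilon> * T1 \<le> 1 / (4 * T1) * T1" using T by (intro mult_right_mono) (auto simp: \<epsilon>_def)
      then show "\<epsilon> * T1 \<le> 1/4" using T by simp
      have "\<epsilon> * (1 + T1 * (1 + C)) \<le> \<epsilon>0 / (2 * (1 + T1 * (1 + C))) * (1 + T1 * (1 + C))"
        using den by (intro mult_right_mono) (auto simp: \<epsilon>_def)
      also have "\<dots> = \<epsilon>0 / 2"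
        unfolding times_divide_eq_left by (rule mult_divide_mult_cancel_right[OF less_imp_neq[OF den, symmetric]])
      finally show "2 * (\<epsilon> * (1 + T1 * (1 + C))) \<le> \<epsilon>0" by simp
    qed
    obtain d where d: "d > 0" "\<And>q k. q \<in> K \<Longrightarrow> norm k \<le> d \<Longrightarrow>
        norm (f (q + k) - f q - ?D q k) \<le> \<epsilon> * norm k"
      using uniform_differentiability[OF W K \<open>\<epsilon> > 0\<close>] by metis
    obtain d1 where d1: "d1 > 0" "\<And>q s. q \<in> X1 \<Longrightarrow> s \<in> J \<Longrightarrow> dist q p < d1 \<Longrightarrow> dist (y q s) (y p s) < d / 2"
    proof -
      obtain d1 where "d1 > 0" and *: "\<And>z z'. z \<in> X1 \<times> J \<Longrightarrow> z' \<in> X1 \<times> J \<Longrightarrow> dist z' z < d1 \<Longrightarrow>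
          dist (y (fst z') (snd z')) (y (fst z) (snd z)) < d / 2"
        using ucy half_gt_zero[OF d(1)] unfolding uniformly_continuous_on_def by meson
      show thesis
        by (rule that[OF \<open>d1 > 0\<close>]) (use *[of "(p, _)" "(_, _)"] p' in \<open>auto simp: dist_prod_def\<close>)
    qed
    obtain d2 where d2: "d2 > 0" "\<And>q. norm (q - p) < d2 \<Longrightarrow>
        norm (y0 q - y0 p - frechet_derivative y0 (at p) (q - p)) \<le> \<epsilon> * norm (q - p)"
      using Ck_on_SucD(1)[of 0 X y0, folded One_nat_def, OF y0 p'(2)] \<epsilon>(1)
      unfolding has_derivative_at_alt by blast
    obtain d3 where d3: "d3 > 0" "ball p d3 \<subseteq> X1"
      using p openE[OF open_ball] ball_subset_cball[of p1 \<rho>] unfolding X1_def by (metis subset_trans)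
    show "\<exists>\<delta>>0. \<forall>q. norm (q - p) < \<delta> \<longrightarrow> norm (y q t - y p t - w (q - p) p t) \<le> \<epsilon>0 * norm (q - p)"
    proof (intro exI[of _ "min (d / 2) (min d1 (min d2 d3))"] conjI allI impI)
      show "min (d / 2) (min d1 (min d2 d3)) > 0" using d d1 d2 d3 by simp
      fix q assume "norm (q - p) < min (d / 2) (min d1 (min d2 d3))"
      then have q: "norm (q - p) < d / 2" "dist q p < d1" "norm (q - p) < d2" "q \<in> X1"
        using d3(2) by (auto simp: dist_norm norm_minus_commute subset_iff)
      define h where "h = q - p"
      \<comment> \<open>The error of the linear approximation. Its derivative consists of the Taylor
        error of \<open>f\<close>, whose displacement again involves \<open>?r\<close>, and a term
        bounded by \<open>L * norm (?r s)\<close>; hence the constant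
        \<open>L + \<epsilon>\<close>.\<close>
      let ?r = "\<lambda>s. y q s - y p s - w h p s"
      have "norm (?r t) \<le> 2 * (norm (?r 0) + T1 * (\<epsilon> * (1 + C) * norm h))"
      proof (rule absorb[OF t, where L = "L + \<epsilon>" and
          r' = "\<lambda>s. f (?c q s) - f (?c p s) - ?D (?c p s) (h, 0, w h p s)"])
        fix s assume s: "s \<in> J"
        show "(?r has_vector_derivative f (?c q s) - f (?c p s) - ?D (?c p s) (h, 0, w h p s)) (at s within J)"
          by (intro has_vector_derivative_diff w y p' q s)
        define k where "k = (h, 0::real, y q s - y p s)"
        have k_le: "norm k \<le> norm h + norm (y q s - y p s)"
          by (simp add: k_def norm_Pair sqrt_add_le_add_sqrt[THEN order_trans])
        have "norm (y q s - y p s) < d / 2" using d1(2)[OF q(4) s q(2)] by (simp add: dist_norm)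
        then have "norm k \<le> d" using k_le q(1) by (simp add: h_def)
        moreover have "?c p s + k = ?c q s" by (simp add: k_def h_def)
        ultimately have 1: "norm (f (?c q s) - f (?c p s) - ?D (?c p s) k) \<le> \<epsilon> * norm k"
          using d(2)[OF KI[OF p'(1) s], of k] by simp
        have "norm (y q s - y p s) \<le> norm (?r s) + norm (w h p s)"
          using norm_triangle_ineq[of "?r s" "w h p s"] by simp
        then have "norm k \<le> (1 + C) * norm h + norm (?r s)"
          using k_le w_bound[OF s, of h] by (simp add: algebra_simps)
        then have 2: "\<epsilon> * norm k \<le> \<epsilon> * ((1 + C) * norm h + norm (?r s))"
          using \<epsilon>(1) by (intro mult_left_mono) auto
        have "?D (?c p s) k - ?D (?c p s) (h, 0, w h p s) = ?D (?c p s) (0, 0, ?r s)"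
          unfolding k_def by (rule Dsplit[OF p'(1) s])
        then have eq: "f (?c q s) - f (?c p s) - ?D (?c p s) (h, 0, w h p s)
          = (f (?c q s) - f (?c p s) - ?D (?c p s) k) + ?D (?c p s) (0, 0, ?r s)"
          by (simp add: algebra_simps)
        have "norm (f (?c q s) - f (?c p s) - ?D (?c p s) (h, 0, w h p s))
            \<le> \<epsilon> * norm k + L * norm (?r s)"
          unfolding eq
          using norm_triangle_ineq[of "f (?c q s) - f (?c p s) - ?D (?c p s) k" "?D (?c p s) (0, 0, ?r s)"]
            1 LJ[OF p'(1) s, of "?r s"] by linarith
        also have "\<dots> \<le> \<epsilon> * (1 + C) * norm h + (L + \<epsilon>) * norm (?r s)"
          using 2 by (simp add: algebra_simps)
        finally show "norm (f (?c q s) - f (?c p s) - ?D (?c p s) (h, 0, w h p s))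
            \<le> \<epsilon> * (1 + C) * norm h + (L + \<epsilon>) * norm (?r s)" .
      next
        show "0 \<le> L + \<epsilon>" using L(2) \<epsilon>(1) by simp
        show "(L + \<epsilon>) * T1 \<le> 1 / 2" using LT \<epsilon>(2) by (simp add: algebra_simps)
      qed
      moreover have "norm (?r 0) \<le> \<epsilon> * norm h"
        using d2(2)[OF q(3)] q(4) X1(1) p' init w0[OF p'(1)] by (auto simp: h_def)
      ultimately have "norm (?r t) \<le> 2 * (\<epsilon> * (1 + T1 * (1 + C))) * norm h"
        by (simp add: algebra_simps)
      also have "\<dots> \<le> \<epsilon>0 * norm h" using \<epsilon>(3) by (intro mult_right_mono) auto
      finally show "norm (y q t - y p t - w (q - p) p t) \<le> \<epsilon>0 * norm (q - p)" by (simp add: h_def)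
    qed
  qed
  have sub: "ball p1 \<rho> \<times> {-T1<..<T1} \<subseteq> X1 \<times> J" by (auto simp: X1_def J_def)
  show ?thesis
  proof (rule that[of \<rho> w])
    show "\<rho> > 0" "ball p1 \<rho> \<subseteq> X" using \<rho> by auto
    show "continuous_on (ball p1 \<rho> \<times> {-T1<..<T1}) (\<lambda>(p, t). w h p t)" for h
      using continuous_on_subset[OF w_cont sub] .
    fix h p assume p: "p \<in> ball p1 \<rho>"
    then show "w h p 0 = frechet_derivative y0 (at p) h" using w0 sub by (auto simp: X1_def)
    fix t assume t: "t \<in> {-T1<..<T1}"
    show "(w h p has_vector_derivative ?D (?c p t) (h, 0, w h p t)) (at t)"
      using w[of p t h] p t at_within_Icc_at[of "-T1" t T1] by (auto simp: X1_def J_def)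
    show "((\<lambda>q. y q t) has_derivative (\<lambda>h. w h p t)) (at p)"
      using deriv[OF p] t by (auto simp: J_def)
  qed
qed

text \<open>The local solutions of the linearised equation are all equal to the derivative, which is
  unique, so they fit together over \<open>X\<close> and the full open interval.\<close>

lemma ode_differentiable:
  fixes f :: "'p::euclidean_space \<times> real \<times> 'e::euclidean_space \<Rightarrow> 'e" and y :: "'p \<Rightarrow> real \<Rightarrow> 'e"
  assumes W: "open W" "Ck_on 1 W f" and X: "open X" and T: "0 < T"
    and y_cont: "continuous_on (X \<times> {-T<..<T}) (\<lambda>(p, t). y p t)"
    and y_in: "\<And>p t. p \<in> X \<Longrightarrow> t \<in> {-T<..<T} \<Longrightarrow> (p, t, y p t) \<in> W"
    and ode: "\<And>p t. p \<in> X \<Longrightarrow> t \<in> {-T<..<T} \<Longrightarrow> (y p has_vector_derivative f (p, t, y p t)) (at t)"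
    and init: "\<And>p. p \<in> X \<Longrightarrow> y p 0 = y0 p" and y0: "Ck_on 1 X y0"
    and L: "\<And>p t k. p \<in> X \<Longrightarrow> t \<in> {-T<..<T} \<Longrightarrow>
      norm (frechet_derivative f (at (p, t, y p t)) (0, 0, k)) \<le> L * norm k" "0 \<le> L" "L * T \<le> 1/4"
  defines "w \<equiv> \<lambda>h p t. frechet_derivative (\<lambda>q. y q t) (at p) h"
  shows "p \<in> X \<Longrightarrow> t \<in> {-T<..<T} \<Longrightarrow> ((\<lambda>q. y q t) has_derivative (\<lambda>h. w h p t)) (at p)"
    and "continuous_on (X \<times> {-T<..<T}) (\<lambda>(p, t). w h p t)"
    and "p \<in> X \<Longrightarrow> w h p 0 = frechet_derivative y0 (at p) h"
    and "p \<in> X \<Longrightarrow> t \<in> {-T<..<T} \<Longrightarrow>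
      (w h p has_vector_derivative frechet_derivative f (at (p, t, y p t)) (h, 0, w h p t)) (at t)"
proof -
  have near: "\<exists>\<rho> T1. 0 < \<rho> \<and> 0 < T1 \<and> T1 < T \<and> \<bar>t\<bar> < T1 \<and> ball p \<rho> \<subseteq> X \<and>
      (\<forall>h. continuous_on (ball p \<rho> \<times> {-T1<..<T1}) (\<lambda>(p, t). w h p t) \<and>
        (\<forall>q\<in>ball p \<rho>. w h q 0 = frechet_derivative y0 (at q) h \<and>
          (\<forall>s\<in>{-T1<..<T1}. ((\<lambda>q. y q s) has_derivative (\<lambda>h. w h q s)) (at q) \<and>
            (w h q has_vector_derivative frechet_derivative f (at (q, s, y q s)) (h, 0, w h q s)) (at s))))"
    if p: "p \<in> X" and t: "t \<in> {-T<..<T}" for p t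
  proof -
    \<comment> \<open>Any value strictly between \<open>\<bar>t\<bar>\<close> and \<open>T\<close>
      would serve.\<close>
    define T1 where "T1 = (\<bar>t\<bar> + T) / 2"
    have T1: "0 < T1" "T1 < T" "\<bar>t\<bar> < T1" using t by (auto simp: T1_def)
    obtain \<rho> w' where \<rho>: "\<rho> > 0" "ball p \<rho> \<subseteq> X"
      and c: "\<And>h. continuous_on (ball p \<rho> \<times> {-T1<..<T1}) (\<lambda>(p, t). w' h p t)"
      and i0: "\<And>h q. q \<in> ball p \<rho> \<Longrightarrow> w' h q 0 = frechet_derivative y0 (at q) h"
      and v: "\<And>h q s. q \<in> ball p \<rho> \<Longrightarrow> s \<in> {-T1<..<T1} \<Longrightarrow>
        (w' h q has_vector_derivative frechet_derivative f (at (q, s, y q s)) (h, 0, w' h q s)) (at s)"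
      and d: "\<And>q s. q \<in> ball p \<rho> \<Longrightarrow> s \<in> {-T1<..<T1} \<Longrightarrow>
        ((\<lambda>q. y q s) has_derivative (\<lambda>h. w' h q s)) (at q)"
      using ode_differentiable_local[OF W X p T1(1,2) y_cont y_in ode init y0 L] by blast
    have eq: "w h q s = w' h q s" if "q \<in> ball p \<rho>" "s \<in> {-T1<..<T1}" for h q s
      unfolding w_def using fun_cong[OF frechet_derivative_at[OF d[OF that]], of h] by simp
    have v': "(w h q has_vector_derivative frechet_derivative f (at (q, s, y q s)) (h, 0, w h q s)) (at s)"
      if q: "q \<in> ball p \<rho>" and s: "s \<in> {-T1<..<T1}" for h q s
      unfolding eq[OF that]
      by (rule has_vector_derivative_transform_within_open[OF v[OF q s] open_greaterThanLessThan s])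
        (simp add: eq[OF q])
    have c': "continuous_on (ball p \<rho> \<times> {-T1<..<T1}) (\<lambda>(p, t). w h p t)" for h
      by (rule continuous_on_eq[OF c[of h]]) (auto simp: eq)
    have i0': "w h q 0 = frechet_derivative y0 (at q) h" if "q \<in> ball p \<rho>" for h q
      using i0[OF that, of h] eq[OF that, of 0 h] T1 by simp
    have d': "((\<lambda>q. y q s) has_derivative (\<lambda>h. w h q s)) (at q)" if "q \<in> ball p \<rho>" "s \<in> {-T1<..<T1}" for q s
      using d[OF that] by (simp add: eq[OF that])
    show ?thesis
      using \<rho> T1 v' c' i0' d' by (intro exI[of _ \<rho>] exI[of _ T1] conjI allI ballI) simp_all
  qed
  show "p \<in> X \<Longrightarrow> t \<in> {-T<..<T} \<Longrightarrow> ((\<lambda>q. y q t) has_derivative (\<lambda>h. w h p t)) (at p)"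
    using near[of p t] by (force simp: abs_less_iff)
  show "p \<in> X \<Longrightarrow> w h p 0 = frechet_derivative y0 (at p) h"
    using near[of p 0] T by force
  show "p \<in> X \<Longrightarrow> t \<in> {-T<..<T} \<Longrightarrow>
      (w h p has_vector_derivative frechet_derivative f (at (p, t, y p t)) (h, 0, w h p t)) (at t)"
    using near[of p t] by (force simp: abs_less_iff)
  have "Ck_on 0 (X \<times> {-T<..<T}) (\<lambda>(p, t). w h p t)"
  proof (rule Ck_on_local)
    fix z assume "z \<in> X \<times> {-T<..<T}"
    then obtain \<rho> T1 where "0 < \<rho>" "\<bar>snd z\<bar> < T1"
      "continuous_on (ball (fst z) \<rho> \<times> {-T1<..<T1}) (\<lambda>(p, t). w h p t)"
      using near[of "fst z" "snd z"] by (auto simp: mem_Times_iff)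
    then show "\<exists>U. open U \<and> z \<in> U \<and> Ck_on 0 U (\<lambda>(p, t). w h p t)"
      by (intro exI[of _ "ball (fst z) \<rho> \<times> {-T1<..<T1}"]) (auto simp: open_Times mem_Times_iff abs_less_iff)
  qed (intro open_Times X open_greaterThanLessThan)
  then show "continuous_on (X \<times> {-T<..<T}) (\<lambda>(p, t). w h p t)" by simp
qed

text \<open>The derivative of the solution in a parameter direction solves an equation of the same kind,
  with the same constant \<open>L\<close>; hence the induction.\<close>

lemma ode_Ck:
  fixes f :: "'p::euclidean_space \<times> real \<times> 'e::euclidean_space \<Rightarrow> 'e" and y :: "'p \<Rightarrow> real \<Rightarrow> 'e"
  assumes X: "open X" and T: "0 < T" and L: "0 \<le> L" "L * T \<le> 1/4"
  shows "open W \<Longrightarrow> Ck_on k W f \<Longrightarrow> continuous_on (X \<times> {-T<..<T}) (\<lambda>(p, t). y p t) \<Longrightarrow>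
    (\<And>p t. p \<in> X \<Longrightarrow> t \<in> {-T<..<T} \<Longrightarrow> (p, t, y p t) \<in> W) \<Longrightarrow>
    (\<And>p t. p \<in> X \<Longrightarrow> t \<in> {-T<..<T} \<Longrightarrow> (y p has_vector_derivative f (p, t, y p t)) (at t)) \<Longrightarrow>
    (\<And>p. p \<in> X \<Longrightarrow> y p 0 = y0 p) \<Longrightarrow> Ck_on k X y0 \<Longrightarrow>
    (\<And>p t v. 0 < k \<Longrightarrow> p \<in> X \<Longrightarrow> t \<in> {-T<..<T} \<Longrightarrow>
      norm (frechet_derivative f (at (p, t, y p t)) (0, 0, v)) \<le> L * norm v) \<Longrightarrow>
    Ck_on k (X \<times> {-T<..<T}) (\<lambda>(p, t). y p t)"
proof (induction k arbitrary: f W y y0)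
  case 0
  then show ?case by simp
next
  case (Suc k)
  let ?I = "{-T<..<T}"
  have open_XI: "open (X \<times> ?I)" by (intro open_Times X open_greaterThanLessThan)
  note f_in = Suc.prems(4) and ode = Suc.prems(5) and init = Suc.prems(6)
  have bound: "norm (frechet_derivative f (at (p, t, y p t)) (0, 0, v)) \<le> L * norm v"
    if "p \<in> X" "t \<in> ?I" for p t v using Suc.prems(8) that by simp
  have f1: "Ck_on 1 W f" and y01: "Ck_on 1 X y0"
    using Ck_on_le[OF Suc.prems(2)] Ck_on_le[OF Suc.prems(7)] by simp_all
  have yk: "Ck_on k (X \<times> ?I) (\<lambda>(p, t). y p t)"
    by (rule Suc.IH[OF Suc.prems(1) Ck_on_Suc_imp[OF Suc.prems(2)] Suc.prems(3) f_in ode init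
          Ck_on_Suc_imp[OF Suc.prems(7)] bound])
  let ?c = "\<lambda>p t. (p, t, y p t)"
  define w where "w = (\<lambda>h p t. frechet_derivative (\<lambda>q. y q t) (at p) h)"
  note D' = ode_differentiable[OF Suc.prems(1) f1 X T Suc.prems(3) f_in ode init y01 bound L]
  have D: "\<And>p t. p \<in> X \<Longrightarrow> t \<in> ?I \<Longrightarrow> ((\<lambda>q. y q t) has_derivative (\<lambda>h. w h p t)) (at p)"
    "\<And>h. continuous_on (X \<times> ?I) (\<lambda>(p, t). w h p t)"
    "\<And>h p. p \<in> X \<Longrightarrow> w h p 0 = frechet_derivative y0 (at p) h"
    "\<And>h p t. p \<in> X \<Longrightarrow> t \<in> ?I \<Longrightarrow>
      (w h p has_vector_derivative frechet_derivative f (at (?c p t)) (h, 0, w h p t)) (at t)"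
    unfolding w_def by (rule D'(1), assumption+) (rule D'(2), assumption+, rule D'(3), assumption+, rule D'(4), assumption+)
  have wk: "Ck_on k (X \<times> ?I) (\<lambda>(p, t). w h p t)" for h
  proof -
    \<comment> \<open>In the linearised equation the known solution \<open>y\<close> becomes part of
      the right-hand side \<open>?g\<close>. It is of class \<open>k\<close> by the induction
      hypothesis for \<open>y\<close>, and this is all the second use of the hypothesis, for
      \<open>w h\<close>, requires.\<close>
    let ?W = "X \<times> ?I \<times> (UNIV :: 'e set)"
    let ?g = "\<lambda>z. frechet_derivative f (at (?c (fst z) (fst (snd z)))) (h, 0, snd (snd z))"
    have oW: "open ?W" by (intro open_Times X open_greaterThanLessThan open_UNIV)
    have cW: "(\<lambda>z. ?c (fst z) (fst (snd z))) ` ?W \<subseteq> W" using f_in by auto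
    have fst_snd: "Ck_on k ?W fst" "Ck_on k ?W (\<lambda>z. fst (snd z))" "Ck_on k ?W (\<lambda>z. snd (snd z))"
      by (intro Ck_on_bounded_linear oW bounded_linear_fst bounded_linear_fst_comp bounded_linear_snd_comp bounded_linear_snd)+
    have "Ck_on k ?W (\<lambda>z. (\<lambda>(p, t). y p t) (fst z, fst (snd z)))"
      by (rule Ck_on_compose[OF oW open_XI yk]) (auto intro!: Ck_on_Pair oW fst_snd)
    then have cC: "Ck_on k ?W (\<lambda>z. ?c (fst z) (fst (snd z)))"
      by (intro Ck_on_Pair oW fst_snd) simp
    have gk: "Ck_on k ?W ?g"
      by (rule Ck_on_frechet_comp[OF oW Suc.prems(1,2) cC cW])
        (intro Ck_on_Pair oW fst_snd Ck_on_const)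
    have lin: "linear (frechet_derivative f (at (?c p t)))" if "p \<in> X" "t \<in> ?I" for p t
      using has_derivative_linear[OF Ck_on_SucD(1)[OF Suc.prems(2) f_in[OF that]]] .
    show ?thesis
    proof (rule Suc.IH[where y = "w h" and f = ?g and W = ?W and ?y0.0 = "\<lambda>p. frechet_derivative y0 (at p) h",
          OF oW gk D(2)])
      fix p t assume p: "p \<in> X" and t: "t \<in> ?I"
      show "(p, t, w h p t) \<in> ?W" using p t by simp
      show "(w h p has_vector_derivative ?g (p, t, w h p t)) (at t)" using D(4)[OF p t] by simp
      fix v :: 'e assume "0 < k"
      then obtain j where "k = Suc j" using gr0_implies_Suc by blast
      then have g: "(?g has_derivative frechet_derivative ?g (at (p, t, w h p t))) (at (p, t, w h p t))"
        using gk p t by (intro Ck_on_SucD(1)[of j]) auto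
      \<comment> \<open>\<open>?g\<close> is affine in its last argument, with linear part taken
        from \<open>Df\<close>, so its partial derivative there is the one already bounded by
        \<open>L\<close>. The constant, and with it the time interval, stays the same at every
        order.\<close>
      have "((\<lambda>s::real. (p, t, w h p t + s *\<^sub>R v)) has_derivative (\<lambda>s. (0, 0, s *\<^sub>R v))) (at 0)"
        by (auto intro!: derivative_eq_intros)
      from has_derivative_compose[OF this, of ?g] g
      have 1: "((\<lambda>s::real. frechet_derivative f (at (?c p t)) (h, 0, w h p t + s *\<^sub>R v)) has_derivative
          (\<lambda>s. frechet_derivative ?g (at (p, t, w h p t)) (0, 0, s *\<^sub>R v))) (at 0)"
        by simp
      have "frechet_derivative f (at (?c p t)) (h, 0, w h p t + s *\<^sub>R v) =
          frechet_derivative f (at (?c p t)) (h, 0, w h p t) + s *\<^sub>R frechet_derivative f (at (?c p t)) (0, 0, v)" for s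
        using linear_add[OF lin[OF p t], of "(h, 0, w h p t)" "s *\<^sub>R (0, 0, v)"]
          linear_cmul[OF lin[OF p t], of s "(0, 0, v)"] by simp
      then have 2: "((\<lambda>s::real. frechet_derivative f (at (?c p t)) (h, 0, w h p t + s *\<^sub>R v)) has_derivative
          (\<lambda>s. s *\<^sub>R frechet_derivative f (at (?c p t)) (0, 0, v))) (at 0)"
        by (auto intro!: derivative_eq_intros)
      have "frechet_derivative ?g (at (p, t, w h p t)) (0, 0, v) = frechet_derivative f (at (?c p t)) (0, 0, v)"
        using fun_cong[OF has_derivative_unique[OF 1 2], of 1] by simp
      then show "norm (frechet_derivative ?g (at (p, t, w h p t)) (0, 0, v)) \<le> L * norm v"
        using bound[OF p t, of v] by simp
    next
      show "w h p 0 = frechet_derivative y0 (at p) h" if "p \<in> X" for p using D(3)[OF that] .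
      show "Ck_on k X (\<lambda>p. frechet_derivative y0 (at p) h)" using Ck_on_SucD(2)[OF Suc.prems(7)] .
    qed
  qed
  have "Ck_on k (X \<times> ?I) (\<lambda>z. f (?c (fst z) (snd z)))"
  proof (rule Ck_on_compose[OF open_XI Suc.prems(1) Ck_on_Suc_imp[OF Suc.prems(2)]])
    show "Ck_on k (X \<times> ?I) (\<lambda>z. ?c (fst z) (snd z))"
      using yk by (intro Ck_on_Pair[OF open_XI Ck_on_bounded_linear[OF bounded_linear_fst open_XI]]
            Ck_on_Pair[OF open_XI Ck_on_bounded_linear[OF bounded_linear_snd open_XI]])
        (simp add: split_def)
  qed (use f_in in auto)
  note fk = this
  show ?case
  proof (rule Ck_on_SucI[OF open_XI,
      where f' = "\<lambda>z d. w (fst d) (fst z) (snd z) + snd d *\<^sub>R f (?c (fst z) (snd z))"])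
    show "Ck_on k (X \<times> ?I) (\<lambda>z. w (fst d) (fst z) (snd z) + snd d *\<^sub>R f (?c (fst z) (snd z)))" for d
      using wk[of "fst d"] by (intro Ck_on_add Ck_on_scaleR Ck_on_const open_XI fk) (simp add: split_def)
    fix z assume z: "z \<in> X \<times> ?I"
    obtain p t where pt: "z = (p, t)" "p \<in> X" "t \<in> ?I" using z by auto
    \<comment> \<open>Joint differentiability follows from partial derivatives of which one is
      continuous; the time derivative is, being \<open>f\<close> along the solution.\<close>
    have "((\<lambda>(p, t). y p t) has_derivative (\<lambda>(h, \<tau>). w h p t + blinfun_scaleR_left (f (?c p t)) \<tau>))
        (at (p, t) within X \<times> ?I)"
    proof (rule has_derivative_partialsI[where fy = "\<lambda>p t. blinfun_scaleR_left (f (?c p t))"])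
      show "((\<lambda>q. y q t) has_derivative (\<lambda>h. w h p t)) (at p within X)"
        by (rule has_derivative_at_withinI[OF D(1)[OF pt(2,3)]])
      show "(y q has_derivative blinfun_apply (blinfun_scaleR_left (f (?c q s)))) (at s within ?I)"
        if "q \<in> X" "s \<in> ?I" for q s
        using has_derivative_at_withinI[OF ode[OF that, unfolded has_vector_derivative_def]]
        by (simp add: blinfun_scaleR_left.rep_eq)
      have "continuous_on (X \<times> ?I) (\<lambda>z. blinfun_scaleR_left (f (?c (fst z) (snd z))))"
        by (intro bounded_linear.continuous_on[OF bounded_linear_blinfun_scaleR_left] Ck_on_imp_continuous_on[OF fk])
      then show "continuous (at (p, t) within X \<times> ?I) (\<lambda>(p, t). blinfun_scaleR_left (f (?c p t)))"
        using z pt by (simp add: continuous_on_eq_continuous_within split_def)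
    qed (use pt in auto)
    then show "((\<lambda>(p, t). y p t) has_derivative
        (\<lambda>d. w (fst d) (fst z) (snd z) + snd d *\<^sub>R f (?c (fst z) (snd z)))) (at z)"
      using at_within_open[OF z open_XI] by (simp add: pt split_def blinfun_scaleR_left.rep_eq)
  qed
qed

text \<open>Existence is proved for the field composed with the nearest-point projection onto a
  ball, which makes it globally Lipschitz. Up to time \<open>T\<close> the solutions do not leave
  the ball, so they solve the original equation. The derivative of the flow satisfies the linearised
  equation, which is recorded for the pulled-back metric.\<close>

lemma flow_exists:
  fixes Z :: "'e::euclidean_space \<Rightarrow> 'e"
  assumes V: "open V" "x0 \<in> V" and Z: "smooth_on V Z"
  obtains r T \<phi> where "0 < r" "0 < T"
    "smooth_on (ball x0 r \<times> {-T<..<T}) (\<lambda>(x, t). \<phi> x t)"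
    "ball x0 r \<subseteq> V"
    "\<And>x t. x \<in> ball x0 r \<Longrightarrow> t \<in> {-T<..<T} \<Longrightarrow> \<phi> x t \<in> V"
    "\<And>x. x \<in> ball x0 r \<Longrightarrow> \<phi> x 0 = x"
    "\<And>x t. x \<in> ball x0 r \<Longrightarrow> t \<in> {-T<..<T} \<Longrightarrow> (\<phi> x has_vector_derivative Z (\<phi> x t)) (at t)"
    "\<And>x h t. x \<in> ball x0 r \<Longrightarrow> t \<in> {-T<..<T} \<Longrightarrow>
      ((\<lambda>t. frechet_derivative (\<lambda>x. \<phi> x t) (at x) h) has_vector_derivative
        frechet_derivative Z (at (\<phi> x t)) (frechet_derivative (\<lambda>x. \<phi> x t) (at x) h)) (at t)"
    "\<And>x s t. x \<in> ball x0 r \<Longrightarrow> s \<in> {-T<..<T} \<Longrightarrow> t \<in> {-T<..<T} \<Longrightarrow> s + t \<in> {-T<..<T} \<Longrightarrow>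
      \<phi> x s \<in> ball x0 r \<Longrightarrow> \<phi> (\<phi> x s) t = \<phi> x (s + t)"
proof -
  obtain R where R: "R > 0" "cball x0 R \<subseteq> V" using V open_contains_cball by blast
  define K where "K = cball x0 R"
  have K: "compact K" "convex K" "closed K" "K \<noteq> {}" "K \<subseteq> V" using R by (auto simp: K_def)
  let ?D = "\<lambda>x. frechet_derivative Z (at x)"
  note Zd = smooth_on_has_derivative[OF Z]
  obtain L where L: "0 \<le> L" "\<And>x v. x \<in> K \<Longrightarrow> norm (?D x v) \<le> L * norm v"
  proof (rule compact_linear_family_bound[OF K(1), of ?D])
    show "linear (?D x)" if "x \<in> K" for x using has_derivative_linear[OF Zd] that K by blast
    show "continuous_on K (\<lambda>x. ?D x v)" for v
      using smooth_on_imp_continuous_on[OF smooth_on_frechet[OF Z]] K(5) continuous_on_subset by blast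
  qed blast
  have lip: "norm (Z x - Z y) \<le> L * norm (x - y)" if "x \<in> K" "y \<in> K" for x y
    by (rule differentiable_bound[OF K(2) has_derivative_at_withinI[OF Zd] _ that])
      (use K L in \<open>auto intro!: onorm_le\<close>)
  have contZ: "continuous_on K Z" using smooth_on_imp_continuous_on[OF Z] K(5) continuous_on_subset by blast
  then have "bounded (Z ` K)" using compact_continuous_image[OF _ K(1)] compact_imp_bounded by blast
  then obtain M where M: "M > 0" "\<And>x. x \<in> K \<Longrightarrow> norm (Z x) \<le> M" by (auto simp: bounded_pos)
  \<comment> \<open>With speed at most \<open>M\<close>, the first bound keeps solutions starting in
    the half ball inside \<open>K\<close>; the second gives \<open>L * T \<le> 1/4\<close>.\<close>
  define T where "T = min (R / (2 * M)) (1 / (4 * (L + 1)))"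
  have T: "0 < T" using R M L(1) by (simp add: T_def)
  have TM: "T * M \<le> R / 2"
  proof -
    have "T * M \<le> R / (2 * M) * M" using M(1) by (intro mult_right_mono) (auto simp: T_def)
    then show ?thesis using M(1) by simp
  qed
  have LT: "L * T \<le> 1/4"
  proof -
    have "(L + 1) * T \<le> (L + 1) * (1 / (4 * (L + 1)))" using L(1) by (intro mult_left_mono) (auto simp: T_def)
    also have "\<dots> = 1/4" using L(1) by (simp add: field_simps)
    finally show ?thesis using T by (simp add: algebra_simps)
  qed
  let ?P = "closest_point K"
  have P: "?P x \<in> K" "x \<in> K \<Longrightarrow> ?P x = x" for x
    using closest_point_in_set[OF K(3,4)] closest_point_self by auto
  define X where "X = cball x0 (R / 2)"
  have X: "compact X" "convex X" "X \<noteq> {}" "X \<subseteq> K" using R by (auto simp: X_def K_def)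
  let ?f = "\<lambda>z :: 'e \<times> real \<times> 'e. Z (?P (snd (snd z)))"
  obtain y where y_cont: "continuous_on (X \<times> {-T..T}) (\<lambda>(p, t). y p t)"
    and y0: "\<And>p. p \<in> X \<Longrightarrow> y p 0 = p"
    and y: "\<And>p t. p \<in> X \<Longrightarrow> t \<in> {-T..T} \<Longrightarrow> (y p has_vector_derivative Z (?P (y p t))) (at t within {-T..T})"
  proof (rule ode_fixpoint[OF X(1-3) T, of ?f L "\<lambda>p. p"])
    show "continuous_on (X \<times> {-T..T} \<times> UNIV) ?f"
      using P(1) by (intro continuous_on_compose2[OF contZ] continuous_on_compose2[OF continuous_on_closest_point[OF K(2,3,4)]]
          continuous_on_snd continuous_on_id) auto
    show "norm (?f (p, t, y) - ?f (p, t, z)) \<le> L * norm (y - z)" for p t y z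
    proof -
      have "norm (?P y - ?P z) \<le> norm (y - z)"
        using closest_point_lipschitz[OF K(2,3,4), of y z] by (simp add: dist_norm)
      then show ?thesis
        using lip[OF P(1) P(1), of y z] mult_left_mono[of "norm (?P y - ?P z)" "norm (y - z)" L] L(1) by simp
    qed
    show "L * T \<le> 1/2" using LT by simp
  qed (use L(1) in \<open>auto intro: continuous_on_id\<close>)
  have yK: "y p t \<in> K" if "p \<in> X" "t \<in> {-T..T}" for p t
  proof -
    have "norm (y p t - y p 0) \<le> T * M"
      by (rule ode_mean_value[OF convex_real_interval(5) _ order_refl that(2) y[OF that(1)]])
        (use T M(2) P(1) in auto)
    then have "dist x0 (y p t) \<le> R / 2 + R / 2"
      using TM y0[OF that(1)] that(1) dist_triangle[of x0 "y p t" p]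
      by (simp add: X_def dist_norm norm_minus_commute)
    then show ?thesis by (simp add: K_def)
  qed
  define r where "r = R / 2"
  have BX: "ball x0 r \<subseteq> X" by (auto simp: X_def r_def)
  have yZ: "(y p has_vector_derivative Z (y p t)) (at t)" if "p \<in> ball x0 r" "t \<in> {-T<..<T}" for p t
    using y[OF subsetD[OF BX that(1)], of t] P(2)[OF yK[OF subsetD[OF BX that(1)], of t]] that(2)
      at_within_Icc_at[of "-T" t T] by auto
  have y_in: "y p t \<in> V" if "p \<in> ball x0 r" "t \<in> {-T<..<T}" for p t
    using yK[OF subsetD[OF BX that(1)], of t] that(2) K(5) by auto
  \<comment> \<open>For the regularity the projection is dropped again, since it is not
    differentiable; this is legitimate because the solutions stay in \<open>K\<close>.\<close>
  let ?W = "UNIV \<times> UNIV \<times> V :: ('e \<times> real \<times> 'e) set" and ?F = "\<lambda>z :: 'e \<times> real \<times> 'e. Z (snd (snd z))"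
  have oW: "open ?W" by (intro open_Times V open_UNIV)
  have Fk: "smooth_on ?W ?F"
    by (rule smooth_on_compose[OF oW V(1) Z])
      (auto intro: smooth_on_bounded_linear[OF _ oW] bounded_linear_snd_comp bounded_linear_snd)
  have DF: "frechet_derivative ?F (at z) = (\<lambda>d. ?D (snd (snd z)) (snd (snd d)))" if "z \<in> ?W" for z
  proof (rule frechet_derivative_at[symmetric])
    have "((\<lambda>z :: 'e \<times> real \<times> 'e. snd (snd z)) has_derivative (\<lambda>d. snd (snd d))) (at z)"
      by (auto intro!: derivative_eq_intros)
    from has_derivative_compose[OF this Zd] that
    show "(?F has_derivative (\<lambda>d. ?D (snd (snd z)) (snd (snd d)))) (at z)" by auto
  qed
  have y_cont': "continuous_on (ball x0 r \<times> {-T<..<T}) (\<lambda>(p, t). y p t)"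
    by (rule continuous_on_subset[OF y_cont]) (use BX in auto)
  have bound: "norm (frechet_derivative ?F (at (p, t, y p t)) (0, 0, v)) \<le> L * norm v"
    if "p \<in> ball x0 r" "t \<in> {-T<..<T}" for p t v
    using DF[of "(p, t, y p t)"] y_in[OF that] L(2)[OF yK[OF subsetD[OF BX that(1)], of t], of v] that(2) by auto
  have init: "y p 0 = p" if "p \<in> ball x0 r" for p using y0[OF subsetD[OF BX that]] .
  have in_W: "(p, t, y p t) \<in> ?W" if "p \<in> ball x0 r" "t \<in> {-T<..<T}" for p t
    using y_in[OF that] by simp
  have yZ': "(y p has_vector_derivative ?F (p, t, y p t)) (at t)" if "p \<in> ball x0 r" "t \<in> {-T<..<T}" for p t
    using yZ[OF that] by simp
  have idk: "Ck_on k (ball x0 r) (\<lambda>p. p)" for k by (rule Ck_on_id) simp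
  have smooth: "smooth_on (ball x0 r \<times> {-T<..<T}) (\<lambda>(p, t). y p t)"
    unfolding smooth_on_def
    by (intro allI, rule ode_Ck[OF open_ball T L(1) LT oW smooth_onD[OF Fk] y_cont' in_W yZ' init idk bound])
  note D = ode_differentiable(4)[OF oW smooth_onD[OF Fk] open_ball T y_cont' in_W yZ' init idk bound L(1) LT]
  show ?thesis
  proof (rule that[of r T y])
    show "0 < r" using R by (simp add: r_def)
    show "ball x0 r \<subseteq> V" using BX X K by blast
    show "((\<lambda>t. frechet_derivative (\<lambda>x. y x t) (at x) h) has_vector_derivative
        ?D (y x t) (frechet_derivative (\<lambda>x. y x t) (at x) h)) (at t)"
      if "x \<in> ball x0 r" "t \<in> {-T<..<T}" for x h t
    proof -
      have "((\<lambda>t. frechet_derivative (\<lambda>x. y x t) (at x) h) has_vector_derivative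
        frechet_derivative ?F (at (x, t, y x t)) (h, 0, frechet_derivative (\<lambda>x. y x t) (at x) h)) (at t)"
        by (rule D, assumption+) (rule that)+
      then show ?thesis using DF[OF in_W[OF that]] by simp
    qed
    fix x s t
    assume x: "x \<in> ball x0 r" "y x s \<in> ball x0 r"
      and st: "s \<in> {-T<..<T}" "t \<in> {-T<..<T}" "s + t \<in> {-T<..<T}"
    \<comment> \<open>The interval between \<open>0\<close> and \<open>t\<close>, for either sign of
      \<open>t\<close>. On it \<open>s + \<tau>\<close> runs between \<open>s\<close> and
      \<open>s + t\<close>, so both curves below are defined.\<close>
    define a b where "a = min 0 t" and "b = max 0 t"
    have ab: "0 \<in> {a..b}" "t \<in> {a..b}" by (auto simp: a_def b_def)
    have \<tau>: "\<tau> \<in> {-T<..<T} \<and> s + \<tau> \<in> {-T<..<T}" if "\<tau> \<in> {a..b}" for \<tau>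
      using that st by (auto simp: a_def b_def min_def max_def split: if_splits)
    \<comment> \<open>Both curves solve the equation and agree at time \<open>0\<close>;
      \<open>ode_absorb\<close> acts as the uniqueness theorem.\<close>
    let ?r = "\<lambda>\<tau>. y (y x s) \<tau> - y x (s + \<tau>)"
    have "norm (?r t) \<le> 2 * (norm (?r 0) + T * 0)"
    proof (rule ode_absorb[OF ab(1) _ ab(2), where r' = "\<lambda>\<tau>. Z (y (y x s) \<tau>) - Z (y x (s + \<tau>))"])
      show "{a..b} \<subseteq> {-T..T}" using \<tau> by force
      fix \<tau> assume "\<tau> \<in> {a..b}"
      note \<tau> = \<tau>[OF this]
      have "((\<lambda>\<tau>. s + \<tau>) has_vector_derivative 1) (at \<tau>)" by (auto intro!: derivative_eq_intros)
      from vector_diff_chain_at[OF this yZ[OF x(1)]] \<tau>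
      have "((\<lambda>\<tau>. y x (s + \<tau>)) has_vector_derivative Z (y x (s + \<tau>))) (at \<tau>)"
        by (simp add: o_def)
      then show "(?r has_vector_derivative Z (y (y x s) \<tau>) - Z (y x (s + \<tau>))) (at \<tau> within {a..b})"
        using yZ[OF x(2) conjunct1[OF \<tau>]]
        by (rule has_vector_derivative_at_within[OF has_vector_derivative_diff, rotated])
      show "norm (Z (y (y x s) \<tau>) - Z (y x (s + \<tau>))) \<le> 0 + L * norm (?r \<tau>)"
        using lip[OF yK[OF subsetD[OF BX x(2)], of \<tau>] yK[OF subsetD[OF BX x(1)], of "s + \<tau>"]] \<tau>
        by simp
    qed (use L LT in auto)
    then show "y (y x s) t = y x (s + t)" using init[OF x(2)] by simp
  qed (use T smooth y_in init yZ in auto)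
qed

section \<open>Smooth families of inner products\<close>

definition inner_form :: "('e::euclidean_space \<Rightarrow> 'e \<Rightarrow> real) \<Rightarrow> bool" where
  "inner_form B \<longleftrightarrow> bilinear B \<and> (\<forall>u v. B u v = B v u) \<and> (\<forall>u. u \<noteq> 0 \<longrightarrow> B u u > 0)"

lemma inner_form_linear:
  assumes "inner_form B"
  shows "linear (B u)" "linear (\<lambda>v. B v u)"
  using assms by (auto simp: inner_form_def bilinear_def)

lemma inner_form_sym: "inner_form B \<Longrightarrow> B u v = B v u"
  by (simp add: inner_form_def)

lemma inner_form_nondegenerate:
  assumes B: "inner_form B" and "\<And>w. B u w = B v w"
  shows "u = v"
proof (rule ccontr)
  assume "u \<noteq> v"
  then have "B (u - v) (u - v) > 0" using B by (simp add: inner_form_def)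
  moreover have "B (u - v) (u - v) = B u (u - v) - B v (u - v)"
    by (rule linear_diff[OF inner_form_linear(2)[OF B]])
  ultimately show False using assms(2) by simp
qed

lemma smooth_on_bilinear_family:
  assumes U: "open U" and G: "\<And>x. x \<in> U \<Longrightarrow> bilinear (G x)" "\<And>u v. smooth_on U (\<lambda>x. G x u v)"
    and ab: "smooth_on U a" "smooth_on U b"
  shows "smooth_on U (\<lambda>x. G x (a x) (b x))"
proof (rule smooth_on_linear_family[where B = "\<lambda>x. G x (a x)", OF U _ _ ab(2)])
  show "linear (G x (a x))" if "x \<in> U" for x using G(1)[OF that] by (auto simp: bilinear_def)
  show "smooth_on U (\<lambda>x. G x (a x) v)" for v
    by (rule smooth_on_linear_family[where B = "\<lambda>x u. G x u v", OF U _ G(2) ab(1)])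
      (use G(1) in \<open>auto simp: bilinear_def\<close>)
qed

text \<open>The representing vector is built by Gram--Schmidt over the standard basis, so that it
  visibly depends smoothly on the form.\<close>

lemma smooth_riesz:
  fixes G :: "'a::euclidean_space \<Rightarrow> 'e::euclidean_space \<Rightarrow> 'e \<Rightarrow> real"
  assumes U: "open U" and G: "\<And>x. x \<in> U \<Longrightarrow> inner_form (G x)" "\<And>u v. smooth_on U (\<lambda>x. G x u v)"
    and l: "\<And>x. x \<in> U \<Longrightarrow> linear (l x)" "\<And>v. smooth_on U (\<lambda>x. l x v)"
  obtains z where "smooth_on U z" "\<And>x w. x \<in> U \<Longrightarrow> G x (z x) w = l x w"
proof -
  have G_bil: "bilinear (G x)" if "x \<in> U" for x using G(1)[OF that] by (simp add: inner_form_def)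
  note lin1 = inner_form_linear(1)[OF G(1)] and lin2 = inner_form_linear(2)[OF G(1)]
  \<comment> \<open>Stated for every functional \<open>l\<close>, because the step uses the
    hypothesis twice: once for \<open>l\<close> and once for \<open>G x b\<close>.\<close>
  have *: "\<exists>z. smooth_on U z \<and> (\<forall>x\<in>U. z x \<in> span B \<and> (\<forall>w\<in>B. G x (z x) w = l x w))"
    if "finite B" "B \<subseteq> Basis" "\<And>x. x \<in> U \<Longrightarrow> linear (l x)" "\<And>v. smooth_on U (\<lambda>x. l x v)"
    for B and l :: "'a \<Rightarrow> 'e \<Rightarrow> real"
    using that
  proof (induction B arbitrary: l rule: finite_induct)
    case empty
    then show ?case by (intro exI[of _ "\<lambda>x. 0"]) (simp add: smooth_on_const)
  next
    case (insert b B)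
    have sub: "B \<subseteq> Basis" using insert.prems by simp
    obtain z where z: "smooth_on U z" "\<And>x. x \<in> U \<Longrightarrow> z x \<in> span B" "\<And>x w. x \<in> U \<Longrightarrow> w \<in> B \<Longrightarrow> G x (z x) w = l x w"
      using insert.IH[OF sub insert.prems(2,3)] by blast
    obtain y where y: "smooth_on U y" "\<And>x. x \<in> U \<Longrightarrow> y x \<in> span B" "\<And>x w. x \<in> U \<Longrightarrow> w \<in> B \<Longrightarrow> G x (y x) w = G x b w"
      using insert.IH[OF sub lin1 G(2)] by blast
    \<comment> \<open>\<open>y x\<close> is the orthogonal projection of \<open>b\<close> to the
      span of \<open>B\<close>, so \<open>e x\<close> is the next Gram-Schmidt vector; it never
      vanishes because \<open>b\<close> is independent of \<open>B\<close>.\<close>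
    define e where "e x = b - y x" for x
    have e_smooth: "smooth_on U e"
      unfolding e_def by (intro smooth_on_diff U smooth_on_const y(1))
    have "independent (insert b B)" using independent_Basis independent_mono insert.prems(1) by blast
    then have b: "b \<notin> span B" using insert.hyps(2) by (simp add: independent_insert)
    have e_B: "G x (e x) w = 0" if "x \<in> U" "w \<in> B" for x w
      using y(3)[OF that] linear_diff[OF lin2[OF that(1)], of b "y x" w] by (simp add: e_def)
    have e_span: "G x (e x) w = 0" if "x \<in> U" "w \<in> span B" for x w
      using linear_eq_0_on_span[OF lin1[OF that(1)] e_B[OF that(1)] that(2)] .
    have e_pos: "G x (e x) (e x) > 0" if "x \<in> U" for x
    proof -
      have "e x \<noteq> 0" using y(2)[OF that] b by (auto simp: e_def)
      then show ?thesis using G(1)[OF that] by (simp add: inner_form_def)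
    qed
    have e_b: "G x (e x) b = G x (e x) (e x)" if "x \<in> U" for x
      using linear_diff[OF lin1[OF that], of "e x" b "y x"] e_span[OF that y(2)[OF that]] by (simp add: e_def)
    \<comment> \<open>Adding a multiple of \<open>e x\<close> leaves the equations on
      \<open>B\<close> alone; this multiple solves the equation for \<open>b\<close>.\<close>
    define c where "c x = (l x b - G x (z x) b) / G x (e x) (e x)" for x
    have c_smooth: "smooth_on U c"
      unfolding c_def
      by (intro smooth_on_divide smooth_on_diff U insert.prems smooth_on_bilinear_family[OF U G_bil G(2)]
          smooth_on_const z(1) e_smooth less_imp_neq[OF e_pos, symmetric])
    show ?case
    proof (intro exI[of _ "\<lambda>x. z x + c x *\<^sub>R e x"] conjI ballI)
      show "smooth_on U (\<lambda>x. z x + c x *\<^sub>R e x)"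
        by (intro smooth_on_add smooth_on_scaleR U z c_smooth e_smooth)
      fix x assume x: "x \<in> U"
      show "z x + c x *\<^sub>R e x \<in> span (insert b B)"
        unfolding e_def using z(2)[OF x] y(2)[OF x] span_mono[OF subset_insertI[of B b]]
        by (intro span_add span_scale span_diff) (auto intro: span_base)
      fix w assume w: "w \<in> insert b B"
      have "G x (z x + c x *\<^sub>R e x) w = G x (z x) w + c x * G x (e x) w"
        using linear_add[OF lin2[OF x]] linear_cmul[OF lin2[OF x]] by simp
      also have "\<dots> = l x w"
      proof (cases "w = b")
        case True
        then show ?thesis using e_b[OF x] e_pos[OF x] by (simp add: c_def)
      next
        case False
        then show ?thesis using w z(3)[OF x] e_B[OF x] by simp
      qed
      finally show "G x (z x + c x *\<^sub>R e x) w = l x w" .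
    qed
  qed
  obtain z where z: "smooth_on U z" "\<And>x w. x \<in> U \<Longrightarrow> w \<in> Basis \<Longrightarrow> G x (z x) w = l x w"
    using *[OF finite_Basis order_refl l] by blast
  show ?thesis
  proof (rule that[OF z(1)])
    fix x w assume x: "x \<in> U"
    show "G x (z x) w = l x w"
      using linear_sum_Basis[OF lin1[OF x], of "z x" w] linear_sum_Basis[OF l(1)[OF x], of w] z(2)[OF x] by simp
  qed
qed

text \<open>A single form is a constant family over the line.\<close>

lemma inner_form_riesz:
  fixes B :: "'e::euclidean_space \<Rightarrow> 'e \<Rightarrow> real"
  assumes "inner_form B" "linear l"
  obtains z where "\<And>w. B z w = l w"
proof (rule smooth_riesz[of "UNIV :: real set" "\<lambda>_. B" "\<lambda>_. l"])
  fix z :: "real \<Rightarrow> 'e" assume "\<And>x w. x \<in> UNIV \<Longrightarrow> B (z x) w = l w"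
  then show thesis using that[of "z 0"] by simp
qed (use assms in \<open>simp_all add: smooth_on_const\<close>)

lemma linear_frechet_family:
  fixes B :: "'a::euclidean_space \<Rightarrow> 'e::euclidean_space \<Rightarrow> 'f::euclidean_space"
  assumes U: "open U" "x \<in> U" and B: "\<And>y. y \<in> U \<Longrightarrow> linear (B y)" "\<And>v. (\<lambda>y. B y v) differentiable at x"
  shows "linear (\<lambda>v. frechet_derivative (\<lambda>y. B y v) (at x) h)"
proof (rule linearI)
  note d = B(2)[unfolded frechet_derivative_works]
  fix u v :: 'e and c :: real
  have "((\<lambda>y. B y (u + v)) has_derivative (\<lambda>h. frechet_derivative (\<lambda>y. B y u) (at x) h + frechet_derivative (\<lambda>y. B y v) (at x) h)) (at x)"
    by (rule has_derivative_transform_within_open[OF has_derivative_add[OF d d] U]) (simp add: linear_add[OF B(1)])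
  from fun_cong[OF frechet_derivative_at[OF this], of h]
  show "frechet_derivative (\<lambda>y. B y (u + v)) (at x) h = frechet_derivative (\<lambda>y. B y u) (at x) h + frechet_derivative (\<lambda>y. B y v) (at x) h"
    by simp
  have "((\<lambda>y. B y (c *\<^sub>R u)) has_derivative (\<lambda>h. c *\<^sub>R frechet_derivative (\<lambda>y. B y u) (at x) h)) (at x)"
    by (rule has_derivative_transform_within_open[OF has_derivative_scaleR_right[OF d] U]) (simp add: linear_cmul[OF B(1)])
  from fun_cong[OF frechet_derivative_at[OF this], of h]
  show "frechet_derivative (\<lambda>y. B y (c *\<^sub>R u)) (at x) h = c *\<^sub>R frechet_derivative (\<lambda>y. B y u) (at x) h"
    by simp
qed

text \<open>Differentiability is assumed only for fixed vectors; the basis expansion turns it into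
  joint differentiability in the point and the vector.\<close>

lemma linear_family_has_derivative:
  fixes B :: "'a::euclidean_space \<Rightarrow> 'e::euclidean_space \<Rightarrow> 'f::euclidean_space"
  assumes U: "open U" "x \<in> U" and B: "\<And>y. y \<in> U \<Longrightarrow> linear (B y)" "\<And>v. (\<lambda>y. B y v) differentiable at x"
  shows "((\<lambda>z. B (fst z) (snd z)) has_derivative
    (\<lambda>d. frechet_derivative (\<lambda>y. B y v) (at x) (fst d) + B x (snd d))) (at (x, v))"
proof -
  let ?D = "\<lambda>v. frechet_derivative (\<lambda>y. B y v) (at x)"
  note d = B(2)[unfolded frechet_derivative_works]
  have fst: "((\<lambda>z. B (fst z) b) has_derivative (\<lambda>h. ?D b (fst h))) (at (x, v))" for b
    by (rule has_derivative_compose[where f = fst]) (use d in \<open>auto intro!: derivative_eq_intros\<close>)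
  have snd: "((\<lambda>z. snd z \<bullet> b) has_derivative (\<lambda>h. snd h \<bullet> b)) (at (x, v))" for b :: 'e
    by (auto intro!: derivative_eq_intros)
  have 1: "((\<lambda>z. \<Sum>b\<in>Basis. (snd z \<bullet> b) *\<^sub>R B (fst z) b) has_derivative
    (\<lambda>h. \<Sum>b\<in>Basis. (snd (x, v) \<bullet> b) *\<^sub>R ?D b (fst h) + (snd h \<bullet> b) *\<^sub>R B (fst (x, v)) b)) (at (x, v))"
    by (intro has_derivative_sum has_derivative_scaleR fst snd)
  have 2: "(\<Sum>b\<in>Basis. (snd (x, v) \<bullet> b) *\<^sub>R ?D b (fst h) + (snd h \<bullet> b) *\<^sub>R B (fst (x, v)) b)
      = ?D v (fst h) + B x (snd h)" for h
    using linear_sum_Basis[OF linear_frechet_family[OF U B], where v = v and h1 = "fst h"]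
      linear_sum_Basis[OF B(1)[OF U(2)], of "snd h"] by (simp add: sum.distrib)
  show ?thesis
    unfolding 2[symmetric]
    by (rule has_derivative_transform_within_open[OF 1, of "U \<times> UNIV"])
      (use U in \<open>auto simp: open_Times linear_sum_Basis[OF B(1), symmetric]\<close>)
qed

text \<open>Two applications of the linear case: first with the second slot frozen, then with point
  and first slot together as the parameter.\<close>

lemma bilinear_family_has_derivative:
  fixes G :: "'a::euclidean_space \<Rightarrow> 'e::euclidean_space \<Rightarrow> 'e \<Rightarrow> 'f::euclidean_space"
  assumes U: "open U" "x s \<in> U" and G: "\<And>y. y \<in> U \<Longrightarrow> bilinear (G y)" "\<And>u v. (\<lambda>y. G y u v) differentiable at (x s)"
    and x: "(x has_derivative x') (at s)" and a: "(a has_derivative a') (at s)" and b: "(b has_derivative b') (at s)"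
  shows "((\<lambda>s. G (x s) (a s) (b s)) has_derivative
    (\<lambda>h. frechet_derivative (\<lambda>y. G y (a s) (b s)) (at (x s)) (x' h) + G (x s) (a' h) (b s) + G (x s) (a s) (b' h))) (at s)"
proof -
  have 1: "((\<lambda>z. G (fst z) (snd z) v) has_derivative
    (\<lambda>d. frechet_derivative (\<lambda>y. G y u v) (at (x s)) (fst d) + G (x s) (snd d) v)) (at (x s, u))" for u v
    by (rule linear_family_has_derivative[OF U, where B = "\<lambda>y u. G y u v"]) (use G in \<open>auto simp: bilinear_def\<close>)
  have 2: "((\<lambda>z. G (fst (fst z)) (snd (fst z)) (snd z)) has_derivative
    (\<lambda>d. frechet_derivative (\<lambda>z. G (fst z) (snd z) (b s)) (at (x s, a s)) (fst d) + G (fst (x s, a s)) (snd (x s, a s)) (snd d)))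
      (at ((x s, a s), b s))"
    by (rule linear_family_has_derivative[where B = "\<lambda>z. G (fst z) (snd z)" and U = "U \<times> UNIV"])
      (use U G differentiableI[OF 1] in \<open>auto simp: bilinear_def open_Times\<close>)
  have 3: "((\<lambda>s. ((x s, a s), b s)) has_derivative (\<lambda>h. ((x' h, a' h), b' h))) (at s)"
    by (intro has_derivative_Pair x a b)
  show ?thesis
    using has_derivative_compose[OF 3 2] by (simp add: frechet_derivative_at[OF 1, symmetric])
qed


section \<open>Symmetry of the second derivative\<close>

text \<open>The mean value theorem twice: along \<open>v\<close> for the increment of
  \<open>u\<close> in the direction \<open>w\<close>, then along \<open>w\<close> for the derivative
  so obtained.\<close>

lemma second_difference:
  fixes u :: "'e::euclidean_space \<Rightarrow> real"
  assumes u: "smooth_on (ball x r) u" and h: "0 < h" "h * (norm v + norm w) < r"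
  obtains p where "dist x p \<le> h * (norm v + norm w)"
    "u (x + h *\<^sub>R v + h *\<^sub>R w) - u (x + h *\<^sub>R v) - u (x + h *\<^sub>R w) + u x
      = h\<^sup>2 * frechet_derivative (\<lambda>y. frechet_derivative u (at y) v) (at p) w"
proof -
  let ?D = "\<lambda>f y v. frechet_derivative f (at y) v"
  have le: "dist x (x + s *\<^sub>R v + t *\<^sub>R w) \<le> h * (norm v + norm w)" if "s \<in> {0..h}" "t \<in> {0..h}" for s t
  proof -
    have "norm (s *\<^sub>R v + t *\<^sub>R w) \<le> \<bar>s\<bar> * norm v + \<bar>t\<bar> * norm w"
      using norm_triangle_ineq[of "s *\<^sub>R v" "t *\<^sub>R w"] by simp
    also have "\<dots> \<le> h * norm v + h * norm w" using that by (intro add_mono mult_right_mono) auto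
    finally show ?thesis by (simp add: dist_norm algebra_simps norm_minus_commute)
  qed
  then have ball: "x + s *\<^sub>R v + t *\<^sub>R w \<in> ball x r" if "s \<in> {0..h}" "t \<in> {0..h}" for s t
    using le[OF that] h(2) by auto
  have D: "((\<lambda>s. f (a + s *\<^sub>R c)) has_real_derivative ?D f (a + s *\<^sub>R c) c) (at s)"
    if "smooth_on (ball x r) f" "a + s *\<^sub>R c \<in> ball x r" for f :: "'e \<Rightarrow> real" and a c s
  proof -
    have 1: "((\<lambda>s. a + s *\<^sub>R c) has_derivative (\<lambda>s. s *\<^sub>R c)) (at s)"
      by (auto intro!: derivative_eq_intros)
    have "((\<lambda>s. f (a + s *\<^sub>R c)) has_derivative (\<lambda>t. ?D f (a + s *\<^sub>R c) (t *\<^sub>R c))) (at s)"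
      by (rule has_derivative_compose[OF 1 smooth_on_has_derivative[OF that]])
    then show ?thesis
      unfolding has_field_derivative_def
      by (rule has_derivative_eq_rhs) (simp add: fun_eq_iff linear_cmul[OF smooth_on_linear_frechet[OF that]])
  qed
  obtain \<xi> where \<xi>: "0 < \<xi>" "\<xi> < h" "(u (x + h *\<^sub>R v + h *\<^sub>R w) - u (x + h *\<^sub>R v)) - (u (x + 0 *\<^sub>R v + h *\<^sub>R w) - u (x + 0 *\<^sub>R v))
      = (h - 0) * (?D u (x + h *\<^sub>R w + \<xi> *\<^sub>R v) v - ?D u (x + \<xi> *\<^sub>R v) v)"
  proof -
    have "\<exists>z>0. z < h \<and> (u (x + h *\<^sub>R w + h *\<^sub>R v) - u (x + h *\<^sub>R v)) - (u (x + h *\<^sub>R w + 0 *\<^sub>R v) - u (x + 0 *\<^sub>R v))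
      = (h - 0) * (?D u (x + h *\<^sub>R w + z *\<^sub>R v) v - ?D u (x + z *\<^sub>R v) v)"
    proof (rule MVT2[OF h(1)])
      fix s :: real assume "0 \<le> s" "s \<le> h"
      then have "x + h *\<^sub>R w + s *\<^sub>R v \<in> ball x r" "x + s *\<^sub>R v \<in> ball x r"
        using ball[of s h] ball[of s 0] h(1) by (simp_all add: algebra_simps)
      then show "((\<lambda>s. u (x + h *\<^sub>R w + s *\<^sub>R v) - u (x + s *\<^sub>R v)) has_real_derivative
          (?D u (x + h *\<^sub>R w + s *\<^sub>R v) v - ?D u (x + s *\<^sub>R v) v)) (at s)"
        by (intro DERIV_diff D[OF u])
    qed
    with that show ?thesis by (auto simp: algebra_simps)
  qed
  have "\<exists>z>0. z < h \<and> ?D u (x + \<xi> *\<^sub>R v + h *\<^sub>R w) v - ?D u (x + \<xi> *\<^sub>R v + 0 *\<^sub>R w) v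
      = (h - 0) * ?D (\<lambda>y. ?D u y v) (x + \<xi> *\<^sub>R v + z *\<^sub>R w) w"
    by (rule MVT2[OF h(1)]) (use \<xi> h ball in \<open>auto intro!: D[OF smooth_on_frechet[OF u]]\<close>)
  then obtain \<eta> where \<eta>: "0 < \<eta>" "\<eta> < h" "?D u (x + \<xi> *\<^sub>R v + h *\<^sub>R w) v - ?D u (x + \<xi> *\<^sub>R v) v
      = h * ?D (\<lambda>y. ?D u y v) (x + \<xi> *\<^sub>R v + \<eta> *\<^sub>R w) w" by auto
  have "x + h *\<^sub>R w + \<xi> *\<^sub>R v = x + \<xi> *\<^sub>R v + h *\<^sub>R w" by simp
  with \<xi>(3) \<eta>(3) have "u (x + h *\<^sub>R v + h *\<^sub>R w) - u (x + h *\<^sub>R v) - u (x + h *\<^sub>R w) + u x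
      = h * (h * ?D (\<lambda>y. ?D u y v) (x + \<xi> *\<^sub>R v + \<eta> *\<^sub>R w) w)" by simp
  then show thesis
    using that[of "x + \<xi> *\<^sub>R v + \<eta> *\<^sub>R w"] le[of \<xi> \<eta>] \<xi> \<eta> by (simp add: power2_eq_square)
qed

text \<open>The second difference is symmetric in \<open>v\<close> and \<open>w\<close>, so the two
  mixed derivatives take a common value at points arbitrarily close to \<open>x\<close>; continuity
  does the rest.\<close>

lemma second_derivative_symmetric:
  fixes u :: "'e::euclidean_space \<Rightarrow> real"
  assumes U: "open U" "x \<in> U" and u: "smooth_on U u"
  shows "frechet_derivative (\<lambda>y. frechet_derivative u (at y) v) (at x) w
    = frechet_derivative (\<lambda>y. frechet_derivative u (at y) w) (at x) v"
proof -
  define P where "P v w y = frechet_derivative (\<lambda>y. frechet_derivative u (at y) v) (at y) w" for v w y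
  have cont: "isCont (P v w) x" for v w
    using smooth_on_imp_continuous_on[OF smooth_on_frechet[OF smooth_on_frechet[OF u]], of v w] U
    by (simp add: P_def[abs_def] continuous_on_eq_continuous_at)
  obtain r where r: "r > 0" "ball x r \<subseteq> U" using U openE by blast
  have "\<bar>P v w x - P w v x\<bar> \<le> \<epsilon>" if "\<epsilon> > 0" for \<epsilon>
  proof -
    obtain d1 where d1: "d1 > 0" "\<And>p. dist x p < d1 \<Longrightarrow> \<bar>P v w p - P v w x\<bar> < \<epsilon> / 2"
      using cont[of v w, unfolded continuous_at_eps_delta, rule_format, OF half_gt_zero[OF \<open>\<epsilon> > 0\<close>]]
      by (auto simp: dist_commute dist_real_def)
    obtain d2 where d2: "d2 > 0" "\<And>p. dist x p < d2 \<Longrightarrow> \<bar>P w v p - P w v x\<bar> < \<epsilon> / 2"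
      using cont[of w v, unfolded continuous_at_eps_delta, rule_format, OF half_gt_zero[OF \<open>\<epsilon> > 0\<close>]]
      by (auto simp: dist_commute dist_real_def)
    define d where "d = min r (min d1 d2)"
    \<comment> \<open>The summand \<open>1\<close> guards against \<open>v = w = 0\<close>.\<close>
    define h where "h = d / (2 * (norm v + norm w + 1))"
    have pos: "norm v + norm w + 1 > 0" by (simp add: add_nonneg_pos)
    have d: "d > 0" using r d1 d2 by (simp add: d_def)
    have h: "h > 0" using d pos by (simp add: h_def)
    have "h * (norm v + norm w) \<le> h * (norm v + norm w + 1)" using h by simp
    also have "\<dots> = d / 2" using less_imp_neq[OF pos, symmetric] by (simp add: h_def field_simps)
    finally have hd: "h * (norm v + norm w) < d" using d by simp
    have u': "smooth_on (ball x r) u" by (rule smooth_on_subset[OF u r(2)])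
    obtain p where p: "dist x p \<le> h * (norm v + norm w)"
      "u (x + h *\<^sub>R v + h *\<^sub>R w) - u (x + h *\<^sub>R v) - u (x + h *\<^sub>R w) + u x = h\<^sup>2 * P v w p"
      using second_difference[OF u' h, of v w] hd by (auto simp: d_def P_def)
    obtain q where q: "dist x q \<le> h * (norm v + norm w)"
      "u (x + h *\<^sub>R w + h *\<^sub>R v) - u (x + h *\<^sub>R w) - u (x + h *\<^sub>R v) + u x = h\<^sup>2 * P w v q"
      using second_difference[OF u' h, of w v] hd by (auto simp: d_def P_def add.commute)
    have "x + h *\<^sub>R w + h *\<^sub>R v = x + h *\<^sub>R v + h *\<^sub>R w" by simp
    from q(2)[unfolded this] p(2) have "h\<^sup>2 * P v w p = h\<^sup>2 * P w v q" by linarith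
    then have "P v w p = P w v q" using h by simp
    moreover have "\<bar>P v w p - P v w x\<bar> < \<epsilon> / 2" "\<bar>P w v q - P w v x\<bar> < \<epsilon> / 2"
      using d1(2)[of p] d2(2)[of q] p(1) q(1) hd by (auto simp: d_def)
    ultimately show ?thesis by linarith
  qed
  then have "\<bar>P v w x - P w v x\<bar> \<le> 0" by (rule field_le_epsilon) simp
  then show ?thesis by (simp add: P_def)
qed

section \<open>Implicit functions\<close>

text \<open>Strict monotonicity in \<open>t\<close> gives the unique zero by the intermediate value
  theorem. Differentiability of \<open>u\<close> is then read off from the inverse function theorem,
  and higher regularity from the formula for the derivative. The conclusion describes all zeros in a
  full box, which is what makes a piece of hypersurface a graph.\<close>

lemma implicit_function_scalar:
  fixes \<rho> :: "'e::euclidean_space \<times> real \<Rightarrow> real"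
  assumes W: "open W" "smooth_on W \<rho>" "(x0, t0) \<in> W"
    and zero: "\<rho> (x0, t0) = 0" and deriv: "frechet_derivative \<rho> (at (x0, t0)) (0, 1) \<noteq> 0"
  obtains V \<delta> u where "open V" "x0 \<in> V" "\<delta> > 0" "V \<times> {t0 - \<delta><..<t0 + \<delta>} \<subseteq> W" "smooth_on V u" "u x0 = t0"
    "\<And>x. x \<in> V \<Longrightarrow> u x \<in> {t0 - \<delta><..<t0 + \<delta>}"
    "\<And>x t. x \<in> V \<Longrightarrow> t \<in> {t0 - \<delta><..<t0 + \<delta>} \<Longrightarrow> \<rho> (x, t) = 0 \<longleftrightarrow> t = u x"
proof -
  let ?D = "\<lambda>z. frechet_derivative \<rho> (at z)"
  \<comment> \<open>A sign, so that \<open>f\<close> is increasing in \<open>t\<close> whichever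
    sign the derivative of \<open>\<rho>\<close> has.\<close>
  define \<sigma> where "\<sigma> = sgn (?D (x0, t0) (0, 1))"
  define f where "f z = \<sigma> * \<rho> z" for z
  have \<sigma>: "\<sigma> \<noteq> 0" using deriv by (simp add: \<sigma>_def sgn_zero_iff)
  define c where "c z = \<sigma> * ?D z (0, 1)" for z
  have contc: "continuous_on W c"
    unfolding c_def by (intro continuous_intros smooth_on_imp_continuous_on smooth_on_frechet W)
  have contf: "continuous_on W f"
    unfolding f_def by (intro continuous_intros smooth_on_imp_continuous_on[OF W(2)])
  define P where "P = W \<inter> c -` {0<..}"
  have P: "open P" unfolding P_def by (rule continuous_open_preimage[OF contc W(1)]) simp
  have "(x0, t0) \<in> P" using W(3) deriv by (simp add: P_def c_def \<sigma>_def abs_sgn sgn_mult_self_eq mult.commute)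
    (metis abs_sgn mult.commute zero_less_abs_iff)
  then obtain r where r: "r > 0" "ball (x0, t0) r \<subseteq> P" using P openE by blast
  define \<delta> where "\<delta> = r / 2"
  have \<delta>: "\<delta> > 0" using r by (simp add: \<delta>_def)
  have box: "(x, t) \<in> P" if "x \<in> ball x0 \<delta>" "\<bar>t - t0\<bar> \<le> \<delta>" for x t
  proof -
    have "dist (x0, t0) (x, t) \<le> dist x0 x + dist t0 t"
      by (simp add: dist_prod_def sqrt_add_le_add_sqrt[THEN order_trans])
    then have "dist (x0, t0) (x, t) < r" using that by (auto simp: \<delta>_def dist_real_def abs_minus_commute)
    then show ?thesis using r(2) by auto
  qed
  have boxW: "(x, t) \<in> W" if "x \<in> ball x0 \<delta>" "\<bar>t - t0\<bar> \<le> \<delta>" for x t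
    using box[OF that] by (simp add: P_def)
  have Df: "((\<lambda>t. f (x, t)) has_real_derivative c (x, t)) (at t)" if "(x, t) \<in> W" for x t
  proof -
    have 1: "((\<lambda>t. (x, t)) has_derivative (\<lambda>h. (0, h))) (at t)" by (auto intro!: derivative_eq_intros)
    have 2: "((\<lambda>t. \<rho> (x, t)) has_derivative (\<lambda>h. ?D (x, t) (0, h))) (at t)"
      by (rule has_derivative_compose[OF 1 smooth_on_has_derivative[OF W(2) that]])
    have "(\<lambda>h. ?D (x, t) (0, h)) = (*) (?D (x, t) (0, 1))"
    proof
      show "?D (x, t) (0, h) = ?D (x, t) (0, 1) * h" for h
        using linear_cmul[OF smooth_on_linear_frechet[OF W(2) that], of h "(0, 1)"] by simp
    qed
    with 2 have "((\<lambda>t. \<rho> (x, t)) has_real_derivative ?D (x, t) (0, 1)) (at t)"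
      unfolding has_field_derivative_def by (simp only:)
    then show ?thesis unfolding f_def c_def by (rule DERIV_cmult)
  qed
  have mono: "f (x, s) < f (x, t)" if "x \<in> ball x0 \<delta>" "s < t" "\<bar>s - t0\<bar> \<le> \<delta>" "\<bar>t - t0\<bar> \<le> \<delta>" for x s t
  proof (rule DERIV_pos_imp_increasing[OF that(2)])
    fix \<tau> assume "s \<le> \<tau>" "\<tau> \<le> t"
    then have "\<bar>\<tau> - t0\<bar> \<le> \<delta>" using that by linarith
    from box[OF that(1) this] have "(x, \<tau>) \<in> W" "0 < c (x, \<tau>)" by (auto simp: P_def)
    with Df show "\<exists>y. ((\<lambda>t. f (x, t)) has_real_derivative y) (at \<tau>) \<and> 0 < y" by blast
  qed
  \<comment> \<open>At the two ends of the interval \<open>f\<close> has strict and opposite signs.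
    These are open conditions holding at \<open>x0\<close>, and they trap the zero in
    between.\<close>
  define V where "V = ball x0 \<delta> \<inter> (\<lambda>x. f (x, t0 - \<delta>)) -` {..<0} \<inter> (\<lambda>x. f (x, t0 + \<delta>)) -` {0<..}"
  have slice: "continuous_on (ball x0 \<delta>) (\<lambda>x. f (x, t))" if "\<bar>t - t0\<bar> \<le> \<delta>" for t
    by (rule continuous_on_compose2[OF contf]) (use boxW that in \<open>auto intro!: continuous_intros\<close>)
  have V_eq: "V = (ball x0 \<delta> \<inter> (\<lambda>x. f (x, t0 - \<delta>)) -` {..<0}) \<inter> (ball x0 \<delta> \<inter> (\<lambda>x. f (x, t0 + \<delta>)) -` {0<..})"
    by (auto simp: V_def)
  have oV: "open V" unfolding V_eq
    by (intro open_Int continuous_open_preimage slice) (use \<delta> in auto)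
  have fx0: "f (x0, t0) = 0" using zero by (simp add: f_def)
  have x0V: "x0 \<in> V"
    using mono[of x0 "t0 - \<delta>" t0] mono[of x0 t0 "t0 + \<delta>"] \<delta> fx0 by (simp add: V_def)
  have ex: "\<exists>t. t \<in> {t0 - \<delta><..<t0 + \<delta>} \<and> f (x, t) = 0" if x: "x \<in> V" for x
  proof -
    have "continuous_on {t0 - \<delta>..t0 + \<delta>} (\<lambda>t. f (x, t))"
      by (rule continuous_on_compose2[OF contf]) (use boxW x in \<open>auto intro!: continuous_intros simp: V_def abs_le_iff\<close>)
    then obtain t where t: "t0 - \<delta> \<le> t" "t \<le> t0 + \<delta>" "f (x, t) = 0"
      using IVT'[of "\<lambda>t. f (x, t)" "t0 - \<delta>" 0 "t0 + \<delta>"] x \<delta> by (auto simp: V_def)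
    then have "t \<noteq> t0 - \<delta>" "t \<noteq> t0 + \<delta>" using x by (auto simp: V_def)
    with t show ?thesis by (intro exI[of _ t]) auto
  qed
  define u where "u x = (SOME t. t \<in> {t0 - \<delta><..<t0 + \<delta>} \<and> f (x, t) = 0)" for x
  have u: "u x \<in> {t0 - \<delta><..<t0 + \<delta>}" "f (x, u x) = 0" if "x \<in> V" for x
    using someI_ex[OF ex[OF that]] by (auto simp: u_def)
  have uniq: "f (x, t) = 0 \<longleftrightarrow> t = u x" if x: "x \<in> V" and t: "t \<in> {t0 - \<delta><..<t0 + \<delta>}" for x t
  proof
    assume "f (x, t) = 0"
    then show "t = u x"
      using mono[of x t "u x"] mono[of x "u x" t] u[OF x] x t by (cases t "u x" rule: linorder_cases) (auto simp: V_def abs_le_iff)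
  qed (use u[OF x] in auto)
  have uW: "(x, u x) \<in> W" "c (x, u x) > 0" if "x \<in> V" for x
    using box[of x "u x"] u(1)[OF that] that by (auto simp: V_def P_def abs_le_iff)
  define u' where "u' x h = - ?D (x, u x) (h, 0) / ?D (x, u x) (0, 1)" for x h
  have Dt: "?D (x, u x) (0, 1) \<noteq> 0" if "x \<in> V" for x
    using uW(2)[OF that] by (auto simp: c_def)
  have \<rho>u: "\<rho> (x, u x) = 0" if "x \<in> V" for x using u(2)[OF that] \<sigma> by (simp add: f_def)
  have du: "(u has_derivative u' x) (at x)" if x: "x \<in> V" for x
  proof -
    let ?J = "{t0 - \<delta><..<t0 + \<delta>}" and ?b = "?D (x, u x) (0, 1)"
    \<comment> \<open>The usual companion map whose inverse carries \<open>(y, 0)\<close> to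
      \<open>(y, u y)\<close>. It is injective by monotonicity, so only the differentiability of its
      inverse is in question.\<close>
    define F where "F z = (fst z, \<rho> z)" for z
    have inj: "inj_on F (V \<times> ?J)"
    proof (rule inj_onI)
      fix z w assume zw: "z \<in> V \<times> ?J" "w \<in> V \<times> ?J" "F z = F w"
      then have "fst z = fst w" "f z = f w" by (simp_all add: F_def f_def)
      with zw(1,2) mono[of "fst z" "snd z" "snd w"] mono[of "fst z" "snd w" "snd z"] show "z = w"
        by (cases "snd z" "snd w" rule: linorder_cases) (auto simp: V_def abs_le_iff prod_eq_iff)
    qed
    note lin = smooth_on_linear_frechet[OF W(2) uW(1)[OF x]]
    have Dsum: "?D (x, u x) (h, k) = ?D (x, u x) (h, 0) + k * ?b" for h k
      using linear_add[OF lin, of "(h, 0)" "(0, k)"] linear_cmul[OF lin, of k "(0, 1)"] by simp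
    have "(F has_derivative (\<lambda>d. (fst d, ?D (x, u x) d))) (at (x, u x))"
      unfolding F_def
      by (intro has_derivative_Pair has_derivative_fst has_derivative_ident smooth_on_has_derivative[OF W(2) uW(1)[OF x]])
    then have "(inv_into (V \<times> ?J) F has_derivative (\<lambda>d. (fst d, (snd d - ?D (x, u x) (fst d, 0)) / ?b))) (at (F (x, u x)))"
    proof (rule has_derivative_inverse_strong[rotated 4])
      show "open (V \<times> ?J)" by (intro open_Times oV open_greaterThanLessThan)
      show "(x, u x) \<in> V \<times> ?J" using x u(1)[OF x] by simp
      have "continuous_on (V \<times> ?J) \<rho>"
        by (rule continuous_on_subset[OF smooth_on_imp_continuous_on[OF W(2)]]) (use boxW in \<open>auto simp: V_def abs_le_iff\<close>)
      then show "continuous_on (V \<times> ?J) F" unfolding F_def by (intro continuous_intros)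
      show "inv_into (V \<times> ?J) F (F z) = z" if "z \<in> V \<times> ?J" for z by (rule inv_into_f_f[OF inj that])
      show "(\<lambda>d. (fst d, ?D (x, u x) d)) \<circ> (\<lambda>d. (fst d, (snd d - ?D (x, u x) (fst d, 0)) / ?b)) = id"
        using Dt[OF x] by (auto simp: fun_eq_iff Dsum[of _ "_ / _"])
    qed
    then have "(inv_into (V \<times> ?J) F has_derivative (\<lambda>d. (fst d, (snd d - ?D (x, u x) (fst d, 0)) / ?b))) (at (x, 0))"
      by (simp add: F_def \<rho>u[OF x])
    from has_derivative_snd[OF has_derivative_compose[of "\<lambda>y. (y, 0)" "\<lambda>h. (h, 0)", OF _ this]]
    have "((\<lambda>y. snd (inv_into (V \<times> ?J) F (y, 0))) has_derivative u' x) (at x)"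
      by (simp add: u'_def[abs_def] has_derivative_Pair)
    then show ?thesis
    proof (rule has_derivative_transform_within_open[OF _ oV x])
      fix y assume y: "y \<in> V"
      have "inv_into (V \<times> ?J) F (F (y, u y)) = (y, u y)" using inv_into_f_f[OF inj] y u(1)[OF y] by simp
      then show "snd (inv_into (V \<times> ?J) F (y, 0)) = u y" by (simp add: F_def \<rho>u[OF y])
    qed
  qed
  \<comment> \<open>\<open>u'\<close> is a quotient of derivatives of \<open>\<rho>\<close> along
    the graph of \<open>u\<close>, hence as regular as \<open>u\<close> itself; each round gains one
    order.\<close>
  have "Ck_on k V u" for k
  proof (induction k)
    case 0
    have "continuous_on V u" by (rule has_derivative_continuous_on) (rule has_derivative_at_withinI[OF du])
    then show ?case by simp
  next
    case (Suc k)
    have pair: "Ck_on k V (\<lambda>x. (x, u x))" by (intro Ck_on_Pair oV Ck_on_id Suc)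
    have D: "Ck_on k V (\<lambda>x. ?D (x, u x) v)" for v
      by (rule Ck_on_frechet_comp[OF oV W(1) smooth_onD[OF W(2)] pair _ Ck_on_const]) (use uW in auto)
    show ?case
    proof (rule Ck_on_SucI[OF oV du])
      show "Ck_on k V (\<lambda>x. u' x v)" for v
        unfolding u'_def by (rule Ck_on_divide[OF oV Ck_on_minus[OF oV D] D Dt])
    qed
  qed
  then have "smooth_on V u" by (simp add: smooth_on_def)
  show thesis
  proof (rule that[OF oV x0V \<delta> _ \<open>smooth_on V u\<close>])
    show "V \<times> {t0 - \<delta><..<t0 + \<delta>} \<subseteq> W" using boxW by (auto simp: V_def abs_le_iff)
    show "u x0 = t0" using uniq[OF x0V, of t0] \<delta> fx0 by simp
    show "\<rho> (x, t) = 0 \<longleftrightarrow> t = u x" if "x \<in> V" "t \<in> {t0 - \<delta><..<t0 + \<delta>}" for x t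
      using uniq[OF that] \<sigma> by (simp add: f_def)
  qed (rule u(1))
qed

section \<open>Charts and tangent vectors\<close>

lemma chart_simps:
  assumes "is_chart c"
  shows chart_inv: "p \<in> cdom c \<Longrightarrow> cinv c (cmap c p) = p"
    and chart_inv_in: "x \<in> cmap c ` cdom c \<Longrightarrow> cinv c x \<in> cdom c"
    and chart_map_inv: "x \<in> cmap c ` cdom c \<Longrightarrow> cmap c (cinv c x) = x"
    and chart_open: "open (cmap c ` cdom c)"
    and chart_open_dom: "open (cdom c)"
  using assms unfolding is_chart_def homeomorphism_def by auto

lemma chart_continuous_inv: "is_chart c \<Longrightarrow> continuous_on (cmap c ` cdom c) (cinv c)"
  and chart_continuous_map: "is_chart c \<Longrightarrow> continuous_on (cdom c) (cmap c)"
  by (auto simp: is_chart_def homeomorphism_def)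

lemma chart_image_eq:
  "is_chart c \<Longrightarrow> cmap c ` (cdom c \<inter> W) = cmap c ` cdom c \<inter> cinv c -` W"
proof (intro equalityI subsetI)
  fix x assume c: "is_chart c" and x: "x \<in> cmap c ` (cdom c \<inter> W)"
  then obtain p where "p \<in> cdom c" "p \<in> W" "x = cmap c p" by blast
  then show "x \<in> cmap c ` cdom c \<inter> cinv c -` W" by (simp add: chart_inv[OF c])
next
  fix x assume c: "is_chart c" and x: "x \<in> cmap c ` cdom c \<inter> cinv c -` W"
  then obtain p where "p \<in> cdom c" "x = cmap c p" by blast
  then show "x \<in> cmap c ` (cdom c \<inter> W)" using x chart_inv[OF c, of p] by simp
qed

lemma open_chart_image: "is_chart c \<Longrightarrow> open W \<Longrightarrow> open (cmap c ` (cdom c \<inter> W))"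
  unfolding chart_image_eq by (intro continuous_open_preimage chart_continuous_inv chart_open)

lemma atlas_chart: "smooth_atlas A \<Longrightarrow> c \<in> A \<Longrightarrow> is_chart c"
  and atlas_compat: "smooth_atlas A \<Longrightarrow> c \<in> A \<Longrightarrow> d \<in> A \<Longrightarrow> smooth_compat c d"
  by (auto simp: smooth_atlas_def)

lemma atlas_cover:
  assumes "smooth_atlas A"
  obtains c where "c \<in> A" "p \<in> cdom c"
proof -
  have "p \<in> (\<Union>c\<in>A. cdom c)" using assms by (simp add: smooth_atlas_def)
  then show thesis using that by (rule UN_E)
qed

lemma transition_smooth:
  "smooth_compat c d \<Longrightarrow> smooth_on (cmap c ` (cdom c \<inter> cdom d)) (\<lambda>x. cmap d (cinv c x))"
  by (simp add: smooth_compat_def o_def)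

lemma transition_smooth':
  "smooth_compat c d \<Longrightarrow> smooth_on (cmap d ` (cdom c \<inter> cdom d)) (\<lambda>x. cmap c (cinv d x))"
  by (simp add: smooth_compat_def o_def)

lemma has_derivative_chart_change:
  assumes c: "is_chart c" and d: "is_chart d" and compat: "smooth_compat c d"
    and p: "p \<in> cdom c" "p \<in> cdom d"
    and f: "(f \<circ> cinv d) differentiable at (cmap d p)"
  shows "((f \<circ> cinv c) has_derivative
    (\<lambda>v. frechet_derivative (f \<circ> cinv d) (at (cmap d p))
      (frechet_derivative (\<lambda>x. cmap d (cinv c x)) (at (cmap c p)) v))) (at (cmap c p))"
proof -
  let ?U = "cmap c ` (cdom c \<inter> cdom d)" and ?\<tau> = "\<lambda>x. cmap d (cinv c x)"
  have U: "open ?U" "cmap c p \<in> ?U" using open_chart_image[OF c chart_open_dom[OF d]] p by auto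
  have \<tau>: "(?\<tau> has_derivative frechet_derivative ?\<tau> (at (cmap c p))) (at (cmap c p))"
    by (rule smooth_on_has_derivative[OF transition_smooth[OF compat] U(2)])
  have eq: "?\<tau> (cmap c p) = cmap d p" using chart_inv[OF c p(1)] by simp
  have "((f \<circ> cinv d) has_derivative frechet_derivative (f \<circ> cinv d) (at (cmap d p))) (at (?\<tau> (cmap c p)))"
    using f unfolding eq frechet_derivative_works .
  from has_derivative_compose[OF \<tau> this] show ?thesis
    by (rule has_derivative_transform_within_open[OF _ U])
      (auto simp: chart_inv[OF c] chart_inv[OF d])
qed

text \<open>Transition maps are smooth, so the existential over charts in \<open>diff_at\<close> may
  be evaluated in any one chart around the point.\<close>

lemma diff_at_chart:
  assumes A: "smooth_atlas A" "c \<in> A" and p: "p \<in> cdom c"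
  shows "diff_at A f p \<longleftrightarrow> (f \<circ> cinv c) differentiable at (cmap c p)"
proof
  assume "diff_at A f p"
  then obtain d where d: "d \<in> A" "p \<in> cdom d" "(f \<circ> cinv d) differentiable at (cmap d p)"
    by (auto simp: diff_at_def)
  show "(f \<circ> cinv c) differentiable at (cmap c p)"
    by (rule differentiableI[OF has_derivative_chart_change[OF _ _ _ p d(2,3)]])
      (use A d(1) atlas_chart atlas_compat in blast)+
qed (use assms in \<open>auto simp: diff_at_def\<close>)

lemma velocity_coord:
  assumes A: "smooth_atlas A" "c \<in> A" and I: "open I" "0 \<in> I" "\<gamma> ` I \<subseteq> cdom c"
    and v: "((\<lambda>t. cmap c (\<gamma> t)) has_vector_derivative v) (at 0)"
  shows "velocity A \<gamma> = (\<lambda>f. if diff_at A f (\<gamma> 0)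
    then frechet_derivative (f \<circ> cinv c) (at (cmap c (\<gamma> 0))) v else 0)"
proof
  fix f :: "'a \<Rightarrow> real"
  note c = atlas_chart[OF A]
  have \<gamma>0: "\<gamma> 0 \<in> cdom c" using I by auto
  have "vector_derivative (f \<circ> \<gamma>) (at 0) = frechet_derivative (f \<circ> cinv c) (at (cmap c (\<gamma> 0))) v"
    if "diff_at A f (\<gamma> 0)"
  proof -
    have "((f \<circ> cinv c) has_derivative frechet_derivative (f \<circ> cinv c) (at (cmap c (\<gamma> 0)))) (at (cmap c (\<gamma> 0)))"
      using that unfolding diff_at_chart[OF A \<gamma>0] frechet_derivative_works .
    from vector_derivative_diff_chain_within[OF v has_derivative_at_withinI[OF this]]
    have "((f \<circ> cinv c) \<circ> (\<lambda>t. cmap c (\<gamma> t)) has_vector_derivative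
        frechet_derivative (f \<circ> cinv c) (at (cmap c (\<gamma> 0))) v) (at 0)" .
    then have "(f \<circ> \<gamma> has_vector_derivative frechet_derivative (f \<circ> cinv c) (at (cmap c (\<gamma> 0))) v) (at 0)"
      by (rule has_vector_derivative_transform_within_open[OF _ I(1,2)])
        (use I(3) chart_inv[OF c] in auto)
    then show ?thesis by (rule vector_derivative_at)
  qed
  then show "velocity A \<gamma> f = (if diff_at A f (\<gamma> 0)
    then frechet_derivative (f \<circ> cinv c) (at (cmap c (\<gamma> 0))) v else 0)" by (simp add: velocity_def)
qed

lemma coord_vector_eq:
  assumes A: "smooth_atlas A" "c \<in> A" and p: "p \<in> cdom c"
  shows "coord_vector A c p v = (\<lambda>f. if diff_at A f p
    then frechet_derivative (f \<circ> cinv c) (at (cmap c p)) v else 0)"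
proof -
  note c = atlas_chart[OF A]
  let ?l = "\<lambda>s::real. cmap c p + s *\<^sub>R v"
  let ?I = "?l -` (cmap c ` cdom c)"
  have oI: "open ?I"
    by (rule open_vimage[OF chart_open[OF c]]) (intro continuous_intros)
  have 0: "0 \<in> ?I" using p by simp
  have sub: "(\<lambda>s. cinv c (?l s)) ` ?I \<subseteq> cdom c" using chart_inv_in[OF c] by auto
  have "(?l has_vector_derivative v) (at 0)" by (auto intro!: derivative_eq_intros)
  then have "((\<lambda>t. cmap c (cinv c (?l t))) has_vector_derivative v) (at 0)"
    by (rule has_vector_derivative_transform_within_open[OF _ oI 0]) (simp add: chart_map_inv[OF c])
  note * = velocity_coord[OF A oI 0 sub this]
  have "cinv c (cmap c p + 0 *\<^sub>R v) = p" by (simp add: chart_inv[OF c p])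
  from *[unfolded this] show ?thesis unfolding coord_vector_def .
qed

lemma velocity_coord_vector:
  assumes A: "smooth_atlas A" "c \<in> A" and I: "open I" "0 \<in> I" "\<gamma> ` I \<subseteq> cdom c"
    and v: "((\<lambda>t. cmap c (\<gamma> t)) has_vector_derivative v) (at 0)"
  shows "velocity A \<gamma> = coord_vector A c (\<gamma> 0) v"
  unfolding velocity_coord[OF assms] by (rule coord_vector_eq[OF A, symmetric]) (use I in auto)

text \<open>Coordinate functions are differentiable, so the default value \<open>0\<close> of
  \<open>velocity\<close> does not interfere.\<close>

lemma components_coord_vector:
  assumes A: "smooth_atlas A" "c \<in> A" and p: "p \<in> cdom c"
  shows "components c (coord_vector A c p v) = v"
proof -
  note c = atlas_chart[OF A]
  have "coord_vector A c p v (\<lambda>q. cmap c q \<bullet> b) = v \<bullet> b" for b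
  proof -
    have "((\<lambda>x. x \<bullet> b) has_derivative (\<lambda>v. v \<bullet> b)) (at (cmap c p))" by (auto intro!: derivative_eq_intros)
    then have d: "((\<lambda>q. cmap c q \<bullet> b) \<circ> cinv c has_derivative (\<lambda>v. v \<bullet> b)) (at (cmap c p))"
      by (rule has_derivative_transform_within_open[OF _ chart_open[OF c]]) (use p in \<open>auto simp: chart_inv[OF c]\<close>)
    have "diff_at A (\<lambda>q. cmap c q \<bullet> b) p"
      unfolding diff_at_chart[OF A p] by (rule differentiableI[OF d])
    then show ?thesis
      unfolding coord_vector_eq[OF A p] by (simp add: frechet_derivative_at[OF d, symmetric])
  qed
  then show ?thesis by (simp add: components_def euclidean_representation)
qed

lemma coord_vector_minus:
  assumes A: "smooth_atlas A" "c \<in> A" and p: "p \<in> cdom c"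
  shows "(\<lambda>f. - coord_vector A c p v f) = coord_vector A c p (- v)"
  unfolding coord_vector_eq[OF assms]
  by (auto simp: fun_eq_iff diff_at_chart[OF assms] linear_neg[OF linear_frechet_derivative])

lemma coord_vector_add:
  assumes A: "smooth_atlas A" "c \<in> A" and p: "p \<in> cdom c"
  shows "(\<lambda>f. coord_vector A c p v f + coord_vector A c p w f) = coord_vector A c p (v + w)"
  unfolding coord_vector_eq[OF assms]
  by (auto simp: fun_eq_iff diff_at_chart[OF assms] linear_add[OF linear_frechet_derivative])

lemma coord_vector_change:
  assumes A: "smooth_atlas A" "c \<in> A" "d \<in> A" and p: "p \<in> cdom c" "p \<in> cdom d"
  shows "coord_vector A c p v =
    coord_vector A d p (frechet_derivative (\<lambda>x. cmap d (cinv c x)) (at (cmap c p)) v)"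
proof
  fix f
  have "frechet_derivative (f \<circ> cinv c) (at (cmap c p)) v = frechet_derivative (f \<circ> cinv d) (at (cmap d p))
      (frechet_derivative (\<lambda>x. cmap d (cinv c x)) (at (cmap c p)) v)" if "diff_at A f p"
    using fun_cong[OF frechet_derivative_at[OF has_derivative_chart_change[OF atlas_chart[OF A(1,2)]
        atlas_chart[OF A(1,3)] atlas_compat[OF A] p]], of f v] that
    by (simp add: diff_at_chart[OF A(1,3) p(2)])
  then show "coord_vector A c p v f = coord_vector A d p (frechet_derivative (\<lambda>x. cmap d (cinv c x)) (at (cmap c p)) v) f"
    unfolding coord_vector_eq[OF A(1,2) p(1)] coord_vector_eq[OF A(1,3) p(2)] by simp
qed

text \<open>The definition lets each curve live in a chart of its own. After shortening the time
  interval, the transition map carries the curve to any prescribed chart around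
  \<open>p\<close>.\<close>

lemma tangent_space_curve:
  assumes A: "smooth_atlas A" "c \<in> A" and p: "p \<in> cdom c" and X: "X \<in> tangent_space A S p"
  obtains \<gamma> I v where "open I" "0 \<in> I" "\<gamma> 0 = cmap c p" "\<gamma> ` I \<subseteq> cmap c ` (S \<inter> cdom c)"
    "(\<gamma> has_vector_derivative v) (at 0)" "X = coord_vector A c p v"
proof -
  from X obtain \<gamma> d \<epsilon> where \<gamma>: "X = velocity A \<gamma>" "\<gamma> 0 = p" "d \<in> A" "\<epsilon> > 0"
    "\<And>t. t \<in> {-\<epsilon><..<\<epsilon>} \<Longrightarrow> \<gamma> t \<in> S \<inter> cdom d" "smooth_on {-\<epsilon><..<\<epsilon>} (cmap d \<circ> \<gamma>)"
    unfolding tangent_space_def by blast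
  note c = atlas_chart[OF A] and d = atlas_chart[OF A(1) \<gamma>(3)]
  let ?U = "cmap d ` (cdom d \<inter> cdom c)"
  let ?I = "{-\<epsilon><..<\<epsilon>} \<inter> (cmap d \<circ> \<gamma>) -` ?U"
  have U: "open ?U" by (rule open_chart_image[OF d chart_open_dom[OF c]])
  have oI: "open ?I"
    by (rule continuous_open_preimage[OF smooth_on_imp_continuous_on[OF \<gamma>(6)] _ U]) simp
  have pd: "p \<in> cdom d" using \<gamma>(2,4) \<gamma>(5)[of 0] by auto
  have 0: "0 \<in> ?I" using \<gamma>(2,4) pd p by auto
  have I_dom: "\<gamma> t \<in> cdom c" if "t \<in> ?I" for t
  proof -
    from that obtain q where q: "q \<in> cdom d" "q \<in> cdom c" "cmap d (\<gamma> t) = cmap d q" by auto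
    moreover have "\<gamma> t \<in> cdom d" using \<gamma>(5) that by blast
    ultimately show ?thesis using chart_inv[OF d] by metis
  qed
  let ?\<tau> = "\<lambda>x. cmap c (cinv d x)"
  define v where "v = frechet_derivative ?\<tau> (at (cmap d p)) (vector_derivative (cmap d \<circ> \<gamma>) (at 0))"
  have "(?\<tau> has_derivative frechet_derivative ?\<tau> (at (cmap d p))) (at (cmap d p))"
    by (rule smooth_on_has_derivative[OF transition_smooth[OF atlas_compat[OF A(1) \<gamma>(3) A(2)]]]) (use p pd in auto)
  then have \<tau>: "(?\<tau> has_derivative frechet_derivative ?\<tau> (at (cmap d p))) (at ((cmap d \<circ> \<gamma>) 0))"
    using \<gamma>(2) by simp
  have "(cmap d \<circ> \<gamma> has_vector_derivative vector_derivative (cmap d \<circ> \<gamma>) (at 0)) (at 0)"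
    using smooth_on_differentiable[OF \<gamma>(6), of 0] \<gamma>(4) by (simp add: vector_derivative_works)
  from vector_derivative_diff_chain_within[OF this has_derivative_at_withinI[OF \<tau>]]
  have "(?\<tau> \<circ> (cmap d \<circ> \<gamma>) has_vector_derivative v) (at 0)" unfolding v_def .
  then have v: "((\<lambda>t. cmap c (\<gamma> t)) has_vector_derivative v) (at 0)"
    by (rule has_vector_derivative_transform_within_open[OF _ oI 0]) (use \<gamma>(5) chart_inv[OF d] in auto)
  show thesis
  proof (rule that[OF oI 0 _ _ v])
    show "cmap c (\<gamma> 0) = cmap c p" by (simp add: \<gamma>(2))
    show "(\<lambda>t. cmap c (\<gamma> t)) ` ?I \<subseteq> cmap c ` (S \<inter> cdom c)" using I_dom \<gamma>(5) by blast
    have "\<gamma> ` ?I \<subseteq> cdom c" using I_dom by blast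
    from velocity_coord_vector[OF A oI 0 this v] show "X = coord_vector A c p v"
      by (simp only: \<gamma>(1,2))
  qed
qed

lemma tangent_space_curveI:
  assumes A: "smooth_atlas A" "c \<in> A" and \<epsilon>: "\<epsilon> > 0" and \<gamma>: "smooth_on {-\<epsilon><..<\<epsilon>} \<gamma>"
    "\<gamma> ` {-\<epsilon><..<\<epsilon>} \<subseteq> cmap c ` (S \<inter> cdom c)" "\<gamma> 0 = cmap c p"
    "(\<gamma> has_vector_derivative v) (at 0)" and p: "p \<in> cdom c"
  shows "coord_vector A c p v \<in> tangent_space A S p"
proof -
  note c = atlas_chart[OF A]
  let ?I = "{-\<epsilon><..<\<epsilon>}" and ?\<gamma> = "\<lambda>t. cinv c (\<gamma> t)"
  have in_S: "?\<gamma> t \<in> S \<inter> cdom c \<and> cmap c (?\<gamma> t) = \<gamma> t" if t: "t \<in> ?I" for t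
  proof -
    from \<gamma>(2) t obtain q where "q \<in> S \<inter> cdom c" "\<gamma> t = cmap c q" by blast
    then show ?thesis using chart_inv[OF c] by simp
  qed
  have v: "((\<lambda>t. cmap c (?\<gamma> t)) has_vector_derivative v) (at 0)"
    by (rule has_vector_derivative_transform_within_open[OF \<gamma>(4), of ?I]) (use \<epsilon> in_S in auto)
  have "?\<gamma> ` ?I \<subseteq> cdom c" using in_S by blast
  have "0 \<in> ?I" using \<epsilon> by simp
  have "coord_vector A c (?\<gamma> 0) v = velocity A ?\<gamma>"
    using velocity_coord_vector[OF A open_greaterThanLessThan \<open>0 \<in> ?I\<close> \<open>?\<gamma> ` ?I \<subseteq> cdom c\<close> v] by simp
  moreover have "?\<gamma> 0 = p" using \<gamma>(3) chart_inv[OF c p] by simp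
  moreover have "smooth_on ?I (cmap c \<circ> ?\<gamma>)"
    using smooth_on_cong[of ?I "cmap c \<circ> ?\<gamma>" \<gamma>] in_S \<gamma>(1) by auto
  ultimately show ?thesis unfolding tangent_space_def using A(2) \<epsilon> in_S by fastforce
qed

lemma coord_vector_in_tangent_space:
  assumes A: "smooth_atlas A" "c \<in> A" and p: "p \<in> cdom c"
  shows "coord_vector A c p v \<in> tangent_space A UNIV p"
proof -
  note c = atlas_chart[OF A]
  let ?l = "\<lambda>s::real. cmap c p + s *\<^sub>R v"
  have "open (?l -` (cmap c ` cdom c))" "0 \<in> ?l -` (cmap c ` cdom c)"
    using p by (auto intro!: open_vimage[OF chart_open[OF c]] continuous_intros)
  then obtain \<epsilon> where \<epsilon>: "\<epsilon> > 0" "ball 0 \<epsilon> \<subseteq> ?l -` (cmap c ` cdom c)" using openE by blast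
  show ?thesis
  proof (rule tangent_space_curveI[OF A \<epsilon>(1), of ?l])
    show "smooth_on {-\<epsilon><..<\<epsilon>} ?l"
      by (intro smooth_on_add smooth_on_const smooth_on_scaleR smooth_on_id open_greaterThanLessThan)
    show "?l ` {-\<epsilon><..<\<epsilon>} \<subseteq> cmap c ` (UNIV \<inter> cdom c)" using \<epsilon>(2) by (auto simp: subset_iff dist_real_def)
    show "(?l has_vector_derivative v) (at 0)" by (auto intro!: derivative_eq_intros)
  qed (use p in auto)
qed

lemma tangent_space_UNIV:
  assumes A: "smooth_atlas A" "c \<in> A" and p: "p \<in> cdom c"
  shows "tangent_space A UNIV p = range (coord_vector A c p)"
proof
  show "tangent_space A UNIV p \<subseteq> range (coord_vector A c p)"
  proof
    fix X assume "X \<in> tangent_space A UNIV p"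
    from tangent_space_curve[OF assms this] show "X \<in> range (coord_vector A c p)" by blast
  qed
qed (use coord_vector_in_tangent_space[OF assms] in blast)

lemma tangent_space_mono: "S \<subseteq> T \<Longrightarrow> tangent_space A S p \<subseteq> tangent_space A T p"
  unfolding tangent_space_def by blast

section \<open>The product with the line\<close>

abbreviation prod_chart :: "('a, 'e) chart \<Rightarrow> ('a \<times> real, 'e \<times> real) chart" where
  "prod_chart c \<equiv> (cdom c \<times> UNIV, \<lambda>(p, t). (cmap c p, t))"

lemma prod_chart_image: "(\<lambda>(p, t). (f p, t)) ` (W \<times> I) = f ` W \<times> I"
  by force

lemma prod_chart_inv:
  assumes c: "is_chart c" and x: "x \<in> cmap c ` cdom c"
  shows "cinv (prod_chart c) (x, t) = (cinv c x, t)"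
  unfolding cinv_def fst_conv snd_conv
proof (rule inv_into_f_eq)
  have "inj_on (cmap c) (cdom c)" using chart_inv[OF c] by (intro inj_on_inverseI)
  then show "inj_on (\<lambda>(p, t). (cmap c p, t)) (cdom c \<times> UNIV)" by (auto simp: inj_on_def)
  show "(inv_into (cdom c) (cmap c) x, t) \<in> cdom c \<times> UNIV"
    using chart_inv_in[OF c x] by (simp add: cinv_def)
  show "(\<lambda>(p, t). (cmap c p, t)) (inv_into (cdom c) (cmap c) x, t) = (x, t)"
    using chart_map_inv[OF c x] by (simp add: cinv_def)
qed

lemma is_chart_prod:
  fixes c :: "('a::topological_space, 'e::euclidean_space) chart"
  assumes c: "is_chart c"
  shows "is_chart (prod_chart c)"
proof -
  let ?d = "prod_chart c" and ?X = "cmap c ` cdom c"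
  have im: "cmap ?d ` cdom ?d = ?X \<times> UNIV" by (simp add: prod_chart_image)
  have cont: "continuous_on (cdom ?d) (cmap ?d)"
    unfolding fst_conv snd_conv split_def
    by (intro continuous_intros continuous_on_compose2[OF chart_continuous_map[OF c]]) auto
  have "continuous_on (?X \<times> UNIV) (\<lambda>z. (cinv c (fst z), snd z :: real))"
    by (intro continuous_intros continuous_on_compose2[OF chart_continuous_inv[OF c]]) auto
  then have cont': "continuous_on (?X \<times> UNIV) (cinv ?d)"
    by (rule continuous_on_eq) (auto simp: prod_chart_inv[OF c])
  have "homeomorphism (cdom ?d) (?X \<times> UNIV) (cmap ?d) (cinv ?d)"
  proof (rule homeomorphismI[OF cont cont'])
    show "cinv ?d (cmap ?d x) = x" if "x \<in> cdom ?d" for x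
      using that chart_inv[OF c] by (auto simp: prod_chart_inv[OF c])
    show "cmap ?d (cinv ?d y) = y" if y: "y \<in> ?X \<times> UNIV" for y
    proof -
      have "cinv ?d (fst y, snd y) = (cinv c (fst y), snd y)" "cmap c (cinv c (fst y)) = fst y"
        using y by (auto simp: prod_chart_inv[OF c] chart_map_inv[OF c])
      then show ?thesis by simp
    qed
    show "cinv ?d ` (?X \<times> UNIV) \<subseteq> cdom ?d"
      using chart_inv_in[OF c] by (auto simp: prod_chart_inv[OF c])
    show "cmap ?d ` cdom ?d \<subseteq> ?X \<times> UNIV" using im by blast
  qed
  then show ?thesis
    unfolding is_chart_def im using chart_open[OF c] chart_open_dom[OF c] by (simp add: open_Times)
qed

lemma prod_atlas_eq: "prod_atlas A = prod_chart ` A"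
  by (simp add: prod_atlas_def)

lemma prod_chart_in: "c \<in> A \<Longrightarrow> prod_chart c \<in> prod_atlas A"
  by (simp add: prod_atlas_eq)

lemma smooth_atlas_prod:
  fixes A :: "('a::topological_space, 'e::euclidean_space) chart set"
  assumes A: "smooth_atlas A"
  shows "smooth_atlas (prod_atlas A)"
proof -
  have trans: "smooth_on (cmap (prod_chart c) ` (cdom (prod_chart c) \<inter> cdom (prod_chart d)))
      (cmap (prod_chart d) \<circ> cinv (prod_chart c))" if cd: "c \<in> A" "d \<in> A" for c d
  proof -
    note c = atlas_chart[OF A cd(1)] and d = atlas_chart[OF A cd(2)]
    let ?U = "cmap c ` (cdom c \<inter> cdom d)"
    have U: "open ?U" by (rule open_chart_image[OF c chart_open_dom[OF d]])
    have im: "cmap (prod_chart c) ` (cdom (prod_chart c) \<inter> cdom (prod_chart d)) = ?U \<times> UNIV"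
      by (simp add: Times_Int_Times prod_chart_image)
    have oU: "open (?U \<times> (UNIV :: real set))" using U by (simp add: open_Times)
    have 1: "smooth_on (?U \<times> (UNIV :: real set)) (\<lambda>z. (cmap d (cinv c (fst z)), snd z))"
      by (intro smooth_on_Pair oU smooth_on_compose[OF oU U transition_smooth[OF atlas_compat[OF A cd]]]
          smooth_on_bounded_linear bounded_linear_fst bounded_linear_snd) auto
    have 2: "(cmap d (cinv c (fst z)), snd z) = (cmap (prod_chart d) \<circ> cinv (prod_chart c)) z"
      if "z \<in> ?U \<times> UNIV" for z
      using that by (auto simp: prod_chart_inv[OF c])
    show ?thesis unfolding im by (rule smooth_on_cong[THEN iffD1, OF oU 2 1])
  qed
  show ?thesis
    unfolding smooth_atlas_def
  proof (intro conjI ballI)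
    show "(\<Union>c\<in>prod_atlas A. cdom c) = UNIV"
    proof (intro equalityI subsetI)
      fix z :: "'a \<times> real"
      obtain c where "c \<in> A" "fst z \<in> cdom c" using atlas_cover[OF A] by blast
      then show "z \<in> (\<Union>c\<in>prod_atlas A. cdom c)"
        unfolding prod_atlas_eq by (intro UN_I[of "prod_chart c"]) (auto simp: mem_Times_iff)
    qed simp
    show "is_chart c" if "c \<in> prod_atlas A" for c
    proof -
      obtain d where "c = prod_chart d" "d \<in> A" using \<open>c \<in> prod_atlas A\<close> unfolding prod_atlas_eq by blast
      then show ?thesis using is_chart_prod[OF atlas_chart[OF A]] by simp
    qed
    show "smooth_compat c d" if mem: "c \<in> prod_atlas A" "d \<in> prod_atlas A" for c d
    proof -
      obtain c' d' where cd: "c = prod_chart c'" "c' \<in> A" "d = prod_chart d'" "d' \<in> A"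
        using mem unfolding prod_atlas_eq by blast
      show ?thesis
        unfolding smooth_compat_def cd(1,3)
        using trans[OF cd(2,4)] trans[OF cd(4,2)] unfolding Int_commute[of "cdom (prod_chart d')"] by blast
    qed
  qed
qed

text \<open>Equality of tangent vectors is equality on all functions, including those sent to
  \<open>0\<close> by default. So it must also be checked that \<open>f \<circ> fst\<close> is
  differentiable exactly when \<open>f\<close> is.\<close>

lemma pushforward_fst_coord_vector:
  fixes A :: "('a::topological_space, 'e::euclidean_space) chart set"
  assumes A: "smooth_atlas A" "c \<in> A" and p: "p \<in> cdom c"
  shows "pushforward fst (coord_vector (prod_atlas A) (prod_chart c) (p, t) (v, a)) = coord_vector A c p v"
proof
  fix f :: "'a \<Rightarrow> real"
  note c = atlas_chart[OF A] and A' = smooth_atlas_prod[OF A(1)] prod_chart_in[OF A(2)]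
  have p': "(p, t) \<in> cdom (prod_chart c)" using p by simp
  have o: "open (cmap c ` cdom c \<times> (UNIV :: real set))" "(cmap c p, t) \<in> cmap c ` cdom c \<times> UNIV"
    using chart_open[OF c] p by (auto simp: open_Times)
  have d: "(f \<circ> fst \<circ> cinv (prod_chart c) has_derivative (\<lambda>h. frechet_derivative (f \<circ> cinv c) (at (cmap c p)) (fst h))) (at (cmap c p, t))"
    if "(f \<circ> cinv c) differentiable at (cmap c p)"
  proof -
    have "(fst has_derivative fst) (at (cmap c p, t))" by (auto intro!: derivative_eq_intros)
    from has_derivative_compose[OF this, of "f \<circ> cinv c"] that
    have "((\<lambda>z. (f \<circ> cinv c) (fst z)) has_derivative (\<lambda>h. frechet_derivative (f \<circ> cinv c) (at (cmap c p)) (fst h))) (at (cmap c p, t))"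
      by (simp add: frechet_derivative_works)
    then show ?thesis
      by (rule has_derivative_transform_within_open[OF _ o]) (auto simp: prod_chart_inv[OF c])
  qed
  have d': "(f \<circ> cinv c) differentiable at (cmap c p)"
    if "(f \<circ> fst \<circ> cinv (prod_chart c)) differentiable at (cmap c p, t)"
  proof -
    have "((\<lambda>x. (x, t)) has_derivative (\<lambda>h. (h, 0))) (at (cmap c p))" by (auto intro!: derivative_eq_intros)
    from has_derivative_compose[OF this that[unfolded frechet_derivative_works]]
    have "((\<lambda>x. (f \<circ> fst \<circ> cinv (prod_chart c)) (x, t)) has_derivative
        (\<lambda>h. frechet_derivative (f \<circ> fst \<circ> cinv (prod_chart c)) (at (cmap c p, t)) (h, 0))) (at (cmap c p))" .
    then have "(f \<circ> cinv c has_derivative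
        (\<lambda>h. frechet_derivative (f \<circ> fst \<circ> cinv (prod_chart c)) (at (cmap c p, t)) (h, 0))) (at (cmap c p))"
      by (rule has_derivative_transform_within_open[OF _ chart_open[OF c]]) (use p in \<open>auto simp: prod_chart_inv[OF c]\<close>)
    then show ?thesis by (rule differentiableI)
  qed
  have iff: "diff_at (prod_atlas A) (f \<circ> fst) (p, t) \<longleftrightarrow> diff_at A f p"
    unfolding diff_at_chart[OF A' p'] diff_at_chart[OF A p] using differentiableI[OF d] d' by auto
  show "pushforward fst (coord_vector (prod_atlas A) (prod_chart c) (p, t) (v, a)) f = coord_vector A c p v f"
    unfolding pushforward_def coord_vector_eq[OF A' p'] coord_vector_eq[OF A p] iff
    by (auto simp: diff_at_chart[OF A p] frechet_derivative_at[OF d, symmetric])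
qed

lemma coord_vector_snd:
  fixes A :: "('a::topological_space, 'e::euclidean_space) chart set"
  assumes A: "smooth_atlas A" "c \<in> A" and p: "p \<in> cdom c"
  shows "coord_vector (prod_atlas A) (prod_chart c) (p, t) (v, a) snd = a"
proof -
  note c = atlas_chart[OF A] and A' = smooth_atlas_prod[OF A(1)] prod_chart_in[OF A(2)]
  have p': "(p, t) \<in> cdom (prod_chart c)" using p by simp
  have o: "open (cmap c ` cdom c \<times> (UNIV :: real set))" "(cmap c p, t) \<in> cmap c ` cdom c \<times> UNIV"
    using chart_open[OF c] p by (auto simp: open_Times)
  have "(snd has_derivative snd) (at (cmap c p, t))" by (auto intro!: derivative_eq_intros)
  then have d: "(snd \<circ> cinv (prod_chart c) has_derivative snd) (at (cmap c p, t))"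
    by (rule has_derivative_transform_within_open[OF _ o]) (auto simp: prod_chart_inv[OF c])
  then show ?thesis
    unfolding coord_vector_eq[OF A' p'] diff_at_chart[OF A' p']
    using differentiableI[OF d] by (simp add: frechet_derivative_at[OF d, symmetric])
qed

lemma metric_coord_prod:
  fixes A :: "('a::topological_space, 'e::euclidean_space) chart set"
  assumes A: "smooth_atlas A" "c \<in> A" and x: "fst z \<in> cmap c ` cdom c"
  shows "metric_coord (prod_atlas A) (prod_metric g) (prod_chart c) z u v =
    metric_coord A g c (fst z) (fst u) (fst v) + snd u * snd v"
proof -
  note c = atlas_chart[OF A]
  obtain x t where z: "z = (x, t)" by fastforce
  obtain u1 a where u: "u = (u1, a)" by fastforce
  obtain v1 b where v: "v = (v1, b)" by fastforce
  have "cinv c x \<in> cdom c" using chart_inv_in[OF c] x z by simp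
  then show ?thesis
    unfolding metric_coord_def prod_metric_def z u v using x z
    by (simp add: prod_chart_inv[OF c] pushforward_fst_coord_vector[OF A] coord_vector_snd[OF A])
qed

lemma inner_form_metric_coord:
  assumes "riemannian_metric A g" "c \<in> A" "x \<in> cmap c ` cdom c"
  shows "inner_form (metric_coord A g c x)"
  using assms unfolding riemannian_metric_def inner_form_def by blast

lemma smooth_metric_coord:
  assumes "riemannian_metric A g" "c \<in> A"
  shows "smooth_on (cmap c ` cdom c) (\<lambda>x. metric_coord A g c x u v)"
  using assms unfolding riemannian_metric_def by blast

lemma metric_coord_vector:
  assumes "is_chart c" "p \<in> cdom c"
  shows "g p (coord_vector A c p u) (coord_vector A c p v) = metric_coord A g c (cmap c p) u v"
  by (simp add: metric_coord_def chart_inv[OF assms])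

lemma riemannian_metric_prod:
  fixes A :: "('a::topological_space, 'e::euclidean_space) chart set"
  assumes A: "smooth_atlas A" and g: "riemannian_metric A g"
  shows "riemannian_metric (prod_atlas A) (prod_metric g)"
  unfolding riemannian_metric_def
proof (rule ballI)
  fix c' assume "c' \<in> prod_atlas A"
  then obtain c where c': "c' = prod_chart c" and c: "c \<in> A" unfolding prod_atlas_eq by blast
  let ?X = "cmap c ` cdom c" and ?H = "metric_coord (prod_atlas A) (prod_metric g) c'"
  have im: "cmap c' ` cdom c' = ?X \<times> UNIV" by (simp add: c' prod_chart_image)
  have H: "?H z u v = metric_coord A g c (fst z) (fst u) (fst v) + snd u * snd v" if "z \<in> ?X \<times> UNIV" for z u v
    unfolding c' by (rule metric_coord_prod[OF A c]) (use that in auto)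
  have form: "inner_form (metric_coord A g c (fst z))" if "z \<in> ?X \<times> UNIV" for z :: "'e \<times> real"
    using inner_form_metric_coord[OF g c] that by auto
  have 1: "bilinear (?H z)" "?H z u v = ?H z v u" "u \<noteq> 0 \<Longrightarrow> ?H z u u > 0"
    if z: "z \<in> ?X \<times> UNIV" for z u v
  proof -
    note lin = inner_form_linear[OF form[OF z]]
    show "bilinear (?H z)"
      unfolding bilinear_def H[OF z]
      by (auto intro!: linearI simp: linear_add[OF lin(1)] linear_add[OF lin(2)]
          linear_cmul[OF lin(1)] linear_cmul[OF lin(2)] algebra_simps)
    show "?H z u v = ?H z v u"
      unfolding H[OF z] using inner_form_sym[OF form[OF z]] by simp
    show "?H z u u > 0" if "u \<noteq> 0"
    proof (cases "fst u = 0")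
      case True
      then have "snd u \<noteq> 0" using that by (simp add: prod_eq_iff)
      then have "snd u * snd u > 0" by (auto simp: zero_less_mult_iff linorder_neq_iff)
      then show ?thesis unfolding H[OF z] using True linear_0[OF lin(1)] by simp
    next
      case False
      then have "metric_coord A g c (fst z) (fst u) (fst u) > 0"
        using form[OF z] by (simp add: inner_form_def)
      then show ?thesis unfolding H[OF z] by (simp add: add_pos_nonneg)
    qed
  qed
  have 2: "smooth_on (?X \<times> UNIV) (\<lambda>z. ?H z u v)" for u v
  proof -
    have X: "open ?X" by (rule chart_open[OF atlas_chart[OF A c]])
    then have o: "open (?X \<times> (UNIV :: real set))" by (simp add: open_Times)
    have *: "smooth_on (?X \<times> (UNIV :: real set)) (\<lambda>z. metric_coord A g c (fst z) (fst u) (fst v) + snd u * snd v)"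
      by (intro smooth_on_add o smooth_on_const smooth_on_compose[OF o X smooth_metric_coord[OF g c]]
          smooth_on_bounded_linear bounded_linear_fst) auto
    show ?thesis by (rule smooth_on_cong[THEN iffD2, OF o H]) (assumption, rule *)
  qed
  show "(\<forall>z\<in>cmap c' ` cdom c'. bilinear (?H z) \<and> (\<forall>u v. ?H z u v = ?H z v u) \<and> (\<forall>u. u \<noteq> 0 \<longrightarrow> 0 < ?H z u u)) \<and>
      (\<forall>u v. smooth_on (cmap c' ` cdom c') (\<lambda>z. ?H z u v))"
    unfolding im using 1 2 by blast
qed

section \<open>The second fundamental form in coordinates\<close>

text \<open>A Riemannian metric in coordinates, detached from the manifold so that it can be
  restricted to smaller open sets.\<close>

definition metric_family :: "'e::euclidean_space set \<Rightarrow> ('e \<Rightarrow> 'e \<Rightarrow> 'e \<Rightarrow> real) \<Rightarrow> bool" where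
  "metric_family U G \<longleftrightarrow> open U \<and> (\<forall>x\<in>U. inner_form (G x)) \<and> (\<forall>u v. smooth_on U (\<lambda>x. G x u v))"

lemma metric_familyD:
  assumes "metric_family U G"
  shows metric_family_open: "open U"
    and metric_family_form: "x \<in> U \<Longrightarrow> inner_form (G x)"
    and metric_family_smooth: "smooth_on U (\<lambda>x. G x u v)"
    and metric_family_diff: "x \<in> U \<Longrightarrow> (\<lambda>x. G x u v) differentiable at x"
    and metric_family_bilinear: "x \<in> U \<Longrightarrow> bilinear (G x)"
    and metric_family_linear: "x \<in> U \<Longrightarrow> linear (G x u)" "x \<in> U \<Longrightarrow> linear (\<lambda>u. G x u v)"
proof -
  show "open U" "x \<in> U \<Longrightarrow> inner_form (G x)" "smooth_on U (\<lambda>x. G x u v)"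
    using assms by (auto simp: metric_family_def)
  then show "x \<in> U \<Longrightarrow> (\<lambda>x. G x u v) differentiable at x" "x \<in> U \<Longrightarrow> bilinear (G x)"
    "x \<in> U \<Longrightarrow> linear (G x u)" "x \<in> U \<Longrightarrow> linear (\<lambda>u. G x u v)"
    using inner_form_linear by (auto simp: inner_form_def intro: smooth_on_differentiable)
qed

lemma metric_family_coord:
  "smooth_atlas A \<Longrightarrow> riemannian_metric A g \<Longrightarrow> c \<in> A \<Longrightarrow> metric_family (cmap c ` cdom c) (metric_coord A g c)"
  unfolding metric_family_def
  by (simp add: inner_form_metric_coord smooth_metric_coord chart_open[OF atlas_chart])

text \<open>The Christoffel symbols with the last index lowered. Working with them avoids inverting
  the metric.\<close>

definition koszul :: "('e::euclidean_space \<Rightarrow> 'e \<Rightarrow> 'e \<Rightarrow> real) \<Rightarrow> 'e \<Rightarrow> 'e \<Rightarrow> 'e \<Rightarrow> 'e \<Rightarrow> real" where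
  "koszul G x u v w = (frechet_derivative (\<lambda>y. G y v w) (at x) u
      + frechet_derivative (\<lambda>y. G y u w) (at x) v - frechet_derivative (\<lambda>y. G y u v) (at x) w) / 2"

lemma linear_real_combination:
  fixes f1 f2 f3 :: "'e::real_vector \<Rightarrow> real"
  assumes "linear f1" "linear f2" "linear f3"
  shows "linear (\<lambda>v. (f1 v + f2 v - f3 v) / 2)"
  by (intro linearI) (simp_all add: linear_add[OF assms(1)] linear_add[OF assms(2)] linear_add[OF assms(3)]
    linear_cmul[OF assms(1)] linear_cmul[OF assms(2)] linear_cmul[OF assms(3)] field_simps)

lemma koszul_linear:
  assumes G: "metric_family U G" and x: "x \<in> U"
  shows "linear (koszul G x u v)" and "linear (\<lambda>v. koszul G x u v w)"
proof -
  note d = metric_family_diff[OF G] and l = metric_family_linear[OF G] and U = metric_family_open[OF G]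
  have 1: "linear (\<lambda>w. frechet_derivative (\<lambda>y. G y v w) (at x) u)" for u v
    by (rule linear_frechet_family[OF U x l(1) d[OF x]])
  have 2: "linear (\<lambda>v. frechet_derivative (\<lambda>y. G y v w) (at x) u)" for u w
    by (rule linear_frechet_family[where B = "\<lambda>y v. G y v w", OF U x l(2) d[OF x]])
  have 3: "linear (frechet_derivative (\<lambda>y. G y u v) (at x))" for u v
    by (rule linear_frechet_derivative[OF d[OF x]])
  show "linear (koszul G x u v)"
    unfolding koszul_def[abs_def] by (intro linear_real_combination 1 3)
  show "linear (\<lambda>v. koszul G x u v w)"
    unfolding koszul_def by (intro linear_real_combination 1 2 3)
qed

text \<open>The description in \<open>christoffel\<close> is proper: the Koszul expression is linear
  in \<open>w\<close>, so a representing vector exists, and it is unique by nondegeneracy.\<close>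

lemma christoffel_koszul:
  assumes A: "smooth_atlas A" "riemannian_metric A g" "c \<in> A" and x: "x \<in> cmap c ` cdom c"
  shows "metric_coord A g c x (christoffel A g c x u v) w = koszul (metric_coord A g c) x u v w"
proof -
  let ?G = "metric_coord A g c"
  note G = metric_family_coord[OF A]
  obtain z where z: "\<And>w. ?G x z w = koszul ?G x u v w"
    using inner_form_riesz[OF metric_family_form[OF G x] koszul_linear(1)[OF G x]] by blast
  have "christoffel A g c x u v = z"
    unfolding christoffel_def koszul_def[symmetric]
  proof (rule the_equality)
    show "z' = z" if "\<forall>w. ?G x z' w = koszul ?G x u v w" for z'
      by (rule inner_form_nondegenerate[OF metric_family_form[OF G x]]) (simp add: that z)
  qed (simp add: z)
  then show ?thesis by (simp add: z)
qed

text \<open>Derivatives within a thin set need not be unique, but along a curve in the set both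
  compute the same velocity. This makes \<open>covariant_derivative\<close> computable in tangent
  directions.\<close>

lemma has_derivative_within_unique_curve:
  assumes f: "(f has_derivative D1) (at x within T)" "(f has_derivative D2) (at x within T)"
    and \<gamma>: "open I" "0 \<in> I" "\<gamma> 0 = x" "\<gamma> ` I \<subseteq> T" "(\<gamma> has_vector_derivative v) (at 0)"
  shows "D1 v = D2 v"
proof -
  have "(f \<circ> \<gamma> has_vector_derivative D v) (at 0)" if D: "(f has_derivative D) (at x within T)" for D
  proof -
    have "(f has_derivative D) (at (\<gamma> 0) within \<gamma> ` I)"
      using has_derivative_subset[OF D \<gamma>(4)] \<gamma>(3) by simp
    from vector_derivative_diff_chain_within[OF has_vector_derivative_at_within[OF \<gamma>(5)] this]
    show ?thesis using at_within_open[OF \<gamma>(2,1)] by simp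
  qed
  then show ?thesis using f vector_derivative_unique_at by blast
qed

text \<open>The normal lives only on \<open>S\<close>; \<open>n\<close> is a local extension of its
  components that can be differentiated in the ordinary sense. In tangent directions the two
  derivatives agree.\<close>

lemma second_form_coord:
  assumes A: "smooth_atlas A" "riemannian_metric A g" "c \<in> A" and p: "p \<in> S" "p \<in> cdom c"
    and W: "open W" "cmap c p \<in> W"
    and n: "\<And>y. y \<in> W \<Longrightarrow> y \<in> cmap c ` (S \<inter> cdom c) \<Longrightarrow> components c (N (cinv c y)) = n y"
      "(n has_derivative n') (at (cmap c p))"
    and u: "coord_vector A c p u \<in> tangent_space A S p"
  shows "second_form A g c S N p (coord_vector A c p u) (coord_vector A c p w) =
    - (metric_coord A g c (cmap c p) (n' u) w + koszul (metric_coord A g c) (cmap c p) u (n (cmap c p)) w)"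
proof -
  define x where "x = cmap c p"
  let ?T = "cmap c ` (S \<inter> cdom c)" and ?G = "metric_coord A g c"
  let ?f = "\<lambda>y. components c (N (cinv c y))"
  note c = atlas_chart[OF A(1,3)]
  note G = metric_family_coord[OF A]
  have xT: "x \<in> ?T" "x \<in> cmap c ` cdom c" using p by (auto simp: x_def)
  have px: "cinv c x = p" using chart_inv[OF c p(2)] by (simp add: x_def)
  obtain d where d: "d > 0" "ball x d \<subseteq> W" using W openE unfolding x_def by blast
  have f: "(?f has_derivative n') (at x within ?T)"
  proof (rule has_derivative_transform_within[OF has_derivative_at_withinI[OF n(2)[folded x_def]] d(1) xT(1)])
    show "n y = ?f y" if "y \<in> ?T" "dist y x < d" for y
    proof -
      have "y \<in> W" using that(2) d(2) by (auto simp: dist_commute subset_iff)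
      then show ?thesis using n(1)[OF _ that(1)] by simp
    qed
  qed
  then have f': "(?f has_derivative frechet_derivative ?f (at x within ?T)) (at x within ?T)"
    by (rule frechet_derivative_works[THEN iffD1, OF differentiableI])
  obtain \<gamma> I v where \<gamma>: "open I" "0 \<in> I" "\<gamma> 0 = cmap c p" "\<gamma> ` I \<subseteq> ?T"
    "(\<gamma> has_vector_derivative v) (at 0)" "coord_vector A c p u = coord_vector A c p v"
    by (rule tangent_space_curve[OF A(1,3) p(2) u], rule that, assumption+)
  have "u = v" using arg_cong[OF \<gamma>(6), of "components c"] by (simp add: components_coord_vector[OF A(1,3) p(2)])
  then have "frechet_derivative ?f (at x within ?T) u = n' u"
    using has_derivative_within_unique_curve[OF f' f \<gamma>(1,2) _ \<gamma>(4,5)] \<gamma>(3) by (simp add: x_def)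
  moreover have "components c (N p) = n x"
    using n(1)[of x] W(2) xT(1) px by (simp add: x_def)
  ultimately have cov: "covariant_derivative A g c S N p (coord_vector A c p u) =
      coord_vector A c p (n' u + christoffel A g c x u (n x))"
    unfolding covariant_derivative_def
    by (simp add: components_coord_vector[OF A(1,3) p(2)] x_def)
  have "second_form A g c S N p (coord_vector A c p u) (coord_vector A c p w) =
      ?G x (- (n' u + christoffel A g c x u (n x))) w"
    unfolding second_form_def cov coord_vector_minus[OF A(1,3) p(2)]
    using metric_coord_vector[OF c p(2)] by (simp add: x_def)
  also have "\<dots> = - (?G x (n' u) w + koszul ?G x u (n x) w)"
    unfolding christoffel_koszul[OF A xT(2), symmetric]
    using linear_neg[OF metric_family_linear(2)[OF G xT(2), of w], of "n' u + christoffel A g c x u (n x)"]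
      linear_add[OF metric_family_linear(2)[OF G xT(2), of w], of "n' u" "christoffel A g c x u (n x)"]
    by simp
  finally show ?thesis unfolding x_def .
qed

text \<open>Normalising factors need not be differentiated: the derivative of \<open>f\<close>
  multiplies \<open>m\<close>, which is orthogonal to \<open>w\<close>. So any convenient normal
  direction \<open>m\<close> may replace the unit normal.\<close>

lemma second_form_scaled:
  assumes A: "smooth_atlas A" "riemannian_metric A g" "c \<in> A" and p: "p \<in> S" "p \<in> cdom c"
    and W: "open W" "cmap c p \<in> W"
    and n: "\<And>y. y \<in> W \<Longrightarrow> y \<in> cmap c ` (S \<inter> cdom c) \<Longrightarrow> components c (N (cinv c y)) = f y *\<^sub>R m y"
    and f: "f differentiable at (cmap c p)" and m: "(m has_derivative m') (at (cmap c p))"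
    and u: "coord_vector A c p u \<in> tangent_space A S p"
    and w: "metric_coord A g c (cmap c p) (m (cmap c p)) w = 0"
  shows "second_form A g c S N p (coord_vector A c p u) (coord_vector A c p w) =
    - (f (cmap c p) * (metric_coord A g c (cmap c p) (m' u) w
      + koszul (metric_coord A g c) (cmap c p) u (m (cmap c p)) w))"
proof -
  let ?x = "cmap c p" and ?G = "metric_coord A g c"
  note G = metric_family_coord[OF A]
  have x: "?x \<in> cmap c ` cdom c" using p by simp
  have "((\<lambda>y. f y *\<^sub>R m y) has_derivative (\<lambda>h. f ?x *\<^sub>R m' h + frechet_derivative f (at ?x) h *\<^sub>R m ?x)) (at ?x)"
    by (intro has_derivative_scaleR m f[unfolded frechet_derivative_works])
  from second_form_coord[OF A p W n this u, of w]
  show ?thesis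
    using linear_cmul[OF metric_family_linear(2)[OF G x]] linear_add[OF metric_family_linear(2)[OF G x]]
      linear_cmul[OF koszul_linear(2)[OF G x]] w
    by (simp add: algebra_simps)
qed

text \<open>The vertical part of the product metric is constant and the horizontal part is
  independent of the height, so only horizontal components survive.\<close>

lemma frechet_derivative_prod_metric:
  fixes A :: "('a::topological_space, 'e::euclidean_space) chart set"
  assumes A: "smooth_atlas A" "riemannian_metric A g" "c \<in> A" and x: "x \<in> cmap c ` cdom c"
  shows "frechet_derivative (\<lambda>z. metric_coord (prod_atlas A) (prod_metric g) (prod_chart c) z u v) (at (x, t)) h =
    frechet_derivative (\<lambda>y. metric_coord A g c y (fst u) (fst v)) (at x) (fst h)"
proof -
  let ?G = "metric_coord A g c" and ?X = "cmap c ` cdom c"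
  note G = metric_family_coord[OF A]
  have o: "open (?X \<times> (UNIV :: real set))" "(x, t) \<in> ?X \<times> UNIV"
    using metric_family_open[OF G] x by (auto simp: open_Times)
  have "(fst has_derivative fst) (at (x, t))" by (auto intro!: derivative_eq_intros)
  from has_derivative_compose[OF this, of "\<lambda>y. ?G y (fst u) (fst v)"] metric_family_diff[OF G x, of "fst u" "fst v"]
  have "((\<lambda>z. ?G (fst z) (fst u) (fst v)) has_derivative
      (\<lambda>h. frechet_derivative (\<lambda>y. ?G y (fst u) (fst v)) (at x) (fst h))) (at (x, t))"
    by (simp add: frechet_derivative_works)
  then have "((\<lambda>z. ?G (fst z) (fst u) (fst v) + snd u * snd v) has_derivative
      (\<lambda>h. frechet_derivative (\<lambda>y. ?G y (fst u) (fst v)) (at x) (fst h))) (at (x, t))"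
    by (auto intro!: derivative_eq_intros)
  then have "((\<lambda>z. metric_coord (prod_atlas A) (prod_metric g) (prod_chart c) z u v) has_derivative
      (\<lambda>h. frechet_derivative (\<lambda>y. ?G y (fst u) (fst v)) (at x) (fst h))) (at (x, t))"
    by (rule has_derivative_transform_within_open[OF _ o]) (simp add: metric_coord_prod[OF A(1,3)] mem_Times_iff)
  from fun_cong[OF frechet_derivative_at[OF this], of h] show ?thesis by simp
qed

lemma koszul_prod:
  fixes A :: "('a::topological_space, 'e::euclidean_space) chart set"
  assumes A: "smooth_atlas A" "riemannian_metric A g" "c \<in> A" and x: "x \<in> cmap c ` cdom c"
  shows "koszul (metric_coord (prod_atlas A) (prod_metric g) (prod_chart c)) (x, t) u v w =
    koszul (metric_coord A g c) x (fst u) (fst v) (fst w)"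
  unfolding koszul_def frechet_derivative_prod_metric[OF assms] by simp

section \<open>Tangent spaces of hypersurfaces\<close>

text \<open>The equation is the vanishing coordinate of a slice chart, read in the given chart
  \<open>c\<close>. Differentiating it along curves in \<open>S\<close> puts tangent vectors into
  the kernel; conversely a kernel vector is the velocity of a straight line lying in the
  slice.\<close>

lemma hypersurface_local_equation:
  fixes A :: "('a::topological_space, 'e::euclidean_space) chart set"
  assumes A: "smooth_atlas A" "c \<in> A" and S: "hypersurface A S" and p: "p \<in> S" "p \<in> cdom c"
  obtains W \<rho> where "open W" "cmap c p \<in> W" "W \<subseteq> cmap c ` cdom c" "smooth_on W (\<rho> :: 'e \<Rightarrow> real)"
    "\<And>x. x \<in> W \<Longrightarrow> cinv c x \<in> S \<longleftrightarrow> \<rho> x = 0"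
    "\<And>x v. x \<in> W \<Longrightarrow> \<rho> x = 0 \<Longrightarrow>
      coord_vector A c (cinv c x) v \<in> tangent_space A S (cinv c x) \<longleftrightarrow> frechet_derivative \<rho> (at x) v = 0"
proof -
  obtain d b where d: "d \<in> maximal_atlas A" "p \<in> cdom d" and b: "b \<in> Basis"
    and Sd: "S \<inter> cdom d = {q \<in> cdom d. cmap d q \<bullet> b = 0}"
    using S p(1) unfolding hypersurface_def by blast
  note c = atlas_chart[OF A]
  have d_chart: "is_chart d" and compat: "smooth_compat d c"
    using d(1) A(2) by (auto simp: maximal_atlas_def)
  let ?\<tau> = "\<lambda>x. cmap d (cinv c x)" and ?\<sigma> = "\<lambda>y. cmap c (cinv d y)"
  define W where "W = cmap c ` (cdom d \<inter> cdom c)"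
  define W' where "W' = cmap d ` (cdom d \<inter> cdom c)"
  have W: "open W" "open W'"
    using open_chart_image[OF c chart_open_dom[OF d_chart]] open_chart_image[OF d_chart chart_open_dom[OF c]]
    by (simp_all add: W_def W'_def Int_commute)
  have \<tau>: "smooth_on W ?\<tau>" and \<sigma>: "smooth_on W' ?\<sigma>"
    using transition_smooth'[OF compat] transition_smooth[OF compat] by (simp_all add: W_def W'_def)
  have \<tau>W: "?\<tau> x \<in> W' \<and> ?\<sigma> (?\<tau> x) = x \<and> cinv c x \<in> cdom d \<and> cinv c x \<in> cdom c \<and> cmap c (cinv c x) = x"
    if "x \<in> W" for x
    using that chart_inv[OF c] chart_inv[OF d_chart] by (auto simp: W_def W'_def)
  have \<sigma>W: "?\<sigma> y \<in> W \<and> ?\<tau> (?\<sigma> y) = y \<and> cinv d y \<in> cdom d \<and> cinv d y \<in> cdom c \<and> cmap d (cinv d y) = y"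
    if "y \<in> W'" for y
    using that chart_inv[OF c] chart_inv[OF d_chart] by (auto simp: W_def W'_def)
  let ?D\<tau> = "\<lambda>x. frechet_derivative ?\<tau> (at x)" and ?D\<sigma> = "\<lambda>x. frechet_derivative ?\<sigma> (at (?\<tau> x))"
  \<comment> \<open>Hence a line in the direction \<open>?D\<tau> x v\<close> of the slice chart
    comes back with velocity \<open>v\<close>.\<close>
  have inv1: "?D\<sigma> x (?D\<tau> x v) = v" if x: "x \<in> W" for x v
  proof -
    have "((\<lambda>y. ?\<sigma> (?\<tau> y)) has_derivative (\<lambda>v. ?D\<sigma> x (?D\<tau> x v))) (at x)"
      by (rule has_derivative_compose[OF smooth_on_has_derivative[OF \<tau> x] smooth_on_has_derivative[OF \<sigma>]])
        (use \<tau>W[OF x] in blast)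
    then have "((\<lambda>y. y) has_derivative (\<lambda>v. ?D\<sigma> x (?D\<tau> x v))) (at x)"
      by (rule has_derivative_transform_within_open[OF _ W(1) x]) (use \<tau>W in blast)
    from fun_cong[OF has_derivative_unique[OF this has_derivative_ident], of v] show ?thesis by simp
  qed
  define \<rho> where "\<rho> x = ?\<tau> x \<bullet> b" for x
  have \<rho>: "smooth_on W \<rho>" unfolding \<rho>_def by (intro smooth_on_inner W \<tau> smooth_on_const)
  have D\<rho>: "frechet_derivative \<rho> (at x) v = ?D\<tau> x v \<bullet> b" if "x \<in> W" for x v
  proof -
    have "(\<rho> has_derivative (\<lambda>v. ?D\<tau> x v \<bullet> b)) (at x)"
      unfolding \<rho>_def by (rule has_derivative_inner_left[OF smooth_on_has_derivative[OF \<tau> that]])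
    from fun_cong[OF frechet_derivative_at[OF this], of v] show ?thesis by simp
  qed
  have S_iff: "cinv c x \<in> S \<longleftrightarrow> \<rho> x = 0" if "x \<in> W" for x
    using \<tau>W[OF that] Sd unfolding \<rho>_def by blast
  have tang: "coord_vector A c (cinv c x) v \<in> tangent_space A S (cinv c x) \<longleftrightarrow> frechet_derivative \<rho> (at x) v = 0"
    if x: "x \<in> W" and x0: "\<rho> x = 0" for x v
  proof
    note xc = \<tau>W[OF x]
    have xc': "cinv c x \<in> cdom c" using xc by blast
    assume T: "coord_vector A c (cinv c x) v \<in> tangent_space A S (cinv c x)"
    obtain \<gamma> I v' where \<gamma>: "open I" "0 \<in> I" "\<gamma> 0 = cmap c (cinv c x)" "\<gamma> ` I \<subseteq> cmap c ` (S \<inter> cdom c)"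
      "(\<gamma> has_vector_derivative v') (at 0)" "coord_vector A c (cinv c x) v = coord_vector A c (cinv c x) v'"
      by (rule tangent_space_curve[OF A xc' T], rule that, assumption+)
    have v': "v' = v"
      using arg_cong[OF \<gamma>(6), of "components c"] unfolding components_coord_vector[OF A xc'] by (rule sym)
    have \<gamma>0: "\<gamma> 0 = x" using \<gamma>(3) xc by simp
    have "isCont \<gamma> 0" using \<gamma>(5) has_vector_derivative_continuous by blast
    then have "(\<gamma> \<longlongrightarrow> x) (at 0)" using \<gamma>0 by (simp add: isCont_def)
    then have ev: "\<forall>\<^sub>F t in at 0. \<gamma> t \<in> W" using W(1) x by (rule topological_tendstoD)
    have evI: "\<forall>\<^sub>F t in at 0. t \<in> I" using eventually_at_in_open'[OF \<gamma>(1,2)] .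
    have zero: "\<rho> (\<gamma> t) = 0" if tI: "t \<in> I" "\<gamma> t \<in> W" for t
    proof -
      obtain q where "q \<in> S" "q \<in> cdom c" "\<gamma> t = cmap c q" using \<gamma>(4) tI(1) by blast
      then show ?thesis using S_iff[OF tI(2)] chart_inv[OF c] by simp
    qed
    have "(\<rho> has_derivative frechet_derivative \<rho> (at x)) (at (\<gamma> 0))"
      unfolding \<gamma>0 by (rule smooth_on_has_derivative[OF \<rho> x])
    from vector_derivative_diff_chain_within[OF \<gamma>(5) has_derivative_at_withinI[OF this]]
    have "(\<rho> \<circ> \<gamma> has_derivative (\<lambda>s. s *\<^sub>R frechet_derivative \<rho> (at x) v)) (at 0)"
      by (simp only: has_vector_derivative_def v')
    then have "((\<lambda>t. 0) has_derivative (\<lambda>s. s *\<^sub>R frechet_derivative \<rho> (at x) v)) (at 0)"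
    proof (rule has_derivative_transform_eventually)
      show "\<forall>\<^sub>F t in at 0. (\<rho> \<circ> \<gamma>) t = 0" using ev evI by eventually_elim (simp add: zero)
      show "(\<rho> \<circ> \<gamma>) 0 = 0" using x0 \<gamma>0 by simp
    qed simp
    from fun_cong[OF has_derivative_unique[OF this has_derivative_const], of 1]
    show "frechet_derivative \<rho> (at x) v = 0" by simp
  next
    note xc = \<tau>W[OF x]
    assume Dv: "frechet_derivative \<rho> (at x) v = 0"
    let ?l = "\<lambda>s::real. ?\<tau> x + s *\<^sub>R ?D\<tau> x v"
    have "open (?l -` W')" "0 \<in> ?l -` W'" using xc by (auto intro!: open_vimage[OF W(2)] continuous_intros)
    then obtain \<epsilon> where \<epsilon>: "\<epsilon> > 0" "ball 0 \<epsilon> \<subseteq> ?l -` W'" using openE by blast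
    have lW: "?l s \<in> W'" if "s \<in> {-\<epsilon><..<\<epsilon>}" for s using \<epsilon>(2) that by (auto simp: subset_iff dist_real_def)
    show "coord_vector A c (cinv c x) v \<in> tangent_space A S (cinv c x)"
    proof (rule tangent_space_curveI[OF A \<epsilon>(1), of "\<lambda>s. ?\<sigma> (?l s)"])
      show "smooth_on {-\<epsilon><..<\<epsilon>} (\<lambda>s. ?\<sigma> (?l s))"
        by (rule smooth_on_compose[OF open_greaterThanLessThan W(2) \<sigma>])
          (use lW in \<open>auto intro!: smooth_on_add smooth_on_const smooth_on_scaleR smooth_on_id\<close>)
      show "(\<lambda>s. ?\<sigma> (?l s)) ` {-\<epsilon><..<\<epsilon>} \<subseteq> cmap c ` (S \<inter> cdom c)"
      proof (rule image_subsetI)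
        fix s assume s: "s \<in> {-\<epsilon><..<\<epsilon>}"
        note y = \<sigma>W[OF lW[OF s]]
        have "?l s \<bullet> b = 0" using x0 Dv D\<rho>[OF x] by (simp add: \<rho>_def inner_add_left)
        then have "cinv d (?l s) \<in> {q \<in> cdom d. cmap d q \<bullet> b = 0}" using y by simp
        then have "cinv d (?l s) \<in> S" unfolding Sd[symmetric] by blast
        then show "?\<sigma> (?l s) \<in> cmap c ` (S \<inter> cdom c)" using y by blast
      qed
      show "?\<sigma> (?l 0) = cmap c (cinv c x)" using xc by simp
      have l: "(?l has_vector_derivative ?D\<tau> x v) (at 0)" by (auto intro!: derivative_eq_intros)
      have s: "(?\<sigma> has_derivative ?D\<sigma> x) (at (?l 0))"
        using smooth_on_has_derivative[OF \<sigma>, of "?\<tau> x"] xc by simp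
      from vector_derivative_diff_chain_within[OF l has_derivative_at_withinI[OF s]]
      show "((\<lambda>s. ?\<sigma> (?l s)) has_vector_derivative v) (at 0)" by (simp add: inv1[OF x] o_def)
      show "cinv c x \<in> cdom c" using xc by blast
    qed
  qed
  show thesis
  proof (rule that[OF W(1) _ _ \<rho> S_iff tang])
    show "cmap c p \<in> W" using d(2) p(2) by (auto simp: W_def)
    show "W \<subseteq> cmap c ` cdom c" by (auto simp: W_def)
  qed
qed

section \<open>A vertical helicoid as a graph\<close>

lemma vertical_field_coord:
  fixes A :: "('a::topological_space, 'e::euclidean_space) chart set"
  assumes A: "smooth_atlas A" "c \<in> A" and p: "p \<in> cdom c"
  shows "vertical_field A (p, t) = coord_vector (prod_atlas A) (prod_chart c) (p, t) (0, 1)"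
proof -
  have "((\<lambda>s. (cmap c p, t + s)) has_vector_derivative (0, 1)) (at 0)"
    by (auto intro!: derivative_eq_intros has_vector_derivative_Pair)
  then have "velocity (prod_atlas A) (\<lambda>s. (p, t + s)) =
      coord_vector (prod_atlas A) (prod_chart c) (p, t + 0) (0, 1)"
    by (intro velocity_coord_vector[OF smooth_atlas_prod[OF A(1)] prod_chart_in[OF A(2)] open_UNIV]) (use p in auto)
  then show ?thesis by (simp add: vertical_field_def)
qed

text \<open>In a product chart the metric is a horizontal plus a vertical part, so pairing the
  normal with the vertical field just reads off its last component. Unit length and orthogonality
  split in the same way.\<close>

lemma helicoid_normal:
  fixes A :: "('a::topological_space, 'e::euclidean_space) chart set"
  assumes A: "smooth_atlas A" "riemannian_metric A g" "c \<in> A"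
    and N: "unit_normal (prod_atlas A) (prod_metric g) \<Sigma> N" and p: "(p, t) \<in> \<Sigma>" "p \<in> cdom c"
  defines "n \<equiv> components (prod_chart c) (N (p, t))"
  shows "angle A g N (p, t) = snd n"
    and "metric_coord A g c (cmap c p) (fst n) (fst n) + (snd n)\<^sup>2 = 1"
    and "coord_vector (prod_atlas A) (prod_chart c) (p, t) v \<in> tangent_space (prod_atlas A) \<Sigma> (p, t) \<Longrightarrow>
      metric_coord A g c (cmap c p) (fst n) (fst v) + snd n * snd v = 0"
proof -
  let ?B = "prod_atlas A" and ?c = "prod_chart c" and ?h = "prod_metric g"
  note c = atlas_chart[OF A(1,3)]
  note B = smooth_atlas_prod[OF A(1)] prod_chart_in[OF A(3)]
  have p': "(p, t) \<in> cdom ?c" using p by simp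
  have "N (p, t) \<in> tangent_space ?B UNIV (p, t)" using N p by (simp add: unit_normal_def)
  then obtain m where m: "N (p, t) = coord_vector ?B ?c (p, t) m"
    unfolding tangent_space_UNIV[OF B p'] by blast
  have Nn: "N (p, t) = coord_vector ?B ?c (p, t) n"
    unfolding n_def m components_coord_vector[OF B p'] ..
  have met: "?h (p, t) (coord_vector ?B ?c (p, t) u) (coord_vector ?B ?c (p, t) v) =
      metric_coord A g c (cmap c p) (fst u) (fst v) + snd u * snd v" for u v
    using metric_coord_vector[OF atlas_chart[OF B] p', of ?h ?B u v] metric_coord_prod[OF A(1,3), of "(cmap c p, t)" g u v] p(2)
    by simp
  have lin: "linear (metric_coord A g c (cmap c p) (fst n))"
    using metric_family_linear(1)[OF metric_family_coord[OF A]] p(2) by blast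
  show "angle A g N (p, t) = snd n"
    unfolding angle_def Nn vertical_field_coord[OF A(1,3) p(2)] met by (simp add: linear_0[OF lin])
  show "metric_coord A g c (cmap c p) (fst n) (fst n) + (snd n)\<^sup>2 = 1"
  proof -
    have "?h (p, t) (N (p, t)) (N (p, t)) = 1" using N p(1) unfolding unit_normal_def by blast
    then show ?thesis unfolding Nn met by (simp add: power2_eq_square)
  qed
  show "metric_coord A g c (cmap c p) (fst n) (fst v) + snd n * snd v = 0"
    if v: "coord_vector ?B ?c (p, t) v \<in> tangent_space ?B \<Sigma> (p, t)"
  proof -
    have "?h (p, t) (N (p, t)) (coord_vector ?B ?c (p, t) v) = 0"
      using N p(1) v unfolding unit_normal_def by blast
    then show ?thesis unfolding Nn met .
  qed
qed

text \<open>If all horizontal directions were tangent, the normal would be vertical.\<close>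

lemma helicoid_not_horizontal:
  fixes A :: "('a::topological_space, 'e::euclidean_space) chart set"
  assumes A: "smooth_atlas A" "riemannian_metric A g" "c \<in> A"
    and N: "unit_normal (prod_atlas A) (prod_metric g) \<Sigma> N" and p: "(p, t) \<in> \<Sigma>" "p \<in> cdom c"
    and angle: "(angle A g N (p, t))\<^sup>2 \<noteq> 1"
  obtains v where
    "coord_vector (prod_atlas A) (prod_chart c) (p, t) (v, 0) \<notin> tangent_space (prod_atlas A) \<Sigma> (p, t)"
proof -
  define n where "n = components (prod_chart c) (N (p, t))"
  note n = helicoid_normal[OF A N p, folded n_def]
  have x: "cmap c p \<in> cmap c ` cdom c" using p by simp
  note form = metric_family_form[OF metric_family_coord[OF A] x]
  have "fst n \<noteq> 0"
    using n(1,2) angle linear_0[OF inner_form_linear(1)[OF form]] linear_0[OF inner_form_linear(2)[OF form]]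
    by auto
  then have "metric_coord A g c (cmap c p) (fst n) (fst n) \<noteq> 0"
    using form by (fastforce simp: inner_form_def)
  then have "coord_vector (prod_atlas A) (prod_chart c) (p, t) (fst n, 0) \<notin> tangent_space (prod_atlas A) \<Sigma> (p, t)"
    using n(3)[of "(fst n, 0)"] by auto
  then show thesis by (rule that)
qed

text \<open>The tangent space of \<open>\<Sigma>\<close> is a hyperplane, and some horizontal vector
  is not in it; so hyperplane and horizontal vectors together span everything.\<close>

lemma helicoid_transversal:
  fixes A :: "('a::topological_space, 'e::euclidean_space) chart set"
  assumes A: "smooth_atlas A" "riemannian_metric A g"
    and N: "unit_normal (prod_atlas A) (prod_metric g) \<Sigma> N" and S: "hypersurface (prod_atlas A) \<Sigma>"
    and angle: "\<forall>x\<in>\<Sigma>. (angle A g N x)\<^sup>2 \<noteq> 1"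
  shows "transversal_at A \<Sigma> t"
  unfolding transversal_def
proof (rule ballI)
  let ?B = "prod_atlas A"
  fix z assume "z \<in> \<Sigma> \<inter> UNIV \<times> {t}"
  then obtain p where z: "z = (p, t)" "(p, t) \<in> \<Sigma>" by auto
  obtain c where c: "c \<in> A" "p \<in> cdom c" using atlas_cover[OF A(1)] by blast
  let ?c = "prod_chart c" and ?X = "coord_vector (prod_atlas A) (prod_chart c) (p, t)"
  note chart = atlas_chart[OF A(1) c(1)]
  note B = smooth_atlas_prod[OF A(1)] prod_chart_in[OF c(1)]
  have p': "(p, t) \<in> cdom ?c" using c by simp
  have cinv: "cinv ?c (cmap c p, t) = (p, t)" using c(2) by (simp add: prod_chart_inv[OF chart] chart_inv[OF chart])
  obtain W \<rho> where W: "open W" "cmap ?c (p, t) \<in> W" "smooth_on W (\<rho> :: 'e \<times> real \<Rightarrow> real)"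
    "\<And>x. x \<in> W \<Longrightarrow> cinv ?c x \<in> \<Sigma> \<longleftrightarrow> \<rho> x = 0"
    "\<And>x v. x \<in> W \<Longrightarrow> \<rho> x = 0 \<Longrightarrow>
      coord_vector ?B ?c (cinv ?c x) v \<in> tangent_space ?B \<Sigma> (cinv ?c x) \<longleftrightarrow> frechet_derivative \<rho> (at x) v = 0"
    by (rule hypersurface_local_equation[OF B S z(2) p'], rule that, assumption+)
  have xW: "(cmap c p, t) \<in> W" using W(2) by simp
  have "\<rho> (cmap c p, t) = 0" using W(4)[OF xW] cinv z(2) by simp
  define L where "L = frechet_derivative \<rho> (at (cmap c p, t))"
  have L: "?X v \<in> tangent_space ?B \<Sigma> (p, t) \<longleftrightarrow> L v = 0" for v
    using W(5)[OF xW \<open>\<rho> (cmap c p, t) = 0\<close>, of v] by (simp add: cinv L_def)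
  have lin: "linear L" unfolding L_def by (rule smooth_on_linear_frechet[OF W(3) xW])
  obtain w where w: "L (w, 0) \<noteq> 0"
    using helicoid_not_horizontal[OF A c(1) N z(2) c(2)] angle z(2) L by blast
  have hor: "?X (v, 0) \<in> tangent_space ?B (UNIV \<times> {t}) (p, t)" for v
  proof -
    let ?l = "\<lambda>s::real. cmap c p + s *\<^sub>R v"
    have "open (?l -` (cmap c ` cdom c))" "0 \<in> ?l -` (cmap c ` cdom c)"
      using c(2) by (auto intro!: open_vimage[OF chart_open[OF chart]] continuous_intros)
    then obtain \<epsilon> where \<epsilon>: "\<epsilon> > 0" "ball 0 \<epsilon> \<subseteq> ?l -` (cmap c ` cdom c)" using openE by blast
    have l: "?l s \<in> cmap c ` cdom c" if "s \<in> {-\<epsilon><..<\<epsilon>}" for s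
      using \<epsilon>(2) that by (auto simp: subset_iff dist_real_def)
    show ?thesis
    proof (rule tangent_space_curveI[OF B \<epsilon>(1), of "\<lambda>s. (?l s, t)"])
      show "smooth_on {-\<epsilon><..<\<epsilon>} (\<lambda>s. (?l s, t))"
        by (intro smooth_on_Pair smooth_on_add smooth_on_const smooth_on_scaleR smooth_on_id open_greaterThanLessThan)
      show "(\<lambda>s. (?l s, t)) ` {-\<epsilon><..<\<epsilon>} \<subseteq> cmap ?c ` (UNIV \<times> {t} \<inter> cdom ?c)"
      proof (rule image_subsetI)
        fix s assume "s \<in> {-\<epsilon><..<\<epsilon>}"
        from l[OF this] obtain q where "q \<in> cdom c" "?l s = cmap c q" by blast
        then show "(?l s, t) \<in> cmap ?c ` (UNIV \<times> {t} \<inter> cdom ?c)" by (intro image_eqI[of _ _ "(q, t)"]) auto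
      qed
      show "((\<lambda>s. (?l s, t)) has_vector_derivative (v, 0)) (at 0)"
        by (auto intro!: derivative_eq_intros has_vector_derivative_Pair)
    qed (use p' in auto)
  qed
  show "{(\<lambda>f. X f + Y f) | X Y. X \<in> tangent_space ?B \<Sigma> z \<and> Y \<in> tangent_space ?B (UNIV \<times> {t}) z} = tangent_space ?B UNIV z"
    unfolding z(1)
  proof (intro equalityI subsetI)
    fix Z assume "Z \<in> {(\<lambda>f. X f + Y f) | X Y. X \<in> tangent_space ?B \<Sigma> (p, t) \<and> Y \<in> tangent_space ?B (UNIV \<times> {t}) (p, t)}"
    then obtain X Y where Z: "Z = (\<lambda>f. X f + Y f)" "X \<in> tangent_space ?B \<Sigma> (p, t)"
      "Y \<in> tangent_space ?B (UNIV \<times> {t}) (p, t)" by blast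
    have "X \<in> range ?X" "Y \<in> range ?X"
      unfolding tangent_space_UNIV[OF B p', symmetric]
      by (rule subsetD[OF tangent_space_mono[OF subset_UNIV] Z(2)])
        (rule subsetD[OF tangent_space_mono[OF subset_UNIV] Z(3)])
    then obtain v w where "X = ?X v" "Y = ?X w" by blast
    then show "Z \<in> tangent_space ?B UNIV (p, t)"
      unfolding Z(1) tangent_space_UNIV[OF B p'] by (simp add: coord_vector_add[OF B p'])
  next
    fix Z assume "Z \<in> tangent_space ?B UNIV (p, t)"
    then obtain v a where Z: "Z = ?X (v, a)" unfolding tangent_space_UNIV[OF B p'] by auto
    \<comment> \<open>Chosen to make \<open>(k *\<^sub>R w, a)\<close> tangent to
      \<open>\<Sigma>\<close>; the remainder of \<open>Z\<close> is then horizontal.\<close>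
    define k where "k = - L (0, a) / L (w, 0)"
    have "L (k *\<^sub>R w, a) = k * L (w, 0) + L (0, a)"
      using linear_add[OF lin, of "(k *\<^sub>R w, 0)" "(0, a)"] linear_cmul[OF lin, of k "(w, 0)"] by simp
    then have "?X (k *\<^sub>R w, a) \<in> tangent_space ?B \<Sigma> (p, t)" using w by (simp add: L k_def)
    moreover have "Z = (\<lambda>f. ?X (k *\<^sub>R w, a) f + ?X (v - k *\<^sub>R w, 0) f)"
      unfolding Z coord_vector_add[OF B p'] by simp
    ultimately show "Z \<in> {(\<lambda>f. X f + Y f) | X Y. X \<in> tangent_space ?B \<Sigma> (p, t) \<and> Y \<in> tangent_space ?B (UNIV \<times> {t}) (p, t)}"
      using hor by blast
  qed
qed

text \<open>The two angle conditions have separate tasks: a nonzero angle keeps the vertical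
  direction out of the tangent space, so that the height is a function \<open>u\<close> of the base
  point, and an angle other than \<open>\<plusminus>1\<close> excludes critical points of
  \<open>u\<close>.\<close>

lemma helicoid_graph:
  fixes A :: "('a::topological_space, 'e::euclidean_space) chart set"
  assumes A: "smooth_atlas A" "riemannian_metric A g" "c \<in> A"
    and N: "unit_normal (prod_atlas A) (prod_metric g) \<Sigma> N" and S: "hypersurface (prod_atlas A) \<Sigma>"
    and angle: "\<forall>x\<in>\<Sigma>. (angle A g N x)\<^sup>2 \<noteq> 1" "\<forall>x\<in>\<Sigma>. angle A g N x \<noteq> 0"
    and p0: "(p0, t0) \<in> \<Sigma>" "p0 \<in> cdom c"
  obtains V \<delta> u where "open V" "cmap c p0 \<in> V" "V \<subseteq> cmap c ` cdom c" "\<delta> > 0"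
    "smooth_on V u" "u (cmap c p0) = t0" "\<And>x. x \<in> V \<Longrightarrow> u x \<in> {t0 - \<delta><..<t0 + \<delta>}"
    "\<And>x t. x \<in> V \<Longrightarrow> t \<in> {t0 - \<delta><..<t0 + \<delta>} \<Longrightarrow> (cinv c x, t) \<in> \<Sigma> \<longleftrightarrow> t = u x"
    "\<And>x. x \<in> V \<Longrightarrow> \<exists>v. frechet_derivative u (at x) v \<noteq> 0"
    "\<And>x v a. x \<in> V \<Longrightarrow> coord_vector (prod_atlas A) (prod_chart c) (cinv c x, u x) (v, a)
        \<in> tangent_space (prod_atlas A) \<Sigma> (cinv c x, u x) \<longleftrightarrow> a = frechet_derivative u (at x) v"
proof -
  let ?B = "prod_atlas A" and ?c = "prod_chart c"
  note c = atlas_chart[OF A(1,3)]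
  note B = smooth_atlas_prod[OF A(1)] prod_chart_in[OF A(3)]
  let ?X = "\<lambda>z. coord_vector (prod_atlas A) (prod_chart c) z" and ?T = "tangent_space (prod_atlas A) \<Sigma>"
  have p0': "(p0, t0) \<in> cdom ?c" using p0 by simp
  obtain W \<rho> where W: "open W" "cmap ?c (p0, t0) \<in> W" "W \<subseteq> cmap ?c ` cdom ?c" "smooth_on W (\<rho> :: 'e \<times> real \<Rightarrow> real)"
    "\<And>x. x \<in> W \<Longrightarrow> cinv ?c x \<in> \<Sigma> \<longleftrightarrow> \<rho> x = 0"
    "\<And>x v. x \<in> W \<Longrightarrow> \<rho> x = 0 \<Longrightarrow> ?X (cinv ?c x) v \<in> ?T (cinv ?c x) \<longleftrightarrow> frechet_derivative \<rho> (at x) v = 0"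
    by (rule hypersurface_local_equation[OF B S p0(1) p0'], rule that, assumption+)
  have W_dom: "x \<in> cmap c ` cdom c" if "(x, t) \<in> W" for x t
    using W(3) that by (auto simp: prod_chart_image)
  have W_inv: "cinv ?c (x, t) = (cinv c x, t)" if "(x, t) \<in> W" for x t
    by (rule prod_chart_inv[OF c W_dom[OF that]])
  have W_\<Sigma>: "(cinv c x, t) \<in> \<Sigma> \<longleftrightarrow> \<rho> (x, t) = 0" if "(x, t) \<in> W" for x t
    using W(5)[OF that] W_inv[OF that] by simp
  have W_T: "?X (cinv c x, t) v \<in> ?T (cinv c x, t) \<longleftrightarrow> frechet_derivative \<rho> (at (x, t)) v = 0"
    if "(x, t) \<in> W" "\<rho> (x, t) = 0" for x t v
    using W(6)[OF that] W_inv[OF that(1)] by simp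
  \<comment> \<open>Otherwise the vertical vector would be tangent and the angle zero.\<close>
  have Dt: "frechet_derivative \<rho> (at (x, t)) (0, 1) \<noteq> 0" if xt: "(x, t) \<in> W" "\<rho> (x, t) = 0" for x t
  proof
    note x = W_dom[OF xt(1)]
    have q: "(cinv c x, t) \<in> \<Sigma>" "cinv c x \<in> cdom c" using W_\<Sigma>[OF xt(1)] xt(2) chart_inv_in[OF c x] by auto
    have lin: "linear (metric_coord A g c (cmap c (cinv c x)) v)" for v
      using metric_family_linear(1)[OF metric_family_coord[OF A]] q(2) by blast
    assume "frechet_derivative \<rho> (at (x, t)) (0, 1) = 0"
    then have "?X (cinv c x, t) (0, 1) \<in> ?T (cinv c x, t)" using W_T[OF xt] by simp
    from helicoid_normal(3)[OF A N q this] helicoid_normal(1)[OF A N q]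
    have "angle A g N (cinv c x, t) = 0" by (simp add: linear_0[OF lin])
    then show False using angle(2) q(1) by blast
  qed
  define x0 where "x0 = cmap c p0"
  have x0: "(x0, t0) \<in> W" using W(2) by (simp add: x0_def)
  have \<rho>0: "\<rho> (x0, t0) = 0" using W_\<Sigma>[OF x0] p0 chart_inv[OF c] by (simp add: x0_def)
  obtain V \<delta> u where V: "open V" "x0 \<in> V" "\<delta> > 0" "V \<times> {t0 - \<delta><..<t0 + \<delta>} \<subseteq> W" "smooth_on V u" "u x0 = t0"
    and u: "\<And>x. x \<in> V \<Longrightarrow> u x \<in> {t0 - \<delta><..<t0 + \<delta>}"
    "\<And>x t. x \<in> V \<Longrightarrow> t \<in> {t0 - \<delta><..<t0 + \<delta>} \<Longrightarrow> \<rho> (x, t) = 0 \<longleftrightarrow> t = u x"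
    by (rule implicit_function_scalar[OF W(1,4) x0 \<rho>0 Dt[OF x0 \<rho>0]], rule that, assumption+)
  have uW: "(x, u x) \<in> W" if "x \<in> V" for x using V(4) u(1)[OF that] that by blast
  have u0: "\<rho> (x, u x) = 0" if "x \<in> V" for x using u(2)[OF that u(1)[OF that]] by simp
  \<comment> \<open>Differentiating \<open>\<rho> (y, u y) = 0\<close> puts the graph of
    \<open>du\<close> into the kernel of \<open>?D\<close>. As \<open>(0, 1)\<close> is not in the
    kernel, the kernel contains nothing else.\<close>
  have T: "?X (cinv c x, u x) (v, a) \<in> ?T (cinv c x, u x) \<longleftrightarrow> a = frechet_derivative u (at x) v"
    if x: "x \<in> V" for x v a
  proof -
    let ?D = "frechet_derivative \<rho> (at (x, u x))" and ?Du = "frechet_derivative u (at x)"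
    have lin: "linear ?D" by (rule smooth_on_linear_frechet[OF W(4) uW[OF x]])
    have "((\<lambda>y. (y, u y)) has_derivative (\<lambda>v. (v, ?Du v))) (at x)"
      by (intro has_derivative_Pair has_derivative_ident smooth_on_has_derivative[OF V(5) x])
    from has_derivative_compose[OF this smooth_on_has_derivative[OF W(4) uW[OF x]]]
    have "((\<lambda>y. 0) has_derivative (\<lambda>v. ?D (v, ?Du v))) (at x)"
      by (rule has_derivative_transform_within_open[OF _ V(1) x]) (simp add: u0)
    from fun_cong[OF has_derivative_unique[OF this has_derivative_const], of v]
    have "?D (v, ?Du v) = 0" .
    moreover have "?D (v, a) = ?D (v, ?Du v) + (a - ?Du v) * ?D (0, 1)"
      using linear_add[OF lin, of "(v, ?Du v)" "(0, a - ?Du v)"] linear_cmul[OF lin, of "a - ?Du v" "(0, 1)"] by simp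
    ultimately show ?thesis
      unfolding W_T[OF uW[OF x] u0[OF x]] using Dt[OF uW[OF x] u0[OF x]] by auto
  qed
  have Du: "\<exists>v. frechet_derivative u (at x) v \<noteq> 0" if x: "x \<in> V" for x
  proof -
    have q: "(cinv c x, u x) \<in> \<Sigma>" "cinv c x \<in> cdom c"
      using W_\<Sigma>[OF uW[OF x]] u0[OF x] chart_inv_in[OF c W_dom[OF uW[OF x]]] by auto
    obtain v where "?X (cinv c x, u x) (v, 0) \<notin> ?T (cinv c x, u x)"
      using helicoid_not_horizontal[OF A N q] angle(1) q(1) by blast
    then show ?thesis using T[OF x, of v 0] by auto
  qed
  show thesis
  proof (rule that[OF V(1) V(2)[unfolded x0_def] _ V(3,5) V(6)[unfolded x0_def] u(1) _ Du T])
    show "V \<subseteq> cmap c ` cdom c" using W_dom uW by blast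
    show "(cinv c x, t) \<in> \<Sigma> \<longleftrightarrow> t = u x" if "x \<in> V" "t \<in> {t0 - \<delta><..<t0 + \<delta>}" for x t
      using W_\<Sigma>[of x t] u(2)[OF that] V(4) that by blast
  qed
qed

text \<open>Shortening the time interval of a curve keeps it in the open set; so tangent vectors are
  not lost when unit normals are only given locally.\<close>

lemma tangent_space_Int_open:
  assumes A: "smooth_atlas A" and W: "open W" "p \<in> W" and X: "X \<in> tangent_space A S p"
  shows "X \<in> tangent_space A (S \<inter> W) p"
proof -
  from X obtain \<gamma> d \<epsilon> where \<gamma>: "X = velocity A \<gamma>" "\<gamma> 0 = p" "d \<in> A" "\<epsilon> > 0"
    "\<And>t. t \<in> {-\<epsilon><..<\<epsilon>} \<Longrightarrow> \<gamma> t \<in> S \<inter> cdom d" "smooth_on {-\<epsilon><..<\<epsilon>} (cmap d \<circ> \<gamma>)"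
    unfolding tangent_space_def by blast
  note d = atlas_chart[OF A \<gamma>(3)]
  have "continuous_on {-\<epsilon><..<\<epsilon>} (\<lambda>t. cinv d ((cmap d \<circ> \<gamma>) t))"
    by (rule continuous_on_compose2[OF chart_continuous_inv[OF d] smooth_on_imp_continuous_on[OF \<gamma>(6)]])
      (use \<gamma>(5) in auto)
  then have "continuous_on {-\<epsilon><..<\<epsilon>} \<gamma>"
    by (rule continuous_on_eq) (use \<gamma>(5) chart_inv[OF d] in auto)
  then have "open ({-\<epsilon><..<\<epsilon>} \<inter> \<gamma> -` W)"
    by (rule continuous_open_preimage[OF _ _ W(1)]) simp
  moreover have "0 \<in> {-\<epsilon><..<\<epsilon>} \<inter> \<gamma> -` W" using \<gamma>(2,4) W(2) by simp
  ultimately obtain \<epsilon>' where \<epsilon>': "\<epsilon>' > 0" "ball 0 \<epsilon>' \<subseteq> {-\<epsilon><..<\<epsilon>} \<inter> \<gamma> -` W" using openE by blast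
  then have sub: "{-\<epsilon>'<..<\<epsilon>'} \<subseteq> {-\<epsilon><..<\<epsilon>} \<inter> \<gamma> -` W" by (auto simp: subset_iff dist_real_def)
  have "\<forall>t\<in>{-\<epsilon>'<..<\<epsilon>'}. \<gamma> t \<in> S \<inter> W \<inter> cdom d" using sub \<gamma>(5) by blast
  moreover have "smooth_on {-\<epsilon>'<..<\<epsilon>'} (cmap d \<circ> \<gamma>)" using smooth_on_subset[OF \<gamma>(6)] sub by blast
  ultimately show ?thesis unfolding tangent_space_def using \<gamma>(1-3) \<epsilon>'(1) by blast
qed

section \<open>The gradient of the graph function and its Killing field\<close>

text \<open>The interface between the graph description and the Riemannian computation:
  \<open>u\<close> is the height over the chart, \<open>grad\<close> its gradient with respect to
  the metric of \<open>M\<close>.\<close>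

locale helicoid_chart =
  fixes A :: "('a::topological_space, 'e::euclidean_space) chart set" and g :: "'a metric"
    and c :: "('a, 'e) chart" and \<Sigma> :: "('a \<times> real) set" and V :: "'e set" and \<delta> t0 :: real
    and u :: "'e \<Rightarrow> real" and grad :: "'e \<Rightarrow> 'e"
  assumes A: "smooth_atlas A" "riemannian_metric A g" "c \<in> A"
    and V: "open V" "V \<subseteq> cmap c ` cdom c"
    and u: "smooth_on V u" "\<And>x. x \<in> V \<Longrightarrow> u x \<in> {t0 - \<delta><..<t0 + \<delta>}"
      "\<And>x t. x \<in> V \<Longrightarrow> t \<in> {t0 - \<delta><..<t0 + \<delta>} \<Longrightarrow> (cinv c x, t) \<in> \<Sigma> \<longleftrightarrow> t = u x"
      "\<And>x. x \<in> V \<Longrightarrow> \<exists>v. frechet_derivative u (at x) v \<noteq> 0"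
      "\<And>x v a. x \<in> V \<Longrightarrow> coord_vector (prod_atlas A) (prod_chart c) (cinv c x, u x) (v, a)
        \<in> tangent_space (prod_atlas A) \<Sigma> (cinv c x, u x) \<longleftrightarrow> a = frechet_derivative u (at x) v"
    and grad: "smooth_on V grad"
      "\<And>x w. x \<in> V \<Longrightarrow> metric_coord A g c x (grad x) w = frechet_derivative u (at x) w"
begin

abbreviation "G \<equiv> metric_coord A g c"
abbreviation "Du x \<equiv> frechet_derivative u (at x)"
abbreviation "Dgrad x \<equiv> frechet_derivative grad (at x)"

text \<open>The squared length of the gradient of \<open>u\<close>.\<close>

definition "lam x = Du x (grad x)"
text \<open>The Hessian as \<open>\<langle>\<nabla>\<^sub>v grad u, w\<rangle>\<close>, with the
  connection term given by the lowered Christoffel symbols.\<close>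

definition "hess x v w = G x (Dgrad x v) w + koszul G x v (grad x) w"
text \<open>Scaled so that \<open>Du x (Z x) = 1\<close>.\<close>

definition "Z x = (1 / lam x) *\<^sub>R grad x"

section \<open>The Hessian of \<open>u\<close> and the Killing equation\<close>

lemma metric: "metric_family V G"
proof -
  note G = metric_family_coord[OF A]
  show ?thesis
    unfolding metric_family_def
    using V(1) metric_family_form[OF G subsetD[OF V(2)]] smooth_on_subset[OF metric_family_smooth[OF G] V(2)] by simp
qed

lemmas G_lin = metric_family_linear[OF metric] and G_form = metric_family_form[OF metric]

lemma chart: "is_chart c" by (rule atlas_chart[OF A(1,3)])

lemma V_inv: "x \<in> V \<Longrightarrow> cinv c x \<in> cdom c" "x \<in> V \<Longrightarrow> cmap c (cinv c x) = x"
  using V(2) chart_inv_in[OF chart] chart_map_inv[OF chart] by auto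

lemma Du_lin: "x \<in> V \<Longrightarrow> linear (Du x)"
  by (rule smooth_on_linear_frechet[OF u(1)])

lemma lam_pos:
  assumes x: "x \<in> V"
  shows "lam x > 0"
proof -
  have "grad x \<noteq> 0" using u(4)[OF x] grad(2)[OF x] linear_0[OF G_lin(2)[OF x]] by metis
  then have "G x (grad x) (grad x) > 0" using G_form[OF x] by (simp add: inner_form_def)
  then show ?thesis using grad(2)[OF x] by (simp add: lam_def)
qed

lemma lam_smooth: "smooth_on V lam"
  unfolding lam_def[abs_def]
  by (rule smooth_on_frechet_comp[where g = "\<lambda>x. x", OF V(1) V(1) u(1) smooth_on_id[OF V(1)] _ grad(1)]) simp

lemma Z_smooth: "smooth_on V Z"
  unfolding Z_def[abs_def]
  by (intro smooth_on_scaleR smooth_on_divide smooth_on_const V lam_smooth grad(1) less_imp_neq[OF lam_pos, symmetric])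

lemma Du_Z: "x \<in> V \<Longrightarrow> Du x (Z x) = 1"
  using lam_pos[of x] linear_cmul[OF Du_lin, of x "1 / lam x" "grad x"] by (simp add: Z_def lam_def)

lemma hess_linear:
  assumes x: "x \<in> V"
  shows "linear (hess x v)" "linear (\<lambda>v. hess x v w)"
proof -
  note k = koszul_linear[OF metric x]
  note D = smooth_on_linear_frechet[OF grad(1) x]
  show "linear (hess x v)"
    unfolding hess_def[abs_def]
    by (intro linearI) (simp_all add: linear_add[OF G_lin(1)[OF x]] linear_cmul[OF G_lin(1)[OF x]]
        linear_add[OF k(1)] linear_cmul[OF k(1)] algebra_simps)
  have k1: "linear (\<lambda>v. koszul G x v b w)" for b
  proof -
    note d = metric_family_diff[OF metric x]
    have 1: "linear (frechet_derivative (\<lambda>y. G y b w) (at x))" by (rule linear_frechet_derivative[OF d])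
    have 2: "linear (\<lambda>v. frechet_derivative (\<lambda>y. G y v w) (at x) h)" for w h
      by (rule linear_frechet_family[where B = "\<lambda>y v. G y v w", OF V(1) x G_lin(2) d])
    show ?thesis unfolding koszul_def by (rule linear_real_combination[OF 1 2 2])
  qed
  show "linear (\<lambda>v. hess x v w)"
    unfolding hess_def
    by (intro linearI) (simp_all add: linear_add[OF G_lin(2)[OF x]] linear_cmul[OF G_lin(2)[OF x]]
        linear_add[OF k1] linear_cmul[OF k1] linear_add[OF D] linear_cmul[OF D] algebra_simps)
qed

lemma DG_sym:
  assumes x: "x \<in> V"
  shows "frechet_derivative (\<lambda>y. G y v w) (at x) h = frechet_derivative (\<lambda>y. G y w v) (at x) h"
proof -
  have "((\<lambda>y. G y v w) has_derivative frechet_derivative (\<lambda>y. G y v w) (at x)) (at x)"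
    using metric_family_diff[OF metric x] by (simp only: frechet_derivative_works)
  then have "((\<lambda>y. G y w v) has_derivative frechet_derivative (\<lambda>y. G y v w) (at x)) (at x)"
    by (rule has_derivative_transform_within_open[OF _ V(1) x]) (rule inner_form_sym[OF G_form])
  then show ?thesis by (rule fun_cong[OF frechet_derivative_at])
qed

lemma G_deriv:
  assumes x: "x \<in> V" and a: "(a has_derivative a') (at x)" and b: "(b has_derivative b') (at x)"
  shows "((\<lambda>y. G y (a y) (b y)) has_derivative
    (\<lambda>h. frechet_derivative (\<lambda>y. G y (a x) (b x)) (at x) h + G x (a' h) (b x) + G x (a x) (b' h))) (at x)"
  by (rule bilinear_family_has_derivative[where x = "\<lambda>y. y", OF V(1) x metric_family_bilinear[OF metric]
        metric_family_diff[OF metric x] has_derivative_ident a b])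

text \<open>Differentiating the defining equation of the gradient trades \<open>Dgrad\<close> for
  second derivatives of \<open>u\<close>.\<close>

lemma grad_deriv:
  assumes x: "x \<in> V"
  shows "frechet_derivative (\<lambda>y. G y (grad x) w) (at x) h + G x (Dgrad x h) w
    = frechet_derivative (\<lambda>y. Du y w) (at x) h"
proof -
  have "((\<lambda>y. G y (grad y) w) has_derivative
    (\<lambda>h. frechet_derivative (\<lambda>y. G y (grad x) w) (at x) h + G x (Dgrad x h) w + G x (grad x) 0)) (at x)"
    by (rule G_deriv[OF x smooth_on_has_derivative[OF grad(1) x] has_derivative_const])
  then have "((\<lambda>y. Du y w) has_derivative
    (\<lambda>h. frechet_derivative (\<lambda>y. G y (grad x) w) (at x) h + G x (Dgrad x h) w + G x (grad x) 0)) (at x)"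
    by (rule has_derivative_transform_within_open[OF _ V(1) x]) (rule grad(2))
  from fun_cong[OF frechet_derivative_at[OF this], of h] show ?thesis
    by (simp add: linear_0[OF G_lin(1)[OF x]])
qed

text \<open>After \<open>grad_deriv\<close> the Hessian consists of second derivatives of
  \<open>u\<close> and first derivatives of the metric, and each group is symmetric in
  \<open>v\<close> and \<open>w\<close>.\<close>

lemma hess_sym:
  assumes x: "x \<in> V"
  shows "hess x v w = hess x w v"
  using grad_deriv[OF x, of w v] grad_deriv[OF x, of v w] second_derivative_symmetric[OF V(1) x u(1), of v w]
    DG_sym[OF x, of w "grad x" v] DG_sym[OF x, of v "grad x" w] DG_sym[OF x, of v w "grad x"]
  unfolding hess_def koszul_def by argo

text \<open>The right side is the Lie derivative of the metric along the gradient, evaluated on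
  constant fields.\<close>

lemma hess_sum:
  assumes x: "x \<in> V"
  shows "hess x v w + hess x w v = G x (Dgrad x v) w + G x v (Dgrad x w)
    + frechet_derivative (\<lambda>y. G y v w) (at x) (grad x)"
  using DG_sym[OF x, of w "grad x" v] DG_sym[OF x, of v "grad x" w] DG_sym[OF x, of v w "grad x"]
    inner_form_sym[OF G_form[OF x], of v "Dgrad x w"]
  unfolding hess_def koszul_def by argo

text \<open>The identity \<open>d \<bar>grad u\<bar>\<^sup>2 = 2 Hess u (\<cdot>, grad u)\<close>,
  the source of the cancellation in \<open>killing\<close>.\<close>

lemma lam_deriv:
  assumes x: "x \<in> V"
  shows "(lam has_derivative (\<lambda>h. 2 * hess x h (grad x))) (at x)"
proof -
  have "((\<lambda>y. G y (grad y) (grad y)) has_derivative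
    (\<lambda>h. frechet_derivative (\<lambda>y. G y (grad x) (grad x)) (at x) h + G x (Dgrad x h) (grad x) + G x (grad x) (Dgrad x h))) (at x)"
    by (rule G_deriv[OF x smooth_on_has_derivative[OF grad(1) x] smooth_on_has_derivative[OF grad(1) x]])
  then have 1: "(lam has_derivative
    (\<lambda>h. frechet_derivative (\<lambda>y. G y (grad x) (grad x)) (at x) h + G x (Dgrad x h) (grad x) + G x (grad x) (Dgrad x h))) (at x)"
    by (rule has_derivative_transform_within_open[OF _ V(1) x]) (simp add: grad(2) lam_def)
  have 2: "frechet_derivative (\<lambda>y. G y (grad x) (grad x)) (at x) h + G x (Dgrad x h) (grad x) + G x (grad x) (Dgrad x h)
      = 2 * hess x h (grad x)" for h
    using DG_sym[OF x, of h "grad x" "grad x"] inner_form_sym[OF G_form[OF x], of "grad x" "Dgrad x h"]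
    unfolding hess_def koszul_def by argo
  from 1 show ?thesis unfolding 2 .
qed

text \<open>The left side is the Lie derivative of the metric along \<open>grad / lam\<close>. The
  part coming from \<open>grad\<close> is twice the Hessian over \<open>lam\<close>; differentiating
  \<open>1 / lam\<close> adds terms in \<open>hess x v (grad x)\<close> and
  \<open>hess x w (grad x)\<close>. Under the two conditions the Hessian reduces to just such mixed
  terms, and everything cancels.\<close>

lemma killing:
  assumes x: "x \<in> V"
    and level: "\<And>v w. Du x v = 0 \<Longrightarrow> Du x w = 0 \<Longrightarrow> hess x v w = 0"
    and gradgrad: "hess x (grad x) (grad x) = 0"
  shows "frechet_derivative (\<lambda>y. G y v w) (at x) (Z x) + G x (frechet_derivative Z (at x) v) w
    + G x v (frechet_derivative Z (at x) w) = 0"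
proof -
  let ?l = "lam x" and ?a = "grad x" and ?D = "frechet_derivative (\<lambda>y. G y v w) (at x)"
  note l = lam_pos[OF x] and h1 = hess_linear(1)[OF x] and h2 = hess_linear(2)[OF x]
  have "((\<lambda>x. (1 / lam x) *\<^sub>R grad x) has_derivative
      (\<lambda>h. (1 / ?l) *\<^sub>R Dgrad x h + (- (2 * hess x h ?a) / ?l\<^sup>2) *\<^sub>R ?a)) (at x)"
  proof (rule has_derivative_scaleR[OF _ smooth_on_has_derivative[OF grad(1) x]])
    have "((\<lambda>x. inverse (lam x)) has_derivative
        (\<lambda>h. - (inverse ?l * (2 * hess x h ?a) * inverse ?l))) (at x)"
      by (rule Deriv.has_derivative_inverse[OF _ lam_deriv[OF x]]) (use l in simp)
    then show "((\<lambda>x. 1 / lam x) has_derivative (\<lambda>h. - (2 * hess x h ?a) / ?l\<^sup>2)) (at x)"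
      by (simp add: divide_inverse power2_eq_square mult_ac)
  qed
  then have DZ: "frechet_derivative Z (at x) h = (1 / ?l) *\<^sub>R Dgrad x h + (- (2 * hess x h ?a) / ?l\<^sup>2) *\<^sub>R ?a" for h
    unfolding Z_def[abs_def] by (rule fun_cong[OF frechet_derivative_at, symmetric])
  have D_lin: "linear ?D" by (rule linear_frechet_derivative[OF metric_family_diff[OF metric x]])
  have 1: "?D (Z x) = (1 / ?l) * ?D ?a" by (simp add: Z_def linear_cmul[OF D_lin])
  have 2: "G x (frechet_derivative Z (at x) v) w = (1 / ?l) * G x (Dgrad x v) w - 2 * hess x v ?a / ?l\<^sup>2 * Du x w"
    unfolding DZ linear_add[OF G_lin(2)[OF x]] linear_cmul[OF G_lin(2)[OF x]] grad(2)[OF x] by simp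
  have 3: "G x v (frechet_derivative Z (at x) w) = (1 / ?l) * G x v (Dgrad x w) - 2 * hess x w ?a / ?l\<^sup>2 * Du x v"
    unfolding DZ linear_add[OF G_lin(1)[OF x]] linear_cmul[OF G_lin(1)[OF x]]
      inner_form_sym[OF G_form[OF x], of v ?a] grad(2)[OF x] by simp
  \<comment> \<open>Splits \<open>v\<close> and \<open>w\<close> into a multiple of the gradient and
    a part in \<open>ker du\<close>; \<open>level\<close> and \<open>gradgrad\<close> then leave
    only the mixed terms of \<open>hess x v w\<close>.\<close>
  define \<alpha> \<beta> where "\<alpha> = Du x v / ?l" and "\<beta> = Du x w / ?l"
  define v0 w0 where "v0 = v - \<alpha> *\<^sub>R ?a" and "w0 = w - \<beta> *\<^sub>R ?a"
  have "Du x v0 = 0" "Du x w0 = 0"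
    using l linear_diff[OF Du_lin[OF x]] linear_cmul[OF Du_lin[OF x]]
    by (simp_all add: v0_def w0_def \<alpha>_def \<beta>_def lam_def[symmetric])
  then have "hess x v0 w0 = 0" by (rule level)
  moreover have "hess x v0 w0 = hess x v w - \<beta> * hess x v ?a - \<alpha> * hess x ?a w + \<alpha> * \<beta> * hess x ?a ?a"
    unfolding v0_def w0_def linear_diff[OF h1] linear_cmul[OF h1] linear_diff[OF h2] linear_cmul[OF h2]
    by (simp add: algebra_simps)
  ultimately have hvw: "hess x v w = \<beta> * hess x v ?a + \<alpha> * hess x w ?a"
    using gradgrad hess_sym[OF x, of ?a w] by simp
  have "?D (Z x) + G x (frechet_derivative Z (at x) v) w + G x v (frechet_derivative Z (at x) w)
      = (1 / ?l) * (hess x v w + hess x w v) - 2 * hess x v ?a / ?l\<^sup>2 * Du x w - 2 * hess x w ?a / ?l\<^sup>2 * Du x v"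
    unfolding 1 2 3 hess_sum[OF x] by (simp add: algebra_simps)
  also have "\<dots> = 0"
    unfolding hess_sym[OF x, of w v] hvw \<alpha>_def \<beta>_def using l by (simp add: field_simps power2_eq_square)
  finally show ?thesis .
qed

section \<open>The two curvature conditions as conditions on the Hessian\<close>

lemma level_unit_normal:
  defines "\<nu> \<equiv> \<lambda>p. coord_vector A c p ((1 / sqrt (lam (cmap c p))) *\<^sub>R grad (cmap c p))"
  assumes t: "t \<in> {t0 - \<delta><..<t0 + \<delta>}"
  shows "unit_normal A g (section_at \<Sigma> t \<inter> cinv c ` V) \<nu>"
  unfolding unit_normal_def
proof (intro conjI ballI)
  let ?S = "section_at \<Sigma> t \<inter> cinv c ` V"
  fix p assume "p \<in> ?S"
  then obtain x where x: "x \<in> V" "p = cinv c x" and pS: "(p, t) \<in> \<Sigma>" by (auto simp: section_at_def)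
  note p = V_inv[OF x(1), folded x(2)]
  have \<nu>p: "\<nu> p = coord_vector A c p ((1 / sqrt (lam x)) *\<^sub>R grad x)" unfolding \<nu>_def p(2) ..
  show "\<nu> p \<in> tangent_space A UNIV p"
    unfolding \<nu>p by (rule coord_vector_in_tangent_space[OF A(1,3) p(1)])
  have met: "g p (coord_vector A c p v) (coord_vector A c p w) = G x v w" for v w
    using metric_coord_vector[OF chart p(1)] by (simp add: p(2))
  note l = lam_pos[OF x(1)]
  have "G x (grad x) (grad x) = lam x" "sqrt (lam x) * sqrt (lam x) = lam x"
    using grad(2)[OF x(1)] l by (simp_all add: lam_def)
  then show "g p (\<nu> p) (\<nu> p) = 1"
    unfolding \<nu>p met linear_cmul[OF G_lin(1)[OF x(1)]] linear_cmul[OF G_lin(2)[OF x(1)]]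
    using l by (simp add: field_simps)
  show "g p (\<nu> p) X = 0" if X: "X \<in> tangent_space A ?S p" for X
  proof -
    obtain \<gamma> I v where \<gamma>: "open I" "0 \<in> I" "\<gamma> 0 = cmap c p" "\<gamma> ` I \<subseteq> cmap c ` (?S \<inter> cdom c)"
      "(\<gamma> has_vector_derivative v) (at 0)" "X = coord_vector A c p v"
      by (rule tangent_space_curve[OF A(1,3) p(1) X], rule that, assumption+)
    \<comment> \<open>A curve in the section has coordinates in a level set of \<open>u\<close>, so
      its velocity is annihilated by \<open>Du x\<close> and orthogonal to the gradient.\<close>
    have lev: "u (\<gamma> s) = t" if "s \<in> I" for s
    proof -
      have "\<gamma> s \<in> cmap c ` (?S \<inter> cdom c)" using \<gamma>(4) \<open>s \<in> I\<close> by blast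
      then obtain y where y: "y \<in> V" "(cinv c y, t) \<in> \<Sigma>" "\<gamma> s = cmap c (cinv c y)" by (auto simp: section_at_def)
      then show ?thesis using u(3)[OF y(1) t] V_inv(2)[OF y(1)] by simp
    qed
    have "(u has_derivative Du x) (at (\<gamma> 0))" using smooth_on_has_derivative[OF u(1) x(1)] \<gamma>(3) p(2) by simp
    from vector_derivative_diff_chain_within[OF \<gamma>(5) has_derivative_at_withinI[OF this]]
    have "(u \<circ> \<gamma> has_vector_derivative Du x v) (at 0)" .
    then have "((\<lambda>s. t) has_vector_derivative Du x v) (at 0)"
      by (rule has_vector_derivative_transform_within_open[OF _ \<gamma>(1,2)]) (simp add: lev)
    then have "Du x v = 0" using vector_derivative_unique_at has_vector_derivative_const by blast
    then show ?thesis
      unfolding \<nu>p \<gamma>(6) met linear_cmul[OF G_lin(2)[OF x(1)]] by (simp add: grad(2)[OF x(1)])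
  qed
next
  let ?S = "section_at \<Sigma> t \<inter> cinv c ` V"
  fix d assume d: "d \<in> A"
  note dc = atlas_chart[OF A(1) d]
  let ?U = "cmap d ` (cdom d \<inter> (cdom c \<inter> cmap c -` V))"
  let ?\<tau> = "\<lambda>y. cmap c (cinv d y)" and ?\<sigma> = "\<lambda>x. cmap d (cinv c x)"
  let ?n = "\<lambda>x. (1 / sqrt (lam x)) *\<^sub>R grad x"
  have oW: "open (cdom c \<inter> cmap c -` V)"
    by (rule continuous_open_preimage[OF chart_continuous_map[OF chart] chart_open_dom[OF chart] V(1)])
  have U: "open ?U" by (rule open_chart_image[OF dc oW])
  have sub: "?U \<subseteq> cmap d ` (cdom d \<inter> cdom c)" by blast
  have \<tau>: "smooth_on ?U ?\<tau>"
    by (rule smooth_on_subset[OF transition_smooth[OF atlas_compat[OF A(1) d A(3)]] sub])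
  have Uc: "cinv d y \<in> cdom d \<and> cinv d y \<in> cdom c \<and> ?\<tau> y \<in> V" if "y \<in> ?U" for y
    using that chart_inv[OF dc] by auto
  have oD: "open (cmap c ` (cdom c \<inter> cdom d))" by (rule open_chart_image[OF chart chart_open_dom[OF dc]])
  have n: "smooth_on V ?n"
    by (intro smooth_on_scaleR smooth_on_divide smooth_on_const smooth_on_sqrt V lam_smooth grad(1) lam_pos)
      (simp_all add: less_imp_neq[OF lam_pos, symmetric])
  \<comment> \<open>Smoothness of a normal is demanded in every chart of the atlas, so the
    components are carried from \<open>c\<close> to \<open>d\<close> by the derivative of the
    transition map.\<close>
  have F: "smooth_on ?U (\<lambda>y. frechet_derivative ?\<sigma> (at (?\<tau> y)) (?n (?\<tau> y)))"
  proof (rule smooth_on_frechet_comp[OF U oD transition_smooth[OF atlas_compat[OF A(1,3) d]] \<tau>])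
    show "?\<tau> ` ?U \<subseteq> cmap c ` (cdom c \<inter> cdom d)" using Uc by blast
    show "smooth_on ?U (\<lambda>y. ?n (?\<tau> y))"
      by (rule smooth_on_compose[OF U V(1) n \<tau>]) (use Uc in blast)
  qed
  have eq: "frechet_derivative ?\<sigma> (at (?\<tau> y)) (?n (?\<tau> y)) = components d (\<nu> (cinv d y))" if y: "y \<in> ?U" for y
  proof -
    have q: "cinv d y \<in> cdom c" "cinv d y \<in> cdom d" using Uc[OF y] by auto
    show ?thesis
      unfolding \<nu>_def coord_vector_change[OF A(1,3) d q] components_coord_vector[OF A(1) d q(2)] ..
  qed
  show "smooth_along (cmap d ` (?S \<inter> cdom d)) (\<lambda>x. components d (\<nu> (cinv d x)))"
    unfolding smooth_along_def
  proof (intro ballI exI[of _ ?U] exI[of _ "\<lambda>y. frechet_derivative ?\<sigma> (at (?\<tau> y)) (?n (?\<tau> y))"] conjI)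
    fix y assume "y \<in> cmap d ` (?S \<inter> cdom d)"
    then obtain x where x: "x \<in> V" "cinv c x \<in> cdom d" "y = cmap d (cinv c x)" by blast
    then show "y \<in> ?U" using V_inv[OF x(1)] by (intro image_eqI[of _ _ "cinv c x"]) auto
  qed (use U F eq in blast)+
qed

text \<open>With unit normal \<open>grad / sqrt lam\<close>, the second fundamental form of the
  level set is minus the Hessian divided by \<open>sqrt lam\<close>.\<close>

lemma hess_level:
  assumes x: "x \<in> V" and tg: "totally_geodesic A g (section_at \<Sigma> (u x))"
    and v: "Du x v = 0" and w: "Du x w = 0"
  shows "hess x v w = 0"
proof -
  let ?S = "section_at \<Sigma> (u x)" and ?W = "cinv c ` V"
  define p where "p = cinv c x"
  note p = V_inv[OF x, folded p_def]
  define \<nu> where "\<nu> = (\<lambda>p. coord_vector A c p ((1 / sqrt (lam (cmap c p))) *\<^sub>R grad (cmap c p)))"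
  have W_eq: "?W = cdom c \<inter> cmap c -` V"
    using V_inv chart_inv[OF chart] by (force intro: image_eqI[of _ _ "cmap c _"])
  have oW: "open ?W"
    unfolding W_eq by (rule continuous_open_preimage[OF chart_continuous_map[OF chart] chart_open_dom[OF chart] V(1)])
  have pS: "p \<in> ?S" "p \<in> ?W" using u(3)[OF x u(2)[OF x]] x by (auto simp: p_def section_at_def)
  have S: "hypersurface A ?S" using tg by (simp add: totally_geodesic_def)
  have un: "unit_normal A g (?S \<inter> ?W) \<nu>"
    unfolding \<nu>_def by (rule level_unit_normal[OF u(2)[OF x]])
  \<comment> \<open>Being a hypersurface, the section has an equation of its own, which exhibits its
    tangent space as a kernel; it remains to identify that kernel with the one of
    \<open>Du x\<close>.\<close>
  obtain W2 \<rho> where W2: "open W2" "cmap c p \<in> W2" "W2 \<subseteq> cmap c ` cdom c" "smooth_on W2 (\<rho> :: 'e \<Rightarrow> real)"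
    "\<And>x. x \<in> W2 \<Longrightarrow> cinv c x \<in> ?S \<longleftrightarrow> \<rho> x = 0"
    "\<And>x v. x \<in> W2 \<Longrightarrow> \<rho> x = 0 \<Longrightarrow>
      coord_vector A c (cinv c x) v \<in> tangent_space A ?S (cinv c x) \<longleftrightarrow> frechet_derivative \<rho> (at x) v = 0"
    by (rule hypersurface_local_equation[OF A(1,3) S pS(1) p(1)], rule that, assumption+)
  have xW2: "x \<in> W2" using W2(2) p(2) by simp
  have \<rho>x: "\<rho> x = 0" using W2(5)[OF xW2] pS(1) by (simp add: p_def)
  let ?D = "frechet_derivative \<rho> (at x)"
  have D_lin: "linear ?D" by (rule smooth_on_linear_frechet[OF W2(4) xW2])
  have T: "coord_vector A c p v \<in> tangent_space A ?S p \<longleftrightarrow> ?D v = 0" for v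
    using W2(6)[OF xW2 \<rho>x, of v] by (simp add: p_def)
  have met: "g p (coord_vector A c p v) (coord_vector A c p w) = G x v w" for v w
    using metric_coord_vector[OF chart p(1)] by (simp add: p(2))
  note l = lam_pos[OF x]
  \<comment> \<open>Tangent vectors are orthogonal to \<open>\<nu>\<close>, which is a positive
    multiple of the gradient.\<close>
  have D_Du: "Du x v = 0" if "?D v = 0" for v
  proof -
    have "coord_vector A c p v \<in> tangent_space A (?S \<inter> ?W) p"
      by (rule tangent_space_Int_open[OF A(1) oW pS(2)]) (use T that in blast)
    then have "g p (\<nu> p) (coord_vector A c p v) = 0"
      using un pS unfolding unit_normal_def by blast
    then have "(1 / sqrt (lam x)) * Du x v = 0"
      unfolding \<nu>_def p(2) met linear_cmul[OF G_lin(2)[OF x]] by (simp add: grad(2)[OF x])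
    then show ?thesis using l by simp
  qed
  text \<open>The kernels of \<open>?D\<close> and \<open>Du\<close> are hyperplanes, one inside the other.\<close>
  have Du_D: "?D v = 0" if v: "Du x v = 0" for v
  proof -
    obtain b where b: "Du x b \<noteq> 0" using u(4)[OF x] by blast
    then have Db: "?D b \<noteq> 0" using D_Du by blast
    have "?D (v - (?D v / ?D b) *\<^sub>R b) = 0"
      using Db by (simp add: linear_diff[OF D_lin] linear_cmul[OF D_lin])
    from D_Du[OF this] have "(?D v / ?D b) * Du x b = 0"
      using v by (simp add: linear_diff[OF Du_lin[OF x]] linear_cmul[OF Du_lin[OF x]])
    then show ?thesis using b Db by simp
  qed
  have tv: "coord_vector A c p v \<in> tangent_space A ?S p" and tw: "coord_vector A c p w \<in> tangent_space A ?S p"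
    using T Du_D v w by blast+
  have sf: "second_form A g c (?S \<inter> ?W) \<nu> p (coord_vector A c p v) (coord_vector A c p w) = 0"
    using tg oW un pS p(1) A(3) tv tw unfolding totally_geodesic_def by blast
  have f: "(\<lambda>y. 1 / sqrt (lam y)) differentiable at (cmap c p)"
  proof (rule smooth_on_differentiable)
    show "smooth_on V (\<lambda>y. 1 / sqrt (lam y))"
      by (intro smooth_on_divide smooth_on_const smooth_on_sqrt V lam_smooth lam_pos) (simp_all add: less_imp_neq[OF lam_pos, symmetric])
  qed (simp add: p(2) x)
  have "second_form A g c (?S \<inter> ?W) \<nu> p (coord_vector A c p v) (coord_vector A c p w) =
    - (1 / sqrt (lam (cmap c p)) * (G (cmap c p) (Dgrad x v) w + koszul G (cmap c p) v (grad (cmap c p)) w))"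
  proof (rule second_form_scaled[OF A _ p(1) V(1), where f = "\<lambda>y. 1 / sqrt (lam y)" and m = grad])
    show "p \<in> ?S \<inter> ?W" using pS by blast
    show "cmap c p \<in> V" by (simp add: p(2) x)
    show "components c (\<nu> (cinv c y)) = (1 / sqrt (lam y)) *\<^sub>R grad y" if "y \<in> V" for y
      unfolding \<nu>_def components_coord_vector[OF A(1,3) V_inv(1)[OF that]] V_inv(2)[OF that] ..
    show "(grad has_derivative Dgrad x) (at (cmap c p))"
      unfolding p(2) by (rule smooth_on_has_derivative[OF grad(1) x])
    show "coord_vector A c p v \<in> tangent_space A (?S \<inter> ?W) p"
      by (rule tangent_space_Int_open[OF A(1) oW pS(2) tv])
    show "G (cmap c p) (grad (cmap c p)) w = 0" unfolding p(2) grad(2)[OF x] by (rule w)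
  qed (rule f)
  then show ?thesis using sf l by (simp add: p(2) hess_def)
qed

text \<open>The graph has normal direction \<open>(grad, -1)\<close>, and
  \<open>\<nabla>\<xi>\<close> is a positive multiple of \<open>(grad, lam)\<close>. Since the
  height direction is flat, the second fundamental form on \<open>\<nabla>\<xi>\<close> is a nonzero
  multiple of \<open>hess x (grad x) (grad x)\<close>.\<close>

lemma hess_grad:
  assumes x: "x \<in> V"
    and N: "unit_normal (prod_atlas A) (prod_metric g) \<Sigma> N"
    and angle: "angle A g N (cinv c x, u x) \<noteq> 0"
    and sf: "second_form (prod_atlas A) (prod_metric g) (prod_chart c) \<Sigma> N (cinv c x, u x)
      (height_gradient A g \<Sigma> (cinv c x, u x)) (height_gradient A g \<Sigma> (cinv c x, u x)) = 0"
  shows "hess x (grad x) (grad x) = 0"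
proof -
  let ?B = "prod_atlas A" and ?c = "prod_chart c" and ?h = "prod_metric g"
  note B = smooth_atlas_prod[OF A(1)] riemannian_metric_prod[OF A(1,2)] prod_chart_in[OF A(3)]
  define P where "P = (cinv c x, u x)"
  let ?X = "coord_vector ?B ?c P" and ?T = "tangent_space ?B \<Sigma> P"
  have PS: "P \<in> \<Sigma>" using u(3)[OF x u(2)[OF x]] by (simp add: P_def)
  have Pc: "P \<in> cdom ?c" using V_inv[OF x] by (simp add: P_def)
  have Px: "cmap ?c P = (x, u x)" using V_inv[OF x] by (simp add: P_def)
  have T: "?X (v, a) \<in> ?T \<longleftrightarrow> a = Du x v" for v a using u(5)[OF x] by (simp add: P_def)
  have met: "?h P (?X v) (?X w) = G x (fst v) (fst w) + snd v * snd w" for v w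
    using metric_coord_vector[OF atlas_chart[OF B(1,3)] Pc, of ?h ?B v w] metric_coord_prod[OF A(1,3), of "(x, u x)" g v w] V(2) x
    unfolding Px by auto
  have snd: "?X v snd = snd v" for v
    using coord_vector_snd[OF A(1,3) V_inv(1)[OF x], of "u x" "fst v" "snd v"] by (simp add: P_def)
  note l = lam_pos[OF x]
  \<comment> \<open>Pairing \<open>(grad x, lam x)\<close> with a tangent vector
    \<open>(v, Du x v)\<close> gives \<open>(1 + lam x) * Du x v\<close>; the factor reduces this to
    the vertical component, as the gradient of the height requires.\<close>
  define k where "k = 1 / (1 + lam x)"
  have k: "k > 0" "k + k * lam x = 1" using l by (simp_all add: k_def field_simps)
  define w where "w = (k *\<^sub>R grad x, k * lam x)"
  have wT: "?X w \<in> ?T" unfolding w_def T using linear_cmul[OF Du_lin[OF x]] by (simp add: lam_def)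
  have "height_gradient A g \<Sigma> P = ?X w"
    unfolding surface_gradient_def
  proof (rule the_equality)
    have range: "\<exists>v. X = ?X (v, Du x v)" if "X \<in> ?T" for X
    proof -
      have "X \<in> range ?X" using subsetD[OF tangent_space_mono[OF subset_UNIV] that]
        unfolding tangent_space_UNIV[OF B(1,3) Pc] .
      then obtain v a where X: "X = ?X (v, a)" by auto
      then have "a = Du x v" using \<open>X \<in> ?T\<close> by (simp add: T)
      then show ?thesis using X by blast
    qed
    have wX: "?h P (?X w) X = X snd" if "X \<in> ?T" for X
    proof -
      obtain v where X: "X = ?X (v, Du x v)" using range[OF \<open>X \<in> ?T\<close>] by blast
      have "k * Du x v + k * lam x * Du x v = (k + k * lam x) * Du x v" by (simp add: algebra_simps)
      then show ?thesis
        unfolding X met snd using linear_cmul[OF G_lin(2)[OF x]] by (simp add: w_def grad(2)[OF x] k(2))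
    qed
    then show "?X w \<in> ?T \<and> (\<forall>X\<in>?T. ?h P (?X w) X = X snd)" using wT by blast
    fix Y assume Y: "Y \<in> ?T \<and> (\<forall>X\<in>?T. ?h P Y X = X snd)"
    then obtain v where v: "Y = ?X (v, Du x v)" using range by blast
    \<comment> \<open>Testing both candidates against the tangent vector over \<open>d\<close> shows
      that this vector has length zero.\<close>
    define d where "d = v - k *\<^sub>R grad x"
    have "?X (d, Du x d) \<in> ?T" by (simp add: T)
    then have "?h P Y (?X (d, Du x d)) = ?h P (?X w) (?X (d, Du x d))" using Y wX by simp
    then have e1: "G x v d + Du x v * Du x d = G x (k *\<^sub>R grad x) d + k * lam x * Du x d"
      unfolding v met w_def by simp
    have e2: "G x d d = G x v d - G x (k *\<^sub>R grad x) d"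
      unfolding d_def by (rule linear_diff[OF G_lin(2)[OF x]])
    have e3: "Du x d = Du x v - k * lam x"
      unfolding d_def using linear_diff[OF Du_lin[OF x]] linear_cmul[OF Du_lin[OF x]] by (simp add: lam_def)
    have "Du x d * Du x d = Du x v * Du x d - k * lam x * Du x d"
      unfolding left_diff_distrib[symmetric] by (simp only: e3)
    then have "G x d d + Du x d * Du x d = 0" using e1 e2 by linarith
    moreover have "Du x d * Du x d \<ge> 0" by simp
    ultimately have "\<not> G x d d > 0" by linarith
    then have "d = 0" using G_form[OF x] unfolding inner_form_def by blast
    then have "v = k *\<^sub>R grad x" by (simp add: d_def)
    then show "Y = ?X w" unfolding v w_def using linear_cmul[OF Du_lin[OF x]] by (simp add: lam_def)
  qed
  note hg = this
  define n where "n z = components ?c (N (cinv ?c z))" for z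
  have sa: "smooth_along (cmap ?c ` (\<Sigma> \<inter> cdom ?c)) n"
    using N B(3) unfolding unit_normal_def n_def by blast
  have mem: "(x, u x) \<in> cmap ?c ` (\<Sigma> \<inter> cdom ?c)"
    by (rule image_eqI[where x = P and f = "cmap ?c"], rule Px[symmetric]) (use PS Pc in blast)
  obtain W3 F where W3': "open W3 \<and> (x, u x) \<in> W3 \<and> smooth_on W3 F \<and>
      (\<forall>z\<in>W3 \<inter> cmap ?c ` (\<Sigma> \<inter> cdom ?c). F z = n z)"
    using bspec[OF sa[unfolded smooth_along_def] mem] by (elim exE) (rule that)
  note W3 = W3'[THEN conjunct1] W3'[THEN conjunct2, THEN conjunct1]
    W3'[THEN conjunct2, THEN conjunct2, THEN conjunct1]
    W3'[THEN conjunct2, THEN conjunct2, THEN conjunct2, rule_format]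
  \<comment> \<open>\<open>F\<close> extends the components of \<open>N\<close> smoothly off
    \<open>\<Sigma>\<close>. Its vertical component supplies the scalar factor, of which only
    differentiability and a nonzero value at the point will matter.\<close>
  define f where "f z = - snd (F z)" for z
  define m where "m z = (grad (fst z), - 1 :: real)" for z :: "'e \<times> real"
  let ?W = "W3 \<inter> V \<times> {t0 - \<delta><..<t0 + \<delta>}"
  have oW: "open ?W" by (intro open_Int W3 open_Times V open_greaterThanLessThan)
  have xW: "cmap ?c P \<in> ?W" unfolding Px using W3(2) x u(2)[OF x] by simp
  have comp: "n z = f z *\<^sub>R m z" if z: "z \<in> ?W" "z \<in> cmap ?c ` (\<Sigma> \<inter> cdom ?c)" for z
  proof -
    obtain y s where ys: "z = (y, s)" "y \<in> V" "s \<in> {t0 - \<delta><..<t0 + \<delta>}" using z(1) by auto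
    have inv: "cinv ?c z = (cinv c y, s)"
      unfolding ys(1) by (rule prod_chart_inv[OF chart]) (use ys(2) V(2) in blast)
    obtain q where q: "q \<in> \<Sigma>" "q \<in> cdom ?c" "z = cmap ?c q" using z(2) by blast
    have "cinv ?c z = q" using chart_inv[OF atlas_chart[OF B(1,3)] q(2)] q(3) by simp
    then have S: "(cinv c y, s) \<in> \<Sigma>" using q(1) inv by simp
    then have s: "s = u y" using u(3)[OF ys(2,3)] by simp
    have nz: "n z = components ?c (N (cinv c y, s))" unfolding n_def inv ..
    \<comment> \<open>Orthogonality to the graph of \<open>Du y\<close> determines the horizontal
      part of the normal from its vertical part.\<close>
    have "G y (fst (n z)) v = G y (- snd (n z) *\<^sub>R grad y) v" for v
    proof -
      have "coord_vector ?B ?c (cinv c y, s) (v, Du y v) \<in> tangent_space ?B \<Sigma> (cinv c y, s)"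
        unfolding s using u(5)[OF ys(2)] by blast
      from helicoid_normal(3)[OF A N S V_inv(1)[OF ys(2)] this]
      have "G y (fst (n z)) v + snd (n z) * Du y v = 0" by (simp add: nz V_inv(2)[OF ys(2)])
      moreover have "G y (- snd (n z) *\<^sub>R grad y) v = - snd (n z) * Du y v"
        using linear_cmul[OF G_lin(2)[OF ys(2)], of "- snd (n z)" "grad y" v] by (simp add: grad(2)[OF ys(2)])
      ultimately show ?thesis by simp
    qed
    then have "fst (n z) = - snd (n z) *\<^sub>R grad y" by (rule inner_form_nondegenerate[OF G_form[OF ys(2)]])
    moreover have "F z = n z" by (rule W3(4)) (use z in blast)
    ultimately show ?thesis by (simp add: f_def m_def ys(1) prod_eq_iff)
  qed
  \<comment> \<open>Up to sign, \<open>f\<close> is the angle function here.\<close>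
  have fP: "f (x, u x) \<noteq> 0"
  proof -
    have "F (x, u x) = n (x, u x)" using W3(4)[OF IntI[OF W3(2) mem]] .
    moreover have "cinv ?c (x, u x) = (cinv c x, u x)"
      by (rule prod_chart_inv[OF chart]) (use x V(2) in blast)
    ultimately show ?thesis
      using helicoid_normal(1)[OF A N PS[unfolded P_def] V_inv(1)[OF x]] angle by (simp add: f_def n_def)
  qed
  have "second_form ?B ?h ?c \<Sigma> N P (?X w) (?X w) =
    - (f (cmap ?c P) * (metric_coord ?B ?h ?c (cmap ?c P) (Dgrad x (fst w), 0) w
      + koszul (metric_coord ?B ?h ?c) (cmap ?c P) w (m (cmap ?c P)) w))"
  proof (rule second_form_scaled[where m' = "\<lambda>v. (Dgrad x (fst v), 0)" and f = f and m = m, OF B PS Pc oW xW _ _ _ wT])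
    show "components ?c (N (cinv ?c z)) = f z *\<^sub>R m z" if "z \<in> ?W" "z \<in> cmap ?c ` (\<Sigma> \<inter> cdom ?c)" for z
      using comp[OF that] unfolding n_def .
    show "f differentiable at (cmap ?c P)"
      unfolding Px
      by (rule smooth_on_differentiable[OF _ W3(2)])
        (unfold f_def[abs_def], intro smooth_on_minus smooth_on_snd W3)
    have "((\<lambda>z. (grad (fst z), - 1 :: real)) has_derivative (\<lambda>v. (Dgrad x (fst v), 0))) (at (x, u x))"
    proof (intro has_derivative_Pair has_derivative_const)
      have "(fst has_derivative fst) (at (x, u x))" by (auto intro!: derivative_eq_intros)
      moreover have "(grad has_derivative Dgrad x) (at (fst (x, u x)))"
        using smooth_on_has_derivative[OF grad(1) x] by simp
      ultimately show "((\<lambda>z. grad (fst z)) has_derivative (\<lambda>v. Dgrad x (fst v))) (at (x, u x))"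
        by (rule has_derivative_compose)
    qed
    then show "(m has_derivative (\<lambda>v. (Dgrad x (fst v), 0))) (at (cmap ?c P))"
      unfolding Px m_def[abs_def] .
    have "metric_coord ?B ?h ?c (x, u x) (m (x, u x)) w = G x (grad x) (k *\<^sub>R grad x) - k * lam x"
      using metric_coord_prod[OF A(1,3), of "(x, u x)" g "m (x, u x)" w] x V(2) by (auto simp: m_def w_def)
    also have "\<dots> = 0" using linear_cmul[OF Du_lin[OF x]] by (simp add: grad(2)[OF x] lam_def)
    finally show "metric_coord ?B ?h ?c (cmap ?c P) (m (cmap ?c P)) w = 0" unfolding Px .
  qed
  moreover have "metric_coord ?B ?h ?c (x, u x) (Dgrad x (fst w), 0) w = k * k * G x (Dgrad x (grad x)) (grad x)"
  proof -
    have "metric_coord ?B ?h ?c (x, u x) (Dgrad x (fst w), 0) w = G x (Dgrad x (k *\<^sub>R grad x)) (k *\<^sub>R grad x)"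
      using metric_coord_prod[OF A(1,3), of "(x, u x)" g "(Dgrad x (fst w), 0)" w] x V(2) by (auto simp: w_def)
    then show ?thesis
      using linear_cmul[OF smooth_on_linear_frechet[OF grad(1) x]] linear_cmul[OF G_lin(1)[OF x]]
        linear_cmul[OF G_lin(2)[OF x]] by simp
  qed
  moreover have "koszul (metric_coord ?B ?h ?c) (x, u x) w (m (x, u x)) w = k * k * koszul G x (grad x) (grad x) (grad x)"
  proof -
    have "koszul (metric_coord ?B ?h ?c) (x, u x) w (m (x, u x)) w = koszul G x (k *\<^sub>R grad x) (grad x) (k *\<^sub>R grad x)"
      using koszul_prod[OF A, of x "u x" w "m (x, u x)" w] x V(2) by (auto simp: w_def m_def)
    also have "\<dots> = hess x (k *\<^sub>R grad x) (k *\<^sub>R grad x) - G x (Dgrad x (k *\<^sub>R grad x)) (k *\<^sub>R grad x)"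
      by (simp add: hess_def)
    also have "\<dots> = k * k * (hess x (grad x) (grad x) - G x (Dgrad x (grad x)) (grad x))"
      using linear_cmul[OF smooth_on_linear_frechet[OF grad(1) x]] linear_cmul[OF G_lin(1)[OF x]]
        linear_cmul[OF G_lin(2)[OF x]] linear_cmul[OF hess_linear(1)[OF x]] linear_cmul[OF hess_linear(2)[OF x]]
      by (simp add: algebra_simps)
    also have "\<dots> = k * k * koszul G x (grad x) (grad x) (grad x)" by (simp add: hess_def)
    finally show ?thesis .
  qed
  ultimately have "f (x, u x) * (k * k * hess x (grad x) (grad x)) = 0"
    using sf[folded P_def] unfolding hg Px by (simp add: hess_def algebra_simps)
  then show ?thesis using fP k(1) by simp
qed

end

section \<open>Maps given in one chart\<close>

lemma chart_inv_image:
  assumes c: "is_chart c" and U: "open U" "U \<subseteq> cmap c ` cdom c"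
  shows "cinv c ` U = cdom c \<inter> cmap c -` U" and "open (cinv c ` U)" and "cmap c ` cinv c ` U = U"
    and "cinv c ` U \<subseteq> cdom c"
proof -
  have inv: "cinv c x \<in> cdom c \<and> cmap c (cinv c x) = x" if "x \<in> U" for x
    using chart_inv_in[OF c] chart_map_inv[OF c] U(2) that by blast
  show eq: "cinv c ` U = cdom c \<inter> cmap c -` U"
  proof (intro equalityI subsetI)
    fix p assume "p \<in> cdom c \<inter> cmap c -` U"
    then show "p \<in> cinv c ` U" using chart_inv[OF c] by (intro image_eqI[of _ _ "cmap c p"]) auto
  qed (use inv in auto)
  show "open (cinv c ` U)"
    unfolding eq by (rule continuous_open_preimage[OF chart_continuous_map[OF c] chart_open_dom[OF c] U(1)])
  show "cmap c ` cinv c ` U = U" using inv by (simp add: image_image)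
  show "cinv c ` U \<subseteq> cdom c" unfolding eq by blast
qed

text \<open>Hypersurfaces are defined by slice charts of the maximal atlas; following
  \<open>c\<close> by a diffeomorphism is the way to produce them.\<close>

lemma diffeo_chart_maximal:
  fixes A :: "('a::topological_space, 'e::euclidean_space) chart set"
  assumes A: "smooth_atlas A" "c \<in> A" and U: "open U" "U \<subseteq> cmap c ` cdom c" and B: "open B"
    and \<Psi>: "smooth_on U \<Psi>" "\<And>x. x \<in> U \<Longrightarrow> \<Psi> x \<in> B \<and> \<Theta> (\<Psi> x) = x"
    and \<Theta>: "smooth_on B \<Theta>" "\<And>y. y \<in> B \<Longrightarrow> \<Theta> y \<in> U \<and> \<Psi> (\<Theta> y) = y"
  shows "(cinv c ` U, \<lambda>p. \<Psi> (cmap c p)) \<in> maximal_atlas A"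
proof -
  let ?d = "(cinv c ` U, \<lambda>p. \<Psi> (cmap c p))"
  note c = atlas_chart[OF A]
  note im = chart_inv_image[OF c U]
  have inv: "cinv c x \<in> cdom c \<and> cmap c (cinv c x) = x" if "x \<in> U" for x
    using chart_inv_in[OF c] chart_map_inv[OF c] U(2) that by blast
  have d_im: "cmap ?d ` cdom ?d = B"
  proof (intro equalityI subsetI)
    fix y assume "y \<in> B"
    then show "y \<in> cmap ?d ` cdom ?d"
      using \<Theta>(2)[of y] inv[of "\<Theta> y"] by (intro image_eqI[of _ _ "cinv c (\<Theta> y)"]) auto
  qed (use \<Psi>(2) inv in auto)
  have d_inv: "cinv ?d y = cinv c (\<Theta> y)" if y: "y \<in> B" for y
    unfolding cinv_def[of ?d] fst_conv snd_conv
  proof (rule inv_into_f_eq)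
    show "inj_on (\<lambda>p. \<Psi> (cmap c p)) (cinv c ` U)"
    proof (rule inj_on_inverseI[where g = "\<lambda>y. cinv c (\<Theta> y)"])
      fix p assume "p \<in> cinv c ` U"
      then show "cinv c (\<Theta> (\<Psi> (cmap c p))) = p" using inv \<Psi>(2) by auto
    qed
  qed (use \<Theta>(2)[OF y] inv in auto)
  have c1: "continuous_on (cdom ?d) (cmap ?d)"
  proof -
    have "continuous_on (cinv c ` U) (cmap c)" using continuous_on_subset[OF chart_continuous_map[OF c] im(4)] .
    then have "continuous_on (cinv c ` U) (\<lambda>p. \<Psi> (cmap c p))"
      by (rule continuous_on_compose2[OF smooth_on_imp_continuous_on[OF \<Psi>(1)]]) (simp add: im(3))
    then show ?thesis by simp
  qed
  have c2: "continuous_on B (cinv ?d)"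
  proof -
    have "continuous_on B (\<lambda>y. cinv c (\<Theta> y))"
      by (rule continuous_on_compose2[OF chart_continuous_inv[OF c] smooth_on_imp_continuous_on[OF \<Theta>(1)]])
        (use \<Theta>(2) U(2) in blast)
    then show ?thesis by (rule continuous_on_eq) (simp add: d_inv)
  qed
  have "homeomorphism (cdom ?d) B (cmap ?d) (cinv ?d)"
  proof (rule homeomorphismI[OF c1 c2])
    show "cmap ?d ` cdom ?d \<subseteq> B" using d_im by blast
    show "cinv ?d ` B \<subseteq> cdom ?d" using d_inv \<Theta>(2) by auto
    show "cinv ?d (cmap ?d p) = p" if p: "p \<in> cdom ?d" for p
    proof -
      obtain x where x: "x \<in> U" "p = cinv c x" using p by auto
      then show ?thesis using inv[of x] \<Psi>(2)[of x] d_inv[of "\<Psi> x"] by simp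
    qed
    show "cmap ?d (cinv ?d y) = y" if "y \<in> B" for y
      using d_inv[OF that] \<Theta>(2)[OF that] inv[of "\<Theta> y"] by simp
  qed
  then have chart: "is_chart ?d" unfolding is_chart_def d_im using im(2) B by simp
  have "smooth_compat ?d e" if e: "e \<in> A" for e
    unfolding smooth_compat_def
  proof (rule conjI)
    note ec = atlas_chart[OF A(1) e]
    have 1: "open (cmap ?d ` (cdom ?d \<inter> cdom e))" by (rule open_chart_image[OF chart chart_open_dom[OF ec]])
    have oc: "open (cmap c ` (cdom c \<inter> cdom e))" by (rule open_chart_image[OF c chart_open_dom[OF ec]])
    have sub: "cmap ?d ` (cdom ?d \<inter> cdom e) \<subseteq> B" using d_im by blast
    have y_in: "\<Theta> y \<in> cmap c ` (cdom c \<inter> cdom e)" if y: "y \<in> cmap ?d ` (cdom ?d \<inter> cdom e)" for y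
    proof -
      obtain x where x: "x \<in> U" "cinv c x \<in> cdom e" "y = \<Psi> (cmap c (cinv c x))" using y by auto
      then have "\<Theta> y = cmap c (cinv c x)" using inv[OF x(1)] \<Psi>(2)[OF x(1)] by simp
      then show ?thesis using x(2) inv[OF x(1)] by blast
    qed
    have s1: "smooth_on (cmap ?d ` (cdom ?d \<inter> cdom e)) (\<lambda>y. cmap e (cinv c (\<Theta> y)))"
      by (rule smooth_on_compose[OF 1 oc transition_smooth[OF atlas_compat[OF A e]] smooth_on_subset[OF \<Theta>(1) sub]])
        (use y_in in blast)
    have eq: "cmap e (cinv c (\<Theta> y)) = (cmap e \<circ> cinv ?d) y" if "y \<in> cmap ?d ` (cdom ?d \<inter> cdom e)" for y
      using d_inv[OF subsetD[OF sub that]] by simp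
    show "smooth_on (cmap ?d ` (cdom ?d \<inter> cdom e)) (cmap e \<circ> cinv ?d)"
      by (rule smooth_on_cong[THEN iffD1, OF 1 _ s1]) (rule eq)
    have 2: "open (cmap e ` (cdom ?d \<inter> cdom e))"
      using open_chart_image[OF ec im(2)] by (simp add: Int_commute)
    have sub2: "cmap e ` (cdom ?d \<inter> cdom e) \<subseteq> cmap e ` (cdom e \<inter> cdom c)" using im(4) by auto
    have z_in: "cmap c (cinv e z) \<in> U" if "z \<in> cmap e ` (cdom ?d \<inter> cdom e)" for z
      using that chart_inv[OF ec] inv by auto
    have "smooth_on (cmap e ` (cdom ?d \<inter> cdom e)) (\<lambda>z. \<Psi> (cmap c (cinv e z)))"
      by (rule smooth_on_compose[OF 2 U(1) \<Psi>(1) smooth_on_subset[OF transition_smooth[OF atlas_compat[OF A(1) e A(2)]] sub2]])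
        (use z_in in blast)
    then show "smooth_on (cmap e ` (cdom ?d \<inter> cdom e)) (cmap ?d \<circ> cinv e)" by (simp add: o_def)
  qed
  then show ?thesis using chart by (simp add: maximal_atlas_def)
qed

text \<open>A left inverse of \<open>f\<close> on \<open>U\<close> is the inverse on the image, so
  the smoothness of \<open>h\<close> gives that of \<open>inv_into\<close>.\<close>

lemma isometry_on_coord:
  fixes A :: "('a::topological_space, 'e::euclidean_space) chart set"
  assumes A: "smooth_atlas A" "c \<in> A" and U: "open U" "U \<subseteq> cmap c ` cdom c"
    and f: "smooth_on U f" "open (f ` U)" "f ` U \<subseteq> cmap c ` cdom c"
    and h: "smooth_on (f ` U) h" "\<And>x. x \<in> U \<Longrightarrow> h (f x) = x"
    and met: "\<And>x v w. x \<in> U \<Longrightarrow> metric_coord A g c (f x) (frechet_derivative f (at x) v) (frechet_derivative f (at x) w)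
      = metric_coord A g c x v w"
  shows "isometry_on A g (cinv c ` U) (\<lambda>p. cinv c (f (cmap c p)))"
proof -
  let ?F = "\<lambda>p. cinv c (f (cmap c p))" and ?U = "cinv c ` U" and ?H = "\<lambda>p. cinv c (h (cmap c p))"
  note c = atlas_chart[OF A]
  note im = chart_inv_image[OF c U] and im' = chart_inv_image[OF c f(2,3)]
  have inv: "cinv c x \<in> cdom c \<and> cmap c (cinv c x) = x" if "x \<in> U" for x
    using chart_inv_in[OF c] chart_map_inv[OF c] U(2) that by blast
  have inv': "cinv c (f x) \<in> cdom c \<and> cmap c (cinv c (f x)) = f x" if "x \<in> U" for x
    using chart_inv_in[OF c] chart_map_inv[OF c] f(3) that by blast
  have F: "?F (cinv c x) = cinv c (f x)" if "x \<in> U" for x using inv[OF that] by simp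
  have FU: "?F ` ?U = cinv c ` f ` U" using inv by (auto simp: image_image)
  have H: "?H (?F p) = p" if "p \<in> ?U" for p using that inv inv' h(2) by auto
  have inj: "inj_on ?F ?U" by (rule inj_on_inverseI) (rule H)
  have inv_F: "inv_into ?U ?F q = ?H q" if "q \<in> ?F ` ?U" for q
    using that H inv_into_f_f[OF inj] by auto
  have sm1: "smooth_map_on A A ?U ?F"
    unfolding smooth_map_on_def
  proof (rule ballI, rule bexI[OF _ A(2)], rule bexI[OF _ A(2)], rule exI[of _ ?U], intro conjI)
    show "smooth_on (cmap c ` ?U) (cmap c \<circ> ?F \<circ> cinv c)"
      unfolding im(3) by (rule smooth_on_cong[THEN iffD1, OF U(1) _ f(1)]) (use inv inv' in auto)
    show "?F ` ?U \<subseteq> cdom c" using inv inv' by auto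
  qed (use im in auto)
  have sm2: "smooth_map_on A A (?F ` ?U) (inv_into ?U ?F)"
    unfolding smooth_map_on_def FU
  proof (rule ballI, rule bexI[OF _ A(2)], rule bexI[OF _ A(2)], rule exI[of _ "cinv c ` f ` U"], intro conjI)
    have eq: "inv_into ?U ?F (cinv c (f x)) = cinv c x" if "x \<in> U" for x
      using inv_into_f_f[OF inj, of "cinv c x"] F[OF that] that by auto
    show "smooth_on (cmap c ` cinv c ` f ` U) (cmap c \<circ> inv_into ?U ?F \<circ> cinv c)"
      unfolding im'(3)
      by (rule smooth_on_cong[THEN iffD1, OF f(2) _ h(1)]) (use inv h(2) eq in auto)
    show "inv_into ?U ?F ` (cinv c ` f ` U) \<subseteq> cdom c" using eq inv by auto
  qed (use im' in auto)
  \<comment> \<open>Both sides must also agree on functions that are not differentiable;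
    \<open>h\<close> shows that differentiability of \<open>k\<close> at the image point and of
    \<open>k \<circ> ?F\<close> at the point are equivalent.\<close>
  have push: "pushforward ?F (coord_vector A c (cinv c x) v) =
      coord_vector A c (cinv c (f x)) (frechet_derivative f (at x) v)" if x: "x \<in> U" for x v
  proof
    fix k :: "'a \<Rightarrow> real"
    let ?p = "cinv c x" and ?q = "cinv c (f x)"
    have p: "?p \<in> cdom c" "cmap c ?p = x" and q: "?q \<in> cdom c" "cmap c ?q = f x" using inv[OF x] inv'[OF x] by auto
    have fx: "(f has_derivative frechet_derivative f (at x)) (at x)" by (rule smooth_on_has_derivative[OF f(1) x])
    have hx: "(h has_derivative frechet_derivative h (at (f x))) (at (f x))"
      by (rule smooth_on_has_derivative[OF h(1)]) (use x in blast)
    have D: "(k \<circ> ?F \<circ> cinv c has_derivative (\<lambda>v. frechet_derivative (k \<circ> cinv c) (at (f x)) (frechet_derivative f (at x) v))) (at x)"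
      if "(k \<circ> cinv c) differentiable at (f x)"
      by (rule has_derivative_transform_within_open[OF has_derivative_compose[OF fx that[unfolded frechet_derivative_works]] U(1) x])
        (use inv in auto)
    have D': "(k \<circ> cinv c) differentiable at (f x)" if k: "(k \<circ> ?F \<circ> cinv c) differentiable at x"
    proof -
      have "(k \<circ> ?F \<circ> cinv c has_derivative frechet_derivative (k \<circ> ?F \<circ> cinv c) (at x)) (at (h (f x)))"
        using k h(2)[OF x] by (simp only: frechet_derivative_works)
      from has_derivative_compose[OF hx this]
      have "(k \<circ> cinv c has_derivative (\<lambda>v. frechet_derivative (k \<circ> ?F \<circ> cinv c) (at x) (frechet_derivative h (at (f x)) v))) (at (f x))"
        by (rule has_derivative_transform_within_open[OF _ f(2)]) (use x inv h(2) in auto)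
      then show ?thesis by (rule differentiableI)
    qed
    have iff: "diff_at A (k \<circ> ?F) ?p \<longleftrightarrow> diff_at A k ?q"
      unfolding diff_at_chart[OF A p(1)] diff_at_chart[OF A q(1)] p(2) q(2)
      using differentiableI[OF D] D' by blast
    show "pushforward ?F (coord_vector A c ?p v) k = coord_vector A c ?q (frechet_derivative f (at x) v) k"
    proof (cases "diff_at A k ?q")
      case True
      then have d: "(k \<circ> cinv c) differentiable at (f x)" unfolding diff_at_chart[OF A q(1)] q(2) .
      have "frechet_derivative (k \<circ> ?F \<circ> cinv c) (at x) v = frechet_derivative (k \<circ> cinv c) (at (f x)) (frechet_derivative f (at x) v)"
        by (rule fun_cong[OF frechet_derivative_at[OF D[OF d], symmetric]])
      then show ?thesis
        unfolding pushforward_def coord_vector_eq[OF A p(1)] coord_vector_eq[OF A q(1)] iff p(2) q(2) using True by simp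
    next
      case False
      then show ?thesis
        unfolding pushforward_def coord_vector_eq[OF A p(1)] coord_vector_eq[OF A q(1)] iff by simp
    qed
  qed
  have iso: "g (?F p) (pushforward ?F X) (pushforward ?F Y) = g p X Y"
    if pU: "p \<in> ?U" and XY: "X \<in> tangent_space A UNIV p" "Y \<in> tangent_space A UNIV p" for p X Y
  proof -
    obtain x where x: "x \<in> U" "p = cinv c x" using pU by blast
    have p: "cinv c x \<in> cdom c" "cmap c (cinv c x) = x" and q: "cinv c (f x) \<in> cdom c" "cmap c (cinv c (f x)) = f x"
      using inv[OF x(1)] inv'[OF x(1)] by auto
    obtain v w where "X = coord_vector A c p v" "Y = coord_vector A c p w"
      using XY unfolding x(2) tangent_space_UNIV[OF A p(1)] by blast
    then show ?thesis
      unfolding x(2)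
      using met[OF x(1), of v w] metric_coord_vector[OF c p(1), of g A v w]
        metric_coord_vector[OF c q(1), of g A "frechet_derivative f (at x) v" "frechet_derivative f (at x) w"]
      by (simp only: push[OF x(1)] F[OF x(1)] p(2) q(2))
  qed
  show ?thesis
    unfolding isometry_on_def
    using im(2) im'(2) inj sm1 sm2 iso unfolding FU by blast
qed

text \<open>The time derivative of the pulled-back metric is the left side of the Killing equation
  at the flowed point, evaluated on the transported vectors; so the pulled-back metric keeps its
  value at time \<open>0\<close>.\<close>

lemma flow_preserves_metric:
  fixes Z :: "'e::euclidean_space \<Rightarrow> 'e"
  assumes G: "metric_family V G" and Z: "smooth_on V Z"
    and killing: "\<And>x v w. x \<in> V \<Longrightarrow> frechet_derivative (\<lambda>y. G y v w) (at x) (Z x)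
      + G x (frechet_derivative Z (at x) v) w + G x v (frechet_derivative Z (at x) w) = 0"
    and U: "open U" and \<phi>: "\<And>x t. x \<in> U \<Longrightarrow> t \<in> {-T<..<T} \<Longrightarrow> \<phi> x t \<in> V"
      "\<And>x. x \<in> U \<Longrightarrow> \<phi> x 0 = x"
      "\<And>x t. x \<in> U \<Longrightarrow> t \<in> {-T<..<T} \<Longrightarrow> (\<phi> x has_vector_derivative Z (\<phi> x t)) (at t)"
      "\<And>x h t. x \<in> U \<Longrightarrow> t \<in> {-T<..<T} \<Longrightarrow>
        ((\<lambda>t. frechet_derivative (\<lambda>x. \<phi> x t) (at x) h) has_vector_derivative
          frechet_derivative Z (at (\<phi> x t)) (frechet_derivative (\<lambda>x. \<phi> x t) (at x) h)) (at t)"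
    and x: "x \<in> U" and t: "t \<in> {-T<..<T}"
  shows "G (\<phi> x t) (frechet_derivative (\<lambda>x. \<phi> x t) (at x) v) (frechet_derivative (\<lambda>x. \<phi> x t) (at x) w) = G x v w"
proof -
  define a where "a h t = frechet_derivative (\<lambda>x. \<phi> x t) (at x) h" for h t
  let ?I = "{-T<..<T}"
  have "((\<lambda>s. G (\<phi> x s) (a v s) (a w s)) has_derivative (\<lambda>h. 0)) (at s within ?I)" if s: "s \<in> ?I" for s
  proof -
    let ?y = "\<phi> x s" and ?D = "frechet_derivative (\<lambda>y. G y (a v s) (a w s)) (at (\<phi> x s))"
    note y = \<phi>(1)[OF x s]
    have a: "(a h has_derivative (\<lambda>r. r *\<^sub>R frechet_derivative Z (at ?y) (a h s))) (at s)" for h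
      using \<phi>(4)[OF x s, of h] unfolding a_def[abs_def] has_vector_derivative_def .
    have "((\<lambda>s. G (\<phi> x s) (a v s) (a w s)) has_derivative
      (\<lambda>r. ?D (r *\<^sub>R Z ?y) + G ?y (r *\<^sub>R frechet_derivative Z (at ?y) (a v s)) (a w s)
        + G ?y (a v s) (r *\<^sub>R frechet_derivative Z (at ?y) (a w s)))) (at s)"
      by (rule bilinear_family_has_derivative[where x = "\<phi> x", OF metric_family_open[OF G] y metric_family_bilinear[OF G]
          metric_family_diff[OF G y] \<phi>(3)[OF x s, unfolded has_vector_derivative_def] a a])
    moreover have "?D (r *\<^sub>R Z ?y) + G ?y (r *\<^sub>R frechet_derivative Z (at ?y) (a v s)) (a w s)
        + G ?y (a v s) (r *\<^sub>R frechet_derivative Z (at ?y) (a w s)) = r * 0" for r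
      unfolding killing[OF y, of "a v s" "a w s", symmetric]
        linear_cmul[OF linear_frechet_derivative[OF metric_family_diff[OF G y]]]
        linear_cmul[OF metric_family_linear(1)[OF G y]] linear_cmul[OF metric_family_linear(2)[OF G y]]
      by (simp add: algebra_simps)
    ultimately show ?thesis by (simp add: has_derivative_at_withinI)
  qed
  then obtain k where k: "\<And>s. s \<in> ?I \<Longrightarrow> G (\<phi> x s) (a v s) (a w s) = k"
    using has_derivative_zero_constant[of ?I "\<lambda>s. G (\<phi> x s) (a v s) (a w s)"] by auto
  have a0: "a h 0 = h" for h
  proof -
    have "((\<lambda>x. \<phi> x 0) has_derivative (\<lambda>h. h)) (at x)"
      by (rule has_derivative_transform_within_open[OF has_derivative_ident U x]) (simp add: \<phi>(2))
    from fun_cong[OF frechet_derivative_at[OF this], of h] show ?thesis by (simp add: a_def)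
  qed
  have "0 \<in> ?I" using t by auto
  from k[OF this] k[OF t] show ?thesis by (simp add: a0 \<phi>(2)[OF x]) (simp add: a_def)
qed

text \<open>\<open>\<Psi>\<close> replaces one coordinate by \<open>u - u a\<close>, and inverting
  it means recovering that coordinate by the implicit function theorem. Convexity of
  \<open>B\<close> will make the level slice connected.\<close>

lemma straightening:
  fixes u :: "'e::euclidean_space \<Rightarrow> real"
  assumes V: "open V" "a \<in> V" and u: "smooth_on V u" and Du: "frechet_derivative u (at a) v \<noteq> 0" and r: "r > 0"
  obtains U B b and \<Psi> \<Theta> :: "'e \<Rightarrow> 'e" where "a \<in> U" "open U" "U \<subseteq> V \<inter> ball a r" "convex B" "open B" "b \<in> Basis"
    "smooth_on U \<Psi>" "\<And>x. x \<in> U \<Longrightarrow> \<Psi> x \<in> B \<and> \<Theta> (\<Psi> x) = x"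
    "smooth_on B \<Theta>" "\<And>y. y \<in> B \<Longrightarrow> \<Theta> y \<in> U \<and> \<Psi> (\<Theta> y) = y"
    "\<And>x. x \<in> U \<Longrightarrow> \<Psi> x \<bullet> b = u x - u a"
proof -
  have lin: "linear (frechet_derivative u (at a))" by (rule smooth_on_linear_frechet[OF u V(2)])
  \<comment> \<open>A vector of the standard basis is required because slices of hypersurfaces are
    taken along such coordinates.\<close>
  obtain b :: 'e where b: "b \<in> Basis" "frechet_derivative u (at a) b \<noteq> 0"
    using linear_sum_Basis[OF lin, of v] Du by (metis (no_types, lifting) real_scaleR_def mult_zero_right sum.neutral)
  have bb: "b \<bullet> b = 1" using b(1) by simp
  define \<Psi> where "\<Psi> x = x - (x \<bullet> b) *\<^sub>R b + (u x - u a) *\<^sub>R b" for x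
  \<comment> \<open>\<open>q (y, s)\<close> is \<open>y\<close> with its \<open>b\<close>-coordinate
    replaced by \<open>s\<close>; then \<open>\<rho> (y, s) = 0\<close> says that
    \<open>q (y, s)\<close> is a preimage of \<open>y\<close> under \<open>\<Psi>\<close>.\<close>
  define q where "q z = fst z - (fst z \<bullet> b) *\<^sub>R b + snd z *\<^sub>R b" for z :: "'e \<times> real"
  define \<rho> where "\<rho> z = u (q z) - u a - fst z \<bullet> b" for z
  have q_smooth: "smooth_on W q" if "open W" for W
    unfolding q_def
    by (intro smooth_on_add smooth_on_diff smooth_on_scaleR smooth_on_inner smooth_on_const that
        smooth_on_bounded_linear bounded_linear_fst bounded_linear_snd)
  define W where "W = q -` V"
  have W: "open W" unfolding W_def
    by (rule open_vimage[OF V(1) smooth_on_imp_continuous_on[OF q_smooth[OF open_UNIV]]])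
  have \<rho>_smooth: "smooth_on W \<rho>"
    unfolding \<rho>_def
    by (intro smooth_on_diff smooth_on_inner smooth_on_const W smooth_on_bounded_linear bounded_linear_fst
        smooth_on_compose[OF W V(1) u q_smooth[OF W]]) (simp add: W_def image_subset_iff)
  define y0 t0 where "y0 = a - (a \<bullet> b) *\<^sub>R b" and "t0 = a \<bullet> b"
  have y0b: "y0 \<bullet> b = 0" by (simp add: y0_def inner_diff_left bb)
  have q0: "q (y0, t0) = a" by (simp add: q_def y0b) (simp add: y0_def t0_def)
  have W0: "(y0, t0) \<in> W" using q0 V(2) by (simp add: W_def)
  have \<rho>0: "\<rho> (y0, t0) = 0" by (simp add: \<rho>_def q0 y0b)
  have "(q has_derivative (\<lambda>d. fst d - (fst d \<bullet> b) *\<^sub>R b + snd d *\<^sub>R b)) (at (y0, t0))"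
    unfolding q_def by (auto intro!: derivative_eq_intros)
  from has_derivative_compose[OF this, of u "frechet_derivative u (at a)"] smooth_on_has_derivative[OF u V(2)]
  have "((\<lambda>z. u (q z)) has_derivative (\<lambda>d. frechet_derivative u (at a) (fst d - (fst d \<bullet> b) *\<^sub>R b + snd d *\<^sub>R b))) (at (y0, t0))"
    by (simp add: q0)
  then have "(\<rho> has_derivative (\<lambda>d. frechet_derivative u (at a) (fst d - (fst d \<bullet> b) *\<^sub>R b + snd d *\<^sub>R b) - fst d \<bullet> b)) (at (y0, t0))"
    unfolding \<rho>_def by (auto intro!: derivative_eq_intros)
  from fun_cong[OF frechet_derivative_at[OF this], of "(0, 1)"]
  have D\<rho>: "frechet_derivative \<rho> (at (y0, t0)) (0, 1) \<noteq> 0" using b(2) by simp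
  obtain V' \<delta> \<tau> where V': "open V'" "y0 \<in> V'" "\<delta> > 0" "V' \<times> {t0 - \<delta><..<t0 + \<delta>} \<subseteq> W" "smooth_on V' \<tau>" "\<tau> y0 = t0"
    and \<tau>: "\<And>y. y \<in> V' \<Longrightarrow> \<tau> y \<in> {t0 - \<delta><..<t0 + \<delta>}"
      "\<And>y s. y \<in> V' \<Longrightarrow> s \<in> {t0 - \<delta><..<t0 + \<delta>} \<Longrightarrow> \<rho> (y, s) = 0 \<longleftrightarrow> s = \<tau> y"
    by (rule implicit_function_scalar[OF W \<rho>_smooth W0 \<rho>0 D\<rho>], rule that, assumption+)
  define \<Theta> where "\<Theta> y = q (y, \<tau> y)" for y
  have \<Theta>: "smooth_on V' \<Theta>"
    unfolding \<Theta>_def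
    by (rule smooth_on_compose[OF V'(1) open_UNIV q_smooth[OF open_UNIV]])
      (auto intro!: smooth_on_Pair V'(1,5) smooth_on_id)
  have "\<Theta> y0 = a" by (simp add: \<Theta>_def V'(6) q0)
  moreover have "open (V' \<inter> \<Theta> -` ball a r)"
    by (rule continuous_open_preimage[OF smooth_on_imp_continuous_on[OF \<Theta>] V'(1) open_ball])
  ultimately obtain e where e: "e > 0" "ball y0 e \<subseteq> V' \<inter> \<Theta> -` ball a r"
    using openE[of "V' \<inter> \<Theta> -` ball a r" y0] V'(2) r by auto
  define B where "B = ball y0 e"
  have B: "B \<subseteq> V'" "\<And>y. y \<in> B \<Longrightarrow> \<Theta> y \<in> ball a r" using e(2) by (auto simp: B_def)
  \<comment> \<open>The bound on the \<open>b\<close>-coordinate keeps it in the interval where the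
    implicit function theorem gives uniqueness; without it
    \<open>x \<bullet> b = \<tau> (\<Psi> x)\<close> could fail.\<close>
  define U where "U = {x \<in> V. \<bar>x \<bullet> b - t0\<bar> < \<delta> \<and> \<Psi> x \<in> B}"
  have \<Psi>_V: "smooth_on V \<Psi>"
    unfolding \<Psi>_def
    by (intro smooth_on_add smooth_on_diff smooth_on_scaleR smooth_on_inner smooth_on_const smooth_on_id V u)
  have \<Psi>b: "\<Psi> x \<bullet> b = u x - u a" for x by (simp add: \<Psi>_def inner_diff_left inner_add_left bb)
  have \<Psi>\<Theta>: "\<Theta> y \<in> U \<and> \<Psi> (\<Theta> y) = y" if y: "y \<in> B" for y
  proof -
    have yV: "y \<in> V'" using B(1) y by blast
    have "(y, \<tau> y) \<in> W" using V'(4) \<tau>(1)[OF yV] yV by blast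
    then have "\<Theta> y \<in> V" by (simp add: W_def \<Theta>_def)
    have \<Theta>b: "\<Theta> y \<bullet> b = \<tau> y" by (simp add: \<Theta>_def q_def inner_diff_left inner_add_left bb)
    have "\<rho> (y, \<tau> y) = 0" using \<tau>(2)[OF yV \<tau>(1)[OF yV]] by simp
    then have u\<Theta>: "u (\<Theta> y) - u a = y \<bullet> b" by (simp add: \<rho>_def \<Theta>_def)
    have "\<Psi> (\<Theta> y) = \<Theta> y - \<tau> y *\<^sub>R b + (y \<bullet> b) *\<^sub>R b" by (simp add: \<Psi>_def \<Theta>b u\<Theta>)
    also have "\<dots> = y" by (simp add: \<Theta>_def q_def)
    finally have "\<Psi> (\<Theta> y) = y" .
    then show ?thesis using \<open>\<Theta> y \<in> V\<close> \<tau>(1)[OF yV] y by (auto simp: U_def \<Theta>b abs_less_iff)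
  qed
  have \<Theta>\<Psi>: "\<Psi> x \<in> B \<and> \<Theta> (\<Psi> x) = x" if x: "x \<in> U" for x
  proof -
    have x': "x \<in> V" "x \<bullet> b \<in> {t0 - \<delta><..<t0 + \<delta>}" "\<Psi> x \<in> B" using x by (auto simp: U_def abs_less_iff)
    have qx: "q (\<Psi> x, x \<bullet> b) = x"
      by (simp add: q_def \<Psi>b) (simp add: \<Psi>_def)
    then have "\<rho> (\<Psi> x, x \<bullet> b) = 0" by (simp add: \<rho>_def \<Psi>b)
    then have "x \<bullet> b = \<tau> (\<Psi> x)" using \<tau>(2)[OF _ x'(2)] x'(3) B(1) by blast
    then show ?thesis using qx x'(3) by (simp add: \<Theta>_def)
  qed
  have oU: "open U"
  proof -
    have "U = (V \<inter> \<Psi> -` B) \<inter> (\<lambda>x. x \<bullet> b) -` {t0 - \<delta><..<t0 + \<delta>}" by (auto simp: U_def abs_less_iff)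
    moreover have "open (V \<inter> \<Psi> -` B)"
      by (rule continuous_open_preimage[OF smooth_on_imp_continuous_on[OF \<Psi>_V] V(1)]) (simp add: B_def)
    moreover have "open ((\<lambda>x. x \<bullet> b) -` {t0 - \<delta><..<t0 + \<delta>})"
      by (rule open_vimage[OF open_greaterThanLessThan]) (intro continuous_intros)
    ultimately show ?thesis by auto
  qed
  show thesis
  proof (rule that[of U B b \<Psi> \<Theta>])
    have "\<Psi> a = y0" by (simp add: \<Psi>_def y0_def)
    then show "a \<in> U" using V(2) V'(3) e(1) by (simp add: U_def B_def t0_def)
    show "U \<subseteq> V \<inter> ball a r"
    proof
      fix x assume "x \<in> U"
      then show "x \<in> V \<inter> ball a r" using \<Theta>\<Psi>[of x] B(2)[of "\<Psi> x"] by (auto simp: U_def)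
    qed
    show "smooth_on U \<Psi>" by (rule smooth_on_subset[OF \<Psi>_V]) (auto simp: U_def)
    show "smooth_on B \<Theta>" by (rule smooth_on_subset[OF \<Theta> B(1)])
  qed (use oU b(1) \<Theta>\<Psi> \<Psi>\<Theta> \<Psi>b in \<open>auto simp: B_def\<close>)
qed

section \<open>The flow box of the Killing field and its graph\<close>

theorem theorem4:
  fixes A :: "('a::{t2_space, second_countable_topology}, 'e::euclidean_space) chart set"
    and g :: "'a metric"
    and \<Sigma> :: "('a \<times> real) set"
    and N :: "'a \<times> real \<Rightarrow> ('a \<times> real) tangent"
    and x0 :: "'a \<times> real"
  assumes "DIM('e) \<ge> 2"
    and "smooth_atlas A"
    and "riemannian_metric A g"
    and "vertical_helicoid A g \<Sigma> N"
    and "\<forall>x\<in>\<Sigma>. angle A g N x \<noteq> 0"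
    and "\<forall>t. transversal_at A \<Sigma> t \<longrightarrow> totally_geodesic A g (section_at \<Sigma> t)"
    and "x0 \<in> \<Sigma>"
  shows "\<exists>\<epsilon>>0. \<exists>\<Sigma>' L0 \<Gamma>.
    openin (top_of_set \<Sigma>) \<Sigma>' \<and> connected \<Sigma>' \<and> x0 \<in> \<Sigma>' \<and>
    hypersurface A L0 \<and> L0 \<subseteq> fst ` \<Sigma>' \<and>
    local_isometry_group A g (fst ` \<Sigma>') {-\<epsilon><..<\<epsilon>} \<Gamma> \<and>
    \<Sigma>' = vertical_translate (snd x0) (twisting 1 \<Gamma> {-\<epsilon><..<\<epsilon>} L0)"
proof -
  obtain p0 t0 where x0: "x0 = (p0, t0)" by fastforce
  have p0: "(p0, t0) \<in> \<Sigma>" using assms(7) by (simp add: x0)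
  obtain c where c: "c \<in> A" "p0 \<in> cdom c" using atlas_cover[OF assms(2)] by blast
  note A = assms(2,3) c(1) and chart = atlas_chart[OF assms(2) c(1)]
  have S: "hypersurface (prod_atlas A) \<Sigma>" and N: "unit_normal (prod_atlas A) (prod_metric g) \<Sigma> N"
    and angle1: "\<forall>x\<in>\<Sigma>. (angle A g N x)\<^sup>2 \<noteq> 1"
    and sf: "\<And>x d. x \<in> \<Sigma> \<Longrightarrow> d \<in> prod_atlas A \<Longrightarrow> x \<in> cdom d \<Longrightarrow>
      second_form (prod_atlas A) (prod_metric g) d \<Sigma> N x (height_gradient A g \<Sigma> x) (height_gradient A g \<Sigma> x) = 0"
    using assms(4) unfolding vertical_helicoid_def by blast+
  define a where "a = cmap c p0"
  obtain V \<delta> u where V: "open V" "a \<in> V" "V \<subseteq> cmap c ` cdom c" and \<delta>: "\<delta> > 0"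
    and u: "smooth_on V u" "u a = t0" "\<And>x. x \<in> V \<Longrightarrow> u x \<in> {t0 - \<delta><..<t0 + \<delta>}"
      "\<And>x t. x \<in> V \<Longrightarrow> t \<in> {t0 - \<delta><..<t0 + \<delta>} \<Longrightarrow> (cinv c x, t) \<in> \<Sigma> \<longleftrightarrow> t = u x"
      "\<And>x. x \<in> V \<Longrightarrow> \<exists>v. frechet_derivative u (at x) v \<noteq> 0"
      "\<And>x v s. x \<in> V \<Longrightarrow> coord_vector (prod_atlas A) (prod_chart c) (cinv c x, u x) (v, s)
        \<in> tangent_space (prod_atlas A) \<Sigma> (cinv c x, u x) \<longleftrightarrow> s = frechet_derivative u (at x) v"
    by (rule helicoid_graph[OF A N S angle1 assms(5) p0 c(2), folded a_def], rule that, assumption+)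
  note G' = metric_family_coord[OF A]
  obtain grad where grad: "smooth_on V grad"
    "\<And>x w. x \<in> V \<Longrightarrow> metric_coord A g c x (grad x) w = frechet_derivative u (at x) w"
    by (rule smooth_riesz[of V "metric_coord A g c" "\<lambda>x. frechet_derivative u (at x)"])
      (use V u(1) metric_family_form[OF G'] smooth_on_subset[OF metric_family_smooth[OF G'] V(3)]
        smooth_on_linear_frechet[OF u(1)] smooth_on_frechet[OF u(1)] in auto)
  interpret H: helicoid_chart A g c \<Sigma> V \<delta> t0 u grad
    by (rule helicoid_chart.intro[OF A V(1,3) u(1,3,4,5,6) grad])
  have killing: "frechet_derivative (\<lambda>y. metric_coord A g c y v w) (at x) (H.Z x)
      + metric_coord A g c x (frechet_derivative H.Z (at x) v) w
      + metric_coord A g c x v (frechet_derivative H.Z (at x) w) = 0" if x: "x \<in> V" for x v w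
  proof (rule H.killing[OF x])
    \<comment> \<open>All sections are transversal, so the hypothesis on them applies at every
      height.\<close>
    have tg: "totally_geodesic A g (section_at \<Sigma> t)" for t
      using assms(6) helicoid_transversal[OF assms(2,3) N S angle1] by blast
    show "H.hess x v w = 0" if "frechet_derivative u (at x) v = 0" "frechet_derivative u (at x) w = 0" for v w
      by (rule H.hess_level[OF x tg that])
    have P: "(cinv c x, u x) \<in> \<Sigma>" "(cinv c x, u x) \<in> cdom (prod_chart c)"
      using u(4)[OF x u(3)[OF x]] H.V_inv[OF x] by auto
    show "H.hess x (grad x) (grad x) = 0"
      by (rule H.hess_grad[OF x N _ sf[OF P(1) prod_chart_in[OF c(1)] P(2)]]) (use assms(5) P(1) in blast)
  qed
  obtain r T \<phi> where r: "0 < r" "0 < T" and \<phi>_smooth: "smooth_on (ball a r \<times> {-T<..<T}) (\<lambda>(x, t). \<phi> x t)"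
    and rV: "ball a r \<subseteq> V" and \<phi>V: "\<And>x t. x \<in> ball a r \<Longrightarrow> t \<in> {-T<..<T} \<Longrightarrow> \<phi> x t \<in> V"
    and \<phi>0: "\<And>x. x \<in> ball a r \<Longrightarrow> \<phi> x 0 = x"
    and ode: "\<And>x t. x \<in> ball a r \<Longrightarrow> t \<in> {-T<..<T} \<Longrightarrow> (\<phi> x has_vector_derivative H.Z (\<phi> x t)) (at t)"
    and ode': "\<And>x h t. x \<in> ball a r \<Longrightarrow> t \<in> {-T<..<T} \<Longrightarrow>
      ((\<lambda>t. frechet_derivative (\<lambda>x. \<phi> x t) (at x) h) has_vector_derivative
        frechet_derivative H.Z (at (\<phi> x t)) (frechet_derivative (\<lambda>x. \<phi> x t) (at x) h)) (at t)"
    and grp: "\<And>x s t. x \<in> ball a r \<Longrightarrow> s \<in> {-T<..<T} \<Longrightarrow> t \<in> {-T<..<T} \<Longrightarrow> s + t \<in> {-T<..<T} \<Longrightarrow>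
      \<phi> x s \<in> ball a r \<Longrightarrow> \<phi> (\<phi> x s) t = \<phi> x (s + t)"
    by (rule flow_exists[OF V(1,2) H.Z_smooth], rule that, assumption+)
  have u\<phi>: "u (\<phi> x t) = u x + t" if x: "x \<in> ball a r" and t: "t \<in> {-T<..<T}" for x t
  proof -
    have "((\<lambda>s. u (\<phi> x s) - s) has_derivative (\<lambda>h. 0)) (at s within {-T<..<T})" if s: "s \<in> {-T<..<T}" for s
    proof -
      have y: "\<phi> x s \<in> V" by (rule \<phi>V[OF x s])
      have "((\<lambda>s. u (\<phi> x s)) has_derivative (\<lambda>h. frechet_derivative u (at (\<phi> x s)) (h *\<^sub>R H.Z (\<phi> x s)))) (at s)"
        by (rule has_derivative_compose[OF ode[OF x s, unfolded has_vector_derivative_def] smooth_on_has_derivative[OF u(1) y]])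
      then have "((\<lambda>s. u (\<phi> x s)) has_derivative (\<lambda>h. h)) (at s)"
        by (simp add: linear_cmul[OF H.Du_lin[OF y]] H.Du_Z[OF y])
      from has_derivative_diff[OF this has_derivative_ident]
      show ?thesis by (simp add: has_derivative_at_withinI)
    qed
    then obtain k where k: "\<And>s. s \<in> {-T<..<T} \<Longrightarrow> u (\<phi> x s) - s = k"
      using has_derivative_zero_constant[of "{-T<..<T}" "\<lambda>s. u (\<phi> x s) - s"] by auto
    have "0 \<in> {-T<..<T}" using r by simp
    from k[OF this] k[OF t] show ?thesis by (simp add: \<phi>0[OF x])
  qed
  have \<phi>_cont: "continuous_on (ball a r \<times> {-T<..<T}) (\<lambda>z. \<phi> (fst z) (snd z))"
    using smooth_on_imp_continuous_on[OF \<phi>_smooth] by (simp add: split_def)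
  have a_r: "a \<in> ball a r" using r by simp
  \<comment> \<open>The group law adds two times from \<open>(-\<epsilon>, \<epsilon>)\<close>,
    hence control up to \<open>2 * \<epsilon>\<close>.\<close>
  obtain \<epsilon> where \<epsilon>: "\<epsilon> > 0" and near: "\<And>x t. x \<in> ball a \<epsilon> \<Longrightarrow> \<bar>t\<bar> < 2 * \<epsilon> \<Longrightarrow> x \<in> ball a r \<and> t \<in> {-T<..<T} \<and> \<phi> x t \<in> ball a r"
  proof -
    let ?P = "(ball a r \<times> {-T<..<T}) \<inter> (\<lambda>z. \<phi> (fst z) (snd z)) -` ball a r"
    have "open ?P"
      by (rule continuous_open_preimage[OF \<phi>_cont]) (auto intro: open_Times)
    moreover have "(a, 0) \<in> ?P" using r \<phi>0[OF a_r] by simp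
    ultimately obtain e where e: "e > 0" "ball (a, 0) e \<subseteq> ?P" using openE by blast
    show thesis
    proof (rule that[of "e / 4"])
      fix x t assume "x \<in> ball a (e / 4)" "\<bar>t\<bar> < 2 * (e / 4)"
      moreover have "dist (a, 0) (x, t) \<le> dist a x + dist 0 t"
        by (simp add: dist_prod_def sqrt_add_le_add_sqrt[THEN order_trans])
      ultimately have "(x, t) \<in> ball (a, 0) e" by (simp add: dist_real_def)
      then have "(x, t) \<in> ?P" using e(2) by blast
      then show "x \<in> ball a r \<and> t \<in> {-T<..<T} \<and> \<phi> x t \<in> ball a r" by simp
    qed (use e in simp)
  qed
  let ?I = "{-\<epsilon><..<\<epsilon>}"
  have I_T: "t \<in> {-T<..<T}" if "\<bar>t\<bar> < 2 * \<epsilon>" for t using near[of a t] that \<epsilon> by simp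
  have small: "x \<in> ball a r" "\<phi> x t \<in> ball a r" if "x \<in> ball a \<epsilon>" "\<bar>t\<bar> < 2 * \<epsilon>" for x t
    using near that by auto
  obtain v where v: "frechet_derivative u (at a) v \<noteq> 0" using u(5)[OF V(2)] by blast
  \<comment> \<open>Straightened inside \<open>ball a \<epsilon>\<close>, so that every point of the
    slice \<open>L\<close> can be moved for times up to \<open>2 * \<epsilon>\<close>.\<close>
  obtain O1 B b and \<Psi> \<Theta> :: "'e \<Rightarrow> 'e" where O1: "a \<in> O1" "open O1" "O1 \<subseteq> V \<inter> ball a \<epsilon>" and B: "convex B" "open B" and b: "b \<in> Basis"
    and \<Psi>: "smooth_on O1 \<Psi>" "\<And>x. x \<in> O1 \<Longrightarrow> \<Psi> x \<in> B \<and> \<Theta> (\<Psi> x) = x"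
    and \<Theta>: "smooth_on B \<Theta>" "\<And>y. y \<in> B \<Longrightarrow> \<Theta> y \<in> O1 \<and> \<Psi> (\<Theta> y) = y"
    and \<Psi>b: "\<And>x. x \<in> O1 \<Longrightarrow> \<Psi> x \<bullet> b = u x - u a"
    by (rule straightening[OF V(1,2) u(1) v \<epsilon>], rule that, assumption+)
  define L where "L = {z \<in> O1. u z = t0}"
  have L: "z \<in> ball a \<epsilon>" "u z = t0" "z \<in> O1" if "z \<in> L" for z using that O1(3) by (auto simp: L_def)
  \<comment> \<open>The union of the flow lines through \<open>L\<close> over times in
    \<open>?I\<close>, as \<open>U_flow\<close> and \<open>flow_U\<close> confirm. It is described
    by flowing each point back to height \<open>t0\<close>, which shows it to be open.\<close>
  define U where "U = {x \<in> ball a r. \<bar>u x - t0\<bar> < \<epsilon> \<and> \<phi> x (t0 - u x) \<in> O1}"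
  have U_r: "x \<in> ball a r" if "x \<in> U" for x using that by (simp add: U_def)
  have U_flow: "\<exists>z\<in>L. \<exists>s\<in>?I. x = \<phi> z s \<and> s = u x - t0" if x: "x \<in> U" for x
  proof -
    let ?s = "t0 - u x" and ?z = "\<phi> x (t0 - u x)"
    have "\<bar>?s\<bar> < 2 * \<epsilon>" "\<bar>- ?s\<bar> < 2 * \<epsilon>" using x by (auto simp: U_def)
    note s = this[THEN I_T]
    have z: "?z \<in> O1" using x by (simp add: U_def)
    then have zr: "?z \<in> ball a r" using small(1)[of ?z 0] O1(3) \<epsilon> by auto
    have "\<phi> ?z (- ?s) = \<phi> x (?s + - ?s)" by (rule grp[OF U_r[OF x] s _ zr]) (use r in simp)
    then have "\<phi> ?z (u x - t0) = x" using \<phi>0[OF U_r[OF x]] by simp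
    moreover have "?z \<in> L" using z u\<phi>[OF U_r[OF x] s(1)] by (simp add: L_def)
    moreover have "u x - t0 \<in> ?I" using x by (auto simp: U_def abs_less_iff)
    ultimately show ?thesis by (intro bexI[of _ ?z] bexI[of _ "u x - t0"]) auto
  qed
  have flow_U: "\<phi> z s \<in> U" "u (\<phi> z s) = t0 + s" if z: "z \<in> L" and s: "s \<in> ?I" for z s
  proof -
    have s': "\<bar>s\<bar> < 2 * \<epsilon>" "\<bar>- s\<bar> < 2 * \<epsilon>" using s by auto
    note zr = small[OF L(1)[OF z] s'(1)]
    show us: "u (\<phi> z s) = t0 + s" using u\<phi>[OF zr(1) I_T[OF s'(1)]] L(2)[OF z] by simp
    have "\<phi> (\<phi> z s) (- s) = \<phi> z (s + - s)"
      by (rule grp[OF zr(1) I_T[OF s'(1)] I_T[OF s'(2)] _ zr(2)]) (use r in simp)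
    then have "\<phi> (\<phi> z s) (- s) = z" using \<phi>0[OF zr(1)] by simp
    then show "\<phi> z s \<in> U" using zr(2) us L(3)[OF z] s by (simp add: U_def abs_less_iff)
  qed
  \<comment> \<open>\<open>x\<close> is reached from the slice at time \<open>s\<close>, so moving
    it by \<open>t\<close> is moving the slice point by \<open>s + t\<close>.\<close>
  have U_\<phi>: "\<phi> x t \<in> ball a r" if x: "x \<in> U" and t: "t \<in> ?I" for x t
  proof -
    obtain z s where zs: "z \<in> L" "s \<in> ?I" "x = \<phi> z s" using U_flow[OF x] by blast
    have s': "\<bar>s\<bar> < 2 * \<epsilon>" "\<bar>t\<bar> < 2 * \<epsilon>" "\<bar>s + t\<bar> < 2 * \<epsilon>" using zs(2) t by auto
    have "\<phi> x t = \<phi> z (s + t)"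
      unfolding zs(3) by (rule grp[OF small(1)[OF L(1)[OF zs(1)] s'(1)] s'[THEN I_T] small(2)[OF L(1)[OF zs(1)] s'(1)]])
    then show ?thesis using small(2)[OF L(1)[OF zs(1)] s'(3)] by simp
  qed
  have I2: "t \<in> {-T<..<T}" "- t \<in> {-T<..<T}" if "t \<in> ?I" for t using that I_T[of t] I_T[of "- t"] by auto
  have group: "\<phi> (\<phi> x s) t = \<phi> x (s + t)" if "x \<in> U" "s \<in> ?I" "t \<in> ?I" for x s t
    by (rule grp[OF U_r[OF that(1)] I2(1)[OF that(2)] I2(1)[OF that(3)] _ U_\<phi>[OF that(1,2)]])
      (rule I_T, use that in auto)
  have inverse: "\<phi> (\<phi> x t) (- t) = x" if "x \<in> U" "t \<in> ?I" for x t
    using group[OF that, of "- t"] that(2) \<phi>0[OF U_r[OF that(1)]] by simp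
  have oU: "open U"
  proof -
    have "continuous_on (ball a r) u" using smooth_on_imp_continuous_on[OF u(1)] rV continuous_on_subset by blast
    then have o1: "open (ball a r \<inter> u -` {t0 - \<epsilon><..<t0 + \<epsilon>})" and cu: "continuous_on (ball a r \<inter> u -` {t0 - \<epsilon><..<t0 + \<epsilon>}) u"
      by (auto intro!: continuous_open_preimage elim: continuous_on_subset)
    have "continuous_on (ball a r \<inter> u -` {t0 - \<epsilon><..<t0 + \<epsilon>}) (\<lambda>x. (x, t0 - u x))"
      by (intro continuous_intros cu)
    moreover have "(\<lambda>x. (x, t0 - u x)) ` (ball a r \<inter> u -` {t0 - \<epsilon><..<t0 + \<epsilon>}) \<subseteq> ball a r \<times> {-T<..<T}"
      using I2 by fastforce
    ultimately have "continuous_on (ball a r \<inter> u -` {t0 - \<epsilon><..<t0 + \<epsilon>}) (\<lambda>x. \<phi> x (t0 - u x))"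
      using continuous_on_compose2[OF \<phi>_cont] by fastforce
    from continuous_open_preimage[OF this o1 O1(2)]
    have "open ((ball a r \<inter> u -` {t0 - \<epsilon><..<t0 + \<epsilon>}) \<inter> (\<lambda>x. \<phi> x (t0 - u x)) -` O1)" .
    moreover have "U = (ball a r \<inter> u -` {t0 - \<epsilon><..<t0 + \<epsilon>}) \<inter> (\<lambda>x. \<phi> x (t0 - u x)) -` O1"
      by (auto simp: U_def abs_less_iff)
    ultimately show ?thesis by simp
  qed
  have U_im: "U \<subseteq> cmap c ` cdom c" using U_r rV V(3) by blast
  have smooth_t: "smooth_on (ball a r) (\<lambda>x. \<phi> x t)" if t: "t \<in> {-T<..<T}" for t
  proof -
    have "smooth_on (ball a r) (\<lambda>x. (\<lambda>(x, t). \<phi> x t) (x, t))"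
      by (rule smooth_on_compose[OF open_ball _ \<phi>_smooth])
        (use t in \<open>auto intro!: open_Times smooth_on_Pair smooth_on_id smooth_on_const\<close>)
    then show ?thesis by simp
  qed
  have iso: "isometry_on A g (cinv c ` U) (\<lambda>p. cinv c (\<phi> (cmap c p) t))" if t: "t \<in> ?I" for t
  proof (rule isometry_on_coord[OF assms(2) c(1) oU U_im, where h = "\<lambda>y. \<phi> y (- t)"])
    \<comment> \<open>As a preimage under the backward flow, the image is open by
      continuity.\<close>
    have im: "(\<lambda>x. \<phi> x t) ` U = ball a r \<inter> (\<lambda>y. \<phi> y (- t)) -` U"
    proof (intro equalityI subsetI)
      fix y assume y: "y \<in> ball a r \<inter> (\<lambda>y. \<phi> y (- t)) -` U"
      have "\<phi> (\<phi> y (- t)) t = \<phi> y (- t + t)"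
        by (rule grp) (use y I2[OF t] U_r r in auto)
      then have "y = \<phi> (\<phi> y (- t)) t" using \<phi>0 y by simp
      then show "y \<in> (\<lambda>x. \<phi> x t) ` U" using y by blast
    qed (use U_\<phi>[OF _ t] inverse[OF _ t] in auto)
    show "smooth_on U (\<lambda>x. \<phi> x t)" by (rule smooth_on_subset[OF smooth_t[OF I2(1)[OF t]]]) (use U_r in blast)
    have sm: "smooth_on (ball a r) (\<lambda>y. \<phi> y (- t))" by (rule smooth_t[OF I2(2)[OF t]])
    show "open ((\<lambda>x. \<phi> x t) ` U)"
      unfolding im by (rule continuous_open_preimage[OF smooth_on_imp_continuous_on[OF sm] open_ball oU])
    show "smooth_on ((\<lambda>x. \<phi> x t) ` U) (\<lambda>y. \<phi> y (- t))"
      by (rule smooth_on_subset[OF sm]) (use im in blast)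
    show "(\<lambda>x. \<phi> x t) ` U \<subseteq> cmap c ` cdom c" using im rV V(3) by blast
    show "\<phi> (\<phi> x t) (- t) = x" if "x \<in> U" for x by (rule inverse[OF that t])
    show "metric_coord A g c (\<phi> x t) (frechet_derivative (\<lambda>x. \<phi> x t) (at x) v) (frechet_derivative (\<lambda>x. \<phi> x t) (at x) w)
        = metric_coord A g c x v w" if x: "x \<in> U" for x v w
      by (rule flow_preserves_metric[OF H.metric H.Z_smooth killing open_ball \<phi>V \<phi>0 ode ode' U_r[OF x] I2(1)[OF t]])
  qed
  define \<Gamma> where "\<Gamma> t p = cinv c (\<phi> (cmap c p) t)" for t p
  have inv: "cinv c x \<in> cdom c \<and> cmap c (cinv c x) = x" if "x \<in> ball a r" for x
    using H.V_inv rV that by blast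
  note U_chart = chart_inv_image[OF chart oU U_im]
  define \<Sigma>' where "\<Sigma>' = (\<lambda>x. (cinv c x, u x)) ` U"
  have fst_\<Sigma>': "fst ` \<Sigma>' = cinv c ` U" by (auto simp: \<Sigma>'_def image_image)
  define L0 where "L0 = cinv c ` L"
  \<comment> \<open>The time needed to reach \<open>x\<close> from the slice is
    \<open>u x - t0\<close>. A twisting starts at height \<open>0\<close>, so it must be lifted by
    \<open>t0\<close>.\<close>
  have twist: "\<Sigma>' = vertical_translate t0 (twisting 1 \<Gamma> ?I L0)"
  proof (intro equalityI subsetI)
    fix w assume "w \<in> \<Sigma>'"
    then obtain x where x: "x \<in> U" "w = (cinv c x, u x)" by (auto simp: \<Sigma>'_def)
    obtain z s where zs: "z \<in> L" "s \<in> ?I" "x = \<phi> z s" "s = u x - t0" using U_flow[OF x(1)] by blast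
    have "z \<in> ball a r" using small(1)[OF L(1)[OF zs(1)], of 0] \<epsilon> by simp
    then have "\<Gamma> s (cinv c z) = cinv c x" using inv by (simp add: \<Gamma>_def zs(3))
    then have "(cinv c x, 1 * s) \<in> twisting 1 \<Gamma> ?I L0"
      using zs(1,2) unfolding twisting_def L0_def by (auto intro!: exI[of _ "cinv c z"])
    then show "w \<in> vertical_translate t0 (twisting 1 \<Gamma> ?I L0)"
      unfolding vertical_translate_def x(2) using zs(4) by (intro image_eqI[of _ _ "(cinv c x, 1 * s)"]) auto
  next
    fix w assume "w \<in> vertical_translate t0 (twisting 1 \<Gamma> ?I L0)"
    then obtain z s where zs: "z \<in> L" "s \<in> ?I" "w = (\<Gamma> s (cinv c z), t0 + s)"
      unfolding vertical_translate_def twisting_def L0_def by auto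
    have "z \<in> ball a r" using small(1)[OF L(1)[OF zs(1)], of 0] \<epsilon> by simp
    then have "w = (cinv c (\<phi> z s), u (\<phi> z s))"
      using inv flow_U(2)[OF zs(1,2)] by (simp add: \<Gamma>_def zs(3))
    then show "w \<in> \<Sigma>'" using flow_U(1)[OF zs(1,2)] unfolding \<Sigma>'_def by blast
  qed
  \<comment> \<open>Over \<open>U\<close> and within \<open>\<delta>\<close> of \<open>t0\<close>,
    the graph is all there is of \<open>\<Sigma>\<close>; this gives relative openness.\<close>
  have "\<Sigma>' = \<Sigma> \<inter> (cinv c ` U \<times> {t0 - \<delta><..<t0 + \<delta>})"
  proof (intro equalityI subsetI)
    fix w assume "w \<in> \<Sigma>'"
    then obtain x where x: "x \<in> U" "w = (cinv c x, u x)" by (auto simp: \<Sigma>'_def)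
    have "x \<in> V" using U_r[OF x(1)] rV by blast
    then show "w \<in> \<Sigma> \<inter> (cinv c ` U \<times> {t0 - \<delta><..<t0 + \<delta>})" using u(3,4) x by auto
  next
    fix w assume w: "w \<in> \<Sigma> \<inter> (cinv c ` U \<times> {t0 - \<delta><..<t0 + \<delta>})"
    then obtain x t where x: "x \<in> U" "w = (cinv c x, t)" "t \<in> {t0 - \<delta><..<t0 + \<delta>}" by auto
    have "x \<in> V" using U_r[OF x(1)] rV by blast
    then have "t = u x" using u(4)[of x t] x(2,3) w by simp
    then show "w \<in> \<Sigma>'" using x(1,2) by (auto simp: \<Sigma>'_def)
  qed
  then have "openin (top_of_set \<Sigma>) \<Sigma>'"
    unfolding openin_open using open_Times[OF U_chart(2) open_greaterThanLessThan] by blast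
  moreover have "connected \<Sigma>'"
  proof -
    \<comment> \<open>The slice is the continuous image of a hyperplane section of the convex set
      \<open>B\<close>; flowing it over \<open>?I\<close> then gives connectedness of
      \<open>\<Sigma>'\<close>.\<close>
    have "L = \<Theta> ` (B \<inter> {y. b \<bullet> y = 0})"
    proof (intro equalityI subsetI)
      fix z assume z: "z \<in> L"
      then have "\<Psi> z \<in> B \<inter> {y. b \<bullet> y = 0}" "z = \<Theta> (\<Psi> z)"
        using \<Psi>(2)[OF L(3)[OF z]] \<Psi>b[OF L(3)[OF z]] L(2)[OF z] u(2) by (auto simp: inner_commute)
      then show "z \<in> \<Theta> ` (B \<inter> {y. b \<bullet> y = 0})" by blast
    next
      fix z assume "z \<in> \<Theta> ` (B \<inter> {y. b \<bullet> y = 0})"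
      then obtain y where y: "y \<in> B" "b \<bullet> y = 0" "z = \<Theta> y" by auto
      then show "z \<in> L" using \<Theta>(2)[OF y(1)] \<Psi>b[of z] u(2) by (simp add: L_def inner_commute)
    qed
    moreover have "connected (B \<inter> {y. b \<bullet> y = 0})"
      by (intro convex_connected convex_Int B(1) convex_hyperplane)
    moreover have "continuous_on (B \<inter> {y. b \<bullet> y = 0}) \<Theta>"
      using smooth_on_imp_continuous_on[OF \<Theta>(1)] continuous_on_subset by blast
    ultimately have "connected L" using connected_continuous_image by blast
    then have conn: "connected (L \<times> ?I)" by (intro connected_Times) auto
    have LI: "L \<times> ?I \<subseteq> ball a r \<times> {-T<..<T}"
    proof
      fix w assume "w \<in> L \<times> ?I"
      then show "w \<in> ball a r \<times> {-T<..<T}"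
        using small(1)[OF L(1), of "fst w" 0] \<epsilon> I2(1)[of "snd w"] by (auto simp: mem_Times_iff)
    qed
    have c1: "continuous_on (L \<times> ?I) (\<lambda>w. \<phi> (fst w) (snd w))" by (rule continuous_on_subset[OF \<phi>_cont LI])
    have "continuous_on (L \<times> ?I) (\<lambda>w. (cinv c (\<phi> (fst w) (snd w)), t0 + snd w))"
    proof (intro continuous_intros continuous_on_compose2[OF chart_continuous_inv[OF chart] c1])
      show "(\<lambda>w. \<phi> (fst w) (snd w)) ` (L \<times> ?I) \<subseteq> cmap c ` cdom c" using flow_U(1) U_im by auto
    qed
    from connected_continuous_image[OF this conn]
    have "connected ((\<lambda>w. (cinv c (\<phi> (fst w) (snd w)), t0 + snd w)) ` (L \<times> ?I))" .
    moreover have "(\<lambda>w. (cinv c (\<phi> (fst w) (snd w)), t0 + snd w)) ` (L \<times> ?I) = \<Sigma>'"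
    proof (intro equalityI subsetI)
      fix w assume "w \<in> (\<lambda>w. (cinv c (\<phi> (fst w) (snd w)), t0 + snd w)) ` (L \<times> ?I)"
      then obtain z s where "z \<in> L" "s \<in> ?I" "w = (cinv c (\<phi> z s), t0 + s)" by auto
      then show "w \<in> \<Sigma>'" using flow_U[of z s] unfolding \<Sigma>'_def by (intro image_eqI[of _ _ "\<phi> z s"]) auto
    next
      fix w assume "w \<in> \<Sigma>'"
      then obtain x where x: "x \<in> U" "w = (cinv c x, u x)" by (auto simp: \<Sigma>'_def)
      obtain z s where zs: "z \<in> L" "s \<in> ?I" "x = \<phi> z s" "s = u x - t0" using U_flow[OF x(1)] by blast
      have "w = (cinv c (\<phi> z s), t0 + s)" using x(2) zs(4) unfolding zs(3)[symmetric] by simp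
      then show "w \<in> (\<lambda>w. (cinv c (\<phi> (fst w) (snd w)), t0 + snd w)) ` (L \<times> ?I)"
        using zs(1,2) by (intro image_eqI[of _ _ "(z, s)"]) simp_all
    qed
    ultimately show ?thesis by simp
  qed
  moreover
  have aL: "a \<in> L" using O1(1) u(2) by (simp add: L_def)
  have "x0 \<in> \<Sigma>'"
  proof -
    have "\<phi> a 0 \<in> U" using flow_U(1)[OF aL, of 0] \<epsilon> by simp
    then have "a \<in> U" using \<phi>0[OF a_r] by simp
    moreover have "x0 = (cinv c a, u a)" using chart_inv[OF chart c(2)] u(2) by (simp add: x0 a_def)
    ultimately show ?thesis unfolding \<Sigma>'_def by blast
  qed
  moreover have "hypersurface A L0"
    unfolding hypersurface_def
  proof
    fix p assume "p \<in> L0"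
    \<comment> \<open>One straightening chart contains the whole slice, so it serves for every
      \<open>p\<close>.\<close>
    let ?d = "(cinv c ` O1, \<lambda>p. \<Psi> (cmap c p))"
    have O1c: "O1 \<subseteq> cmap c ` cdom c" using O1(3) V(3) by blast
    have d: "?d \<in> maximal_atlas A"
      by (rule diffeo_chart_maximal[OF assms(2) c(1) O1(2) O1c B(2) \<Psi> \<Theta>])
    have O1_inv: "cmap c (cinv c x) = x" if "x \<in> O1" for x using H.V_inv(2) O1(3) that by blast
    have "L0 \<inter> cdom ?d = {q \<in> cdom ?d. cmap ?d q \<bullet> b = 0}"
    proof (intro equalityI subsetI)
      fix q assume "q \<in> L0 \<inter> cdom ?d"
      then obtain z where "z \<in> L" "q = cinv c z" by (auto simp: L0_def)
      then show "q \<in> {q \<in> cdom ?d. cmap ?d q \<bullet> b = 0}"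
        using L[of z] O1_inv[of z] \<Psi>b[of z] u(2) by auto
    next
      fix q assume "q \<in> {q \<in> cdom ?d. cmap ?d q \<bullet> b = 0}"
      then obtain x where x: "x \<in> O1" "q = cinv c x" "\<Psi> (cmap c q) \<bullet> b = 0" by auto
      then have "x \<in> L" using O1_inv[of x] \<Psi>b[of x] u(2) by (simp add: L_def)
      then show "q \<in> L0 \<inter> cdom ?d" using x by (auto simp: L0_def)
    qed
    moreover have "p \<in> cdom ?d" using \<open>p \<in> L0\<close> L(3) by (auto simp: L0_def)
    ultimately show "\<exists>d\<in>maximal_atlas A. p \<in> cdom d \<and> (\<exists>b\<in>Basis. L0 \<inter> cdom d = {q \<in> cdom d. cmap d q \<bullet> b = 0})"
      using d b by blast
  qed
  moreover have "L0 \<subseteq> fst ` \<Sigma>'"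
  proof
    fix p assume "p \<in> L0"
    then obtain z where z: "z \<in> L" "p = cinv c z" by (auto simp: L0_def)
    have "z \<in> ball a r" using small(1)[OF L(1)[OF z(1)], of 0] \<epsilon> by simp
    then have "z \<in> U" using flow_U(1)[OF z(1), of 0] \<phi>0 \<epsilon> by simp
    then show "p \<in> fst ` \<Sigma>'" unfolding fst_\<Sigma>' z(2) by blast
  qed
  moreover have "local_isometry_group A g (fst ` \<Sigma>') ?I \<Gamma>"
    unfolding local_isometry_group_def fst_\<Sigma>'
  proof (intro conjI ballI impI)
    show "isometry_on A g (cinv c ` U) (\<Gamma> t)" if "t \<in> ?I" for t
      using iso[OF that] unfolding \<Gamma>_def[abs_def] .
    show "\<Gamma> 0 p = p" if "p \<in> cinv c ` U" for p
      using that \<phi>0 U_r inv by (auto simp: \<Gamma>_def)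
    show "\<Gamma> (t + s) p = \<Gamma> t (\<Gamma> s p)"
      if p: "p \<in> cinv c ` U" and s: "s \<in> ?I" and t: "t \<in> ?I" for p s t
    proof -
      obtain x where x: "x \<in> U" "p = cinv c x" using p by blast
      have "cmap c (\<Gamma> s p) = \<phi> x s" "\<Gamma> (t + s) p = cinv c (\<phi> x (t + s))"
        using inv[OF U_r[OF x(1)]] inv[OF U_\<phi>[OF x(1) s]] by (simp_all add: \<Gamma>_def x(2))
      then show ?thesis using group[OF x(1) s t] by (simp add: \<Gamma>_def[of t] add.commute)
    qed
    show "smooth_map_on (prod_atlas A) A (cinv c ` U \<times> ?I) (\<lambda>(p, t). \<Gamma> t p)"
      unfolding smooth_map_on_def
    proof (rule ballI, rule bexI[OF _ prod_chart_in[OF c(1)]], rule bexI[OF _ c(1)],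
        rule exI[of _ "cinv c ` U \<times> ?I"], intro conjI)
      show "open (cinv c ` U \<times> ?I)" by (rule open_Times[OF U_chart(2) open_greaterThanLessThan])
      show "cinv c ` U \<times> ?I \<subseteq> cinv c ` U \<times> ?I \<inter> cdom (prod_chart c)" using U_chart(4) by auto
      show "(\<lambda>(p, t). \<Gamma> t p) ` (cinv c ` U \<times> ?I) \<subseteq> cdom c"
      proof (rule image_subsetI)
        fix w assume "w \<in> cinv c ` U \<times> ?I"
        then obtain x t where w: "x \<in> U" "t \<in> ?I" "w = (cinv c x, t)" by auto
        then show "(case w of (p, t) \<Rightarrow> \<Gamma> t p) \<in> cdom c"
          using inv[OF U_r[OF w(1)]] inv[OF U_\<phi>[OF w(1,2)]] by (simp add: \<Gamma>_def)
      qed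
      have im: "cmap (prod_chart c) ` (cinv c ` U \<times> ?I) = U \<times> ?I"
        by (simp add: prod_chart_image U_chart(3))
      have o: "open (U \<times> ?I)" by (rule open_Times[OF oU open_greaterThanLessThan])
      have "smooth_on (U \<times> ?I) (\<lambda>(x, t). \<phi> x t)"
        by (rule smooth_on_subset[OF \<phi>_smooth]) (use U_r I2(1) in auto)
      moreover have "(\<lambda>(x, t). \<phi> x t) z = (cmap c \<circ> (\<lambda>(p, t). \<Gamma> t p) \<circ> cinv (prod_chart c)) z" if "z \<in> U \<times> ?I" for z
      proof -
        obtain x t where z: "x \<in> U" "t \<in> ?I" "z = (x, t)" using \<open>z \<in> U \<times> ?I\<close> by auto
        have "cinv (prod_chart c) z = (cinv c x, t)"
          unfolding z(3) by (rule prod_chart_inv[OF chart]) (use z(1) U_im in blast)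
        then show ?thesis using inv[OF U_r[OF z(1)]] inv[OF U_\<phi>[OF z(1,2)]] by (simp add: \<Gamma>_def z(3))
      qed
      ultimately show "smooth_on (cmap (prod_chart c) ` (cinv c ` U \<times> ?I)) (cmap c \<circ> (\<lambda>(p, t). \<Gamma> t p) \<circ> cinv (prod_chart c))"
        unfolding im by (rule smooth_on_cong[THEN iffD1, OF o, rotated])
    qed
  qed
  ultimately show ?thesis
    using \<epsilon> twist by (intro exI[of _ \<epsilon>] conjI exI[of _ \<Sigma>'] exI[of _ L0] exI[of _ \<Gamma>]) (simp_all add: x0)
qed

end
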